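(* Let $\mathcal G$ be the group of interval exchange transformations of $[0,1)$. If $\mathcal G$ is uniformly perfect (that is, $c(\mathcal G)<\infty$), then $c(\mathcal G)\leq 5$.
   Context: Let $I=[0,1)$. An interval exchange transformation (IET) of $I$ is a right-continuous bijection $f:I\to I$ defined by a finite partition of $I$ into half-open subintervals $[a_i,a_{i+1})$ and a reordering of these intervals by translations. $\mathcal G$ is the group of all IET of $I$ under composition. For a group $G$, a commutator is an element $[f,g]=fgf^{-1}g^{-1}$ with $f,g\in G$, and $[G,G]$ is the subgroup generated by commutators. For $g\in[G,G]$, the commutator length $c_G(g)$ is the least number $c$ such that $g$ is a product of $c$ commutators of $G$, and $c(G)=\sup\{c_G(g): g\in[G,G]\}$. In this convention, $G$ is called uniformly perfect if $c(G)$ is finite (it is not required that $G=[G,G]$). *)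

theory Defs
  imports
    Complex_Main
    "HOL-Library.Extended_Nat"
    "HOL-Algebra.Bij"
    "HOL-Algebra.Generated_Groups"
begin

definition unit_interval :: "real set" where
  "unit_interval = {0..<1}"

(* As in BijGroup, maps are made extensional: they have the value undefined outside [0,1).
   The reordering of the pieces is determined by the translation lengths t i: bijectivity
   says exactly that the translated pieces tile [0,1). *)
definition iet :: "(real \<Rightarrow> real) \<Rightarrow> bool" where
  "iet f \<longleftrightarrow>
     f \<in> Bij unit_interval \<and>
     (\<forall>x\<in>unit_interval. continuous (at_right x) f) \<and>
     (\<exists>(n::nat) (a :: nat \<Rightarrow> real) (t :: nat \<Rightarrow> real).
        a 0 = 0 \<and> a n = 1 \<and> strict_mono_on {0..n} a \<and>
        (\<forall>i<n. \<forall>x\<in>{a i..<a (Suc i)}. f x = x + t i))"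

definition IET_group :: "(real \<Rightarrow> real) monoid" where
  "IET_group = (BijGroup unit_interval)\<lparr>carrier := {f. iet f}\<rparr>"

(* The empty word has product one, so the identity has length 0. An element that is not
   a product of commutators gets length infinity (the infimum of the empty set). *)
definition commutator_length :: "('a, 'b) monoid_scheme \<Rightarrow> 'a \<Rightarrow> enat" where
  "commutator_length G g =
     (INF ws \<in> {ws. set ws \<subseteq> derived_set G (carrier G) \<and>
                     foldr (\<lambda>x y. x \<otimes>\<^bsub>G\<^esub> y) ws \<one>\<^bsub>G\<^esub> = g}. enat (length ws))"

definition commutator_width :: "('a, 'b) monoid_scheme \<Rightarrow> enat" where
  "commutator_width G = (SUP g \<in> derived G (carrier G). commutator_length G g)"

(* G = [G,G] is not required. *)
definition uniformly_perfect :: "('a, 'b) monoid_scheme \<Rightarrow> bool" where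
  "uniformly_perfect G \<longleftrightarrow> commutator_width G < \<infinity>"

end

theory Submission
  imports Defs "HOL-Analysis.Analysis"
begin

text \<open>
  Every interval exchange \<open>g\<close> in the commutator subgroup turns out to be a product of at most three
  commutators, provided that commutator lengths are bounded at all.

  Let \<open>J\<close> be a small neighbourhood of the cut points of \<open>g\<close> and let \<open>h\<close> be the first return map of \<open>g\<close> to
  \<open>J\<close>, extended by the identity.  All orbits of \<open>p = g h\<inverse>\<close> are finite
  (\<open>finite_orbits_return_quotient\<close>).  Such a map has a square root \<open>d\<close> with finite orbits, and \<open>d\<close> is
  conjugate to its inverse by some \<open>s\<close>, so that \<open>p = d d = [d, s]\<close> is a single commutator
  (\<open>finite_orbits_commutator\<close>).  After conjugation, \<open>h\<close> is supported in \<open>[0, 1/m)\<close> for a prescribed \<open>m\<close>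
  (\<open>concentrate\<close>).  There it is a copy of an interval exchange \<open>k\<close> of the whole interval, rescaled by \<open>1/m\<close>.

  The map \<open>k\<close> again lies in the commutator subgroup (\<open>derived_rescale\<close>).  This is the step where the
  Sah-Arnoux-Fathi invariant is needed.  The class of the rotation of \<open>[0, L)\<close> by \<open>a\<close> in the abelianization
  is additive both in \<open>a\<close> and in \<open>L\<close>; call it \<open>w L a\<close>.  For every real \<open>\<alpha>\<close> the sum of \<open>w \<mu> (\<alpha> t)\<close>, where \<open>t\<close>
  runs over the displacements of \<open>f\<close> and \<open>\<mu>\<close> is the length of the set on which the displacement is \<open>t\<close>, is
  a homomorphism in \<open>f\<close>.  For \<open>\<alpha> = 1/2\<close> it agrees with the class of \<open>f\<close>, because it does so on rotations and
  these generate the group (\<open>cls_eq_displacement_sum\<close>).  Rescaling turns \<open>\<mu>\<close> and \<open>t\<close> into \<open>\<mu>/m\<close> and \<open>t/m\<close>, so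
  the class of \<open>k\<close> is the value of the homomorphism with \<open>\<alpha> = m\<^sup>2/2\<close> at \<open>h\<close>, and this is zero.

  If commutator lengths are bounded by \<open>n\<close>, then \<open>k\<close> is a product of at most \<open>n\<close> commutators.  Choosing
  \<open>m > n\<close>, these commutators can be moved to disjoint intervals of length \<open>1/m\<close>, where they form a single
  commutator, at the cost of one further commutator (\<open>diag_two_commutators\<close>).  Hence \<open>h\<close> is a product of
  two commutators, and \<open>g = p h\<close> is a product of three.
\<close>

section \<open>Step functions and interval exchanges\<close>

text \<open>A function on the unit interval that is constant between finitely many cut points.  The
  value at a cut point is the one taken to its right.\<close>

definition step_fun :: "(real \<Rightarrow> 'b) \<Rightarrow> bool" where
  "step_fun \<phi> \<longleftrightarrow> (\<exists>E. finite E \<and>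
     (\<forall>x\<in>unit_interval. \<forall>y\<in>unit_interval. x \<le> y \<longrightarrow> E \<inter> {x<..y} = {} \<longrightarrow> \<phi> x = \<phi> y))"

lemma in_unit_interval [simp]: "x \<in> unit_interval \<longleftrightarrow> 0 \<le> x \<and> x < 1"
  by (auto simp: unit_interval_def)

lemma step_funI:
  assumes "finite E"
    and "\<And>x y. 0 \<le> x \<Longrightarrow> x \<le> y \<Longrightarrow> y < 1 \<Longrightarrow> E \<inter> {x<..y} = {} \<Longrightarrow> \<phi> x = \<phi> y"
  shows "step_fun \<phi>"
  unfolding step_fun_def using assms by (intro exI[of _ E]) auto

lemma step_funE:
  assumes "step_fun \<phi>"
  obtains E where "finite E"
    and "\<And>x y. 0 \<le> x \<Longrightarrow> x \<le> y \<Longrightarrow> y < 1 \<Longrightarrow> E \<inter> {x<..y} = {} \<Longrightarrow> \<phi> x = \<phi> y"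
proof -
  obtain E where "finite E" "\<forall>x\<in>unit_interval. \<forall>y\<in>unit_interval. x \<le> y \<longrightarrow> E \<inter> {x<..y} = {} \<longrightarrow> \<phi> x = \<phi> y"
    using assms unfolding step_fun_def by blast
  then show thesis by (intro that[of E]) auto
qed

lemma step_fun_const [intro, simp]: "step_fun (\<lambda>x. c)"
  by (rule step_funI[of "{}"]) auto

lemma step_fun_less [intro, simp]: "step_fun (\<lambda>x. x < c)"
  by (rule step_funI[of "{c}"]) fastforce+

lemma step_fun_ge [intro, simp]: "step_fun (\<lambda>x. c \<le> x)"
  by (rule step_funI[of "{c}"]) fastforce+

lemma step_fun_cong:
  assumes "step_fun \<phi>" "\<And>x. 0 \<le> x \<Longrightarrow> x < 1 \<Longrightarrow> \<phi> x = \<psi> x"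
  shows "step_fun \<psi>"
proof -
  from assms(1) obtain E where "finite E"
    and "\<And>x y. 0 \<le> x \<Longrightarrow> x \<le> y \<Longrightarrow> y < 1 \<Longrightarrow> E \<inter> {x<..y} = {} \<Longrightarrow> \<phi> x = \<phi> y"
    by (rule step_funE) blast
  then show ?thesis using assms(2) by (intro step_funI[of E]) force+
qed

lemma step_fun_finite_range:
  assumes "step_fun \<phi>"
  shows "finite (\<phi> ` unit_interval)"
proof -
  from assms obtain E where E: "finite E"
    and c: "\<And>x y. 0 \<le> x \<Longrightarrow> x \<le> y \<Longrightarrow> y < 1 \<Longrightarrow> E \<inter> {x<..y} = {} \<Longrightarrow> \<phi> x = \<phi> y"
    by (rule step_funE) blast
  have "\<phi> x = \<phi> (SOME y. 0 \<le> y \<and> y < 1 \<and> E \<inter> {..y} = E \<inter> {..x})" if "0 \<le> x" "x < 1" for x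
  proof -
    define y where "y = (SOME y. 0 \<le> y \<and> y < 1 \<and> E \<inter> {..y} = E \<inter> {..x})"
    have "0 \<le> y \<and> y < 1 \<and> E \<inter> {..y} = E \<inter> {..x}"
      unfolding y_def by (rule someI[of _ x]) (use that in auto)
    moreover from this have "E \<inter> {x<..y} = {}" "E \<inter> {y<..x} = {}" by force+
    ultimately show ?thesis unfolding y_def[symmetric] using c[of x y] c[of y x] that by fastforce
  qed
  then have "\<phi> ` unit_interval \<subseteq> (\<lambda>F. \<phi> (SOME y. 0 \<le> y \<and> y < 1 \<and> E \<inter> {..y} = F)) ` Pow E"
    by (auto simp: image_iff)
  then show ?thesis using E finite_subset by blast
qed

text \<open>The parameter of a family of step functions may itself be chosen by a step function.\<close>

lemma step_fun_select:
  assumes r: "step_fun r" and \<psi>: "\<And>k. k \<in> r ` unit_interval \<Longrightarrow> step_fun (\<psi> k)"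
  shows "step_fun (\<lambda>x. \<psi> (r x) x)"
proof -
  from r obtain E where E: "finite E"
    and c: "\<And>x y. 0 \<le> x \<Longrightarrow> x \<le> y \<Longrightarrow> y < 1 \<Longrightarrow> E \<inter> {x<..y} = {} \<Longrightarrow> r x = r y"
    by (rule step_funE) blast
  have "\<exists>F. finite F \<and> (\<forall>x y. 0 \<le> x \<longrightarrow> x \<le> y \<longrightarrow> y < 1 \<longrightarrow> F \<inter> {x<..y} = {} \<longrightarrow> \<psi> k x = \<psi> k y)"
    if "k \<in> r ` unit_interval" for k
    using \<psi>[OF that] by (elim step_funE) blast
  then obtain F where F: "\<And>k. k \<in> r ` unit_interval \<Longrightarrow> finite (F k)"
    "\<And>k x y. k \<in> r ` unit_interval \<Longrightarrow> 0 \<le> x \<Longrightarrow> x \<le> y \<Longrightarrow> y < 1 \<Longrightarrow> F k \<inter> {x<..y} = {} \<Longrightarrow> \<psi> k x = \<psi> k y"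
    by metis
  show ?thesis
  proof (rule step_funI)
    show "finite (E \<union> \<Union> (F ` r ` unit_interval))"
      using E F(1) step_fun_finite_range[OF r] by blast
    fix x y :: real
    assume xy: "0 \<le> x" "x \<le> y" "y < 1" "(E \<union> \<Union> (F ` r ` unit_interval)) \<inter> {x<..y} = {}"
    have "r x = r y" using xy by (intro c) auto
    moreover have "\<psi> (r x) x = \<psi> (r x) y"
    proof (rule F(2))
      show "r x \<in> r ` unit_interval" using xy by simp
      then show "F (r x) \<inter> {x<..y} = {}" using xy(4) by blast
    qed (use xy in auto)
    ultimately show "\<psi> (r x) x = \<psi> (r y) y" by simp
  qed
qed

lemma step_fun_comp1: "step_fun \<phi> \<Longrightarrow> step_fun (\<lambda>x. F (\<phi> x))"
  by (erule step_fun_select[where \<psi> = "\<lambda>k x. F k"]) (rule step_fun_const)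

lemma step_fun_comp2: "step_fun \<phi> \<Longrightarrow> step_fun \<psi> \<Longrightarrow> step_fun (\<lambda>x. F (\<phi> x) (\<psi> x))"
  by (erule step_fun_select[where \<psi> = "\<lambda>k x. F k (\<psi> x)"]) (erule step_fun_comp1)

lemma step_fun_if: "step_fun P \<Longrightarrow> step_fun \<phi> \<Longrightarrow> step_fun \<psi> \<Longrightarrow> step_fun (\<lambda>x. if P x then \<phi> x else \<psi> x)"
  by (erule step_fun_select[where \<psi> = "\<lambda>k x. if k then \<phi> x else \<psi> x"]) (case_tac k; simp)

lemma step_fun_less_step: "step_fun c \<Longrightarrow> step_fun (\<lambda>x. x < c x)"
  by (erule step_fun_select[where \<psi> = "\<lambda>k x. x < k"]) (rule step_fun_less)

lemma step_fun_finite_Collect: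
  assumes "finite T" "\<And>t. t \<in> T \<Longrightarrow> step_fun (Q t)"
  shows "step_fun (\<lambda>x. {t \<in> T. Q t x})"
  using assms
proof (induction T rule: finite_induct)
  case (insert t T)
  have "step_fun (\<lambda>x. if Q t x then insert t {t \<in> T. Q t x} else {t \<in> T. Q t x})"
    by (intro step_fun_if step_fun_comp1[where F = "insert t"] insert.IH insert.prems) auto
  then show ?case by (rule step_fun_cong) auto
qed simp

lemma step_fun_finite_Ball:
  assumes "finite T" "\<And>t. t \<in> T \<Longrightarrow> step_fun (Q t)"
  shows "step_fun (\<lambda>x. \<forall>t\<in>T. Q t x)"
proof -
  have "step_fun (\<lambda>x. {t \<in> T. Q t x} = T)"
    using step_fun_finite_Collect[OF assms] by (rule step_fun_comp1)
  then show ?thesis by (rule step_fun_cong) auto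
qed

lemma step_fun_affine:
  assumes "step_fun \<phi>" "0 < (k::real)"
  shows "step_fun (\<lambda>x. if k * x + t \<in> unit_interval then \<phi> (k * x + t) else c)"
proof -
  from assms(1) obtain E where E: "finite E"
    and c: "\<And>x y. 0 \<le> x \<Longrightarrow> x \<le> y \<Longrightarrow> y < 1 \<Longrightarrow> E \<inter> {x<..y} = {} \<Longrightarrow> \<phi> x = \<phi> y"
    by (rule step_funE) blast
  show ?thesis
  proof (rule step_funI)
    show "finite ((\<lambda>e. (e - t) / k) ` ({0, 1} \<union> E))" using E by simp
    fix x y :: real
    assume xy: "0 \<le> x" "x \<le> y" "y < 1" "(\<lambda>e. (e - t) / k) ` ({0, 1} \<union> E) \<inter> {x<..y} = {}"
    have le: "k * x \<le> k * y" using xy assms(2) by simp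
    have e: "\<not> (k * x + t < e \<and> e \<le> k * y + t)" if "e \<in> {0, 1} \<union> E" for e
    proof
      assume "k * x + t < e \<and> e \<le> k * y + t"
      then have "(e - t) / k \<in> {x<..y}" using assms(2) by (simp add: field_simps)
      then show False using xy(4) that by blast
    qed
    then have "E \<inter> {k * x + t<..k * y + t} = {}" by auto
    then show "(if k * x + t \<in> unit_interval then \<phi> (k * x + t) else c) =
        (if k * y + t \<in> unit_interval then \<phi> (k * y + t) else c)"
      using e[of 0] e[of 1] le c[of "k * x + t" "k * y + t"] by auto
  qed
qed

lemma step_fun_shift:
  "step_fun \<phi> \<Longrightarrow> step_fun (\<lambda>x. if x + t \<in> unit_interval then \<phi> (x + t) else c)"
  by (drule step_fun_affine[where k = 1 and t = t and c = c]) (simp_all only: mult_1 zero_less_one)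

text \<open>The next two lemmas concern maps \<open>f\<close> whose displacement \<open>f x - x\<close> is a step function, that is,
  right-continuous piecewise translations with finitely many pieces.\<close>

lemma step_fun_compose:
  assumes "step_fun \<phi>" "step_fun (\<lambda>x. f x - x)" "\<And>x. 0 \<le> x \<Longrightarrow> x < 1 \<Longrightarrow> 0 \<le> f x \<and> f x < 1"
  shows "step_fun (\<lambda>x. \<phi> (f x))"
proof -
  have "step_fun (\<lambda>x. if x + (f x - x) \<in> unit_interval then \<phi> (x + (f x - x)) else undefined)"
    by (rule step_fun_select[OF assms(2), of "\<lambda>t x. if x + t \<in> unit_interval then \<phi> (x + t) else undefined"])
       (rule step_fun_shift[OF assms(1)])
  then show ?thesis by (rule step_fun_cong) (use assms(3) in auto)
qed

lemma step_fun_inverse: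
  assumes f: "step_fun (\<lambda>x. f x - x)"
    and g: "\<And>x. 0 \<le> x \<Longrightarrow> x < 1 \<Longrightarrow> 0 \<le> g x \<and> g x < 1"
    and fg: "\<And>x. 0 \<le> x \<Longrightarrow> x < 1 \<Longrightarrow> f (g x) = x"
    and inj: "inj_on f unit_interval"
  shows "step_fun (\<lambda>x. g x - x)"
proof -
  define T where "T = (\<lambda>x. f x - x) ` unit_interval"
  define Q where "Q = (\<lambda>t y. if y + (- t) \<in> unit_interval then f (y + (- t)) - (y + (- t)) = t else False)"
  have "finite T" unfolding T_def using f by (rule step_fun_finite_range)
  moreover have "step_fun (Q t)" for t
    unfolding Q_def by (rule step_fun_shift) (use f in \<open>rule step_fun_comp1\<close>)
  ultimately have "step_fun (\<lambda>y. - the_elem {t \<in> T. Q t y})"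
    by (intro step_fun_comp1[where F = "\<lambda>A. - the_elem A"] step_fun_finite_Collect)
  then show ?thesis
  proof (rule step_fun_cong)
    fix y :: real assume y: "0 \<le> y" "y < 1"
    have "{t \<in> T. Q t y} = {y - g y}"
    proof (intro equalityI subsetI)
      fix t assume "t \<in> {t \<in> T. Q t y}"
      then have "y - t \<in> unit_interval" "f (y - t) = y" by (auto simp: Q_def split: if_splits)
      then have "y - t = g y" using inj_onD[OF inj, of "y - t" "g y"] fg[OF y] g[OF y] by simp
      then show "t \<in> {y - g y}" by simp
    next
      fix t assume "t \<in> {y - g y}"
      then show "t \<in> {t \<in> T. Q t y}" using g[OF y] fg[OF y] by (auto simp: Q_def T_def image_iff intro!: bexI[of _ "g y"])
    qed
    then show "- the_elem {t \<in> T. Q t y} = g y - y" by simp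
  qed
qed

text \<open>This characterization replaces the list of pieces in the definition: an interval exchange is a
  bijection whose displacement is a step function.\<close>

lemma iet_iff: "iet f \<longleftrightarrow> f \<in> Bij unit_interval \<and> step_fun (\<lambda>x. f x - x)"
proof (intro iffI conjI)
  assume "iet f"
  then show "f \<in> Bij unit_interval" by (simp add: iet_def)
  from \<open>iet f\<close> obtain n a t where a: "a 0 = (0::real)" "a (n::nat) = 1" "strict_mono_on {0..n} a"
    and f: "\<And>i x. i < n \<Longrightarrow> a i \<le> x \<Longrightarrow> x < a (Suc i) \<Longrightarrow> f x = x + t i"
    unfolding iet_def by force
  show "step_fun (\<lambda>x. f x - x)"
  proof (rule step_funI)
    show "finite (a ` {..n})" by simp
    fix x y :: real assume xy: "0 \<le> x" "x \<le> y" "y < 1" "a ` {..n} \<inter> {x<..y} = {}"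
    define S where "S = {i. i \<le> n \<and> a i \<le> x}"
    define i where "i = Max S"
    have S: "finite S" "0 \<in> S" unfolding S_def using a xy by auto
    then have "i \<in> S" unfolding i_def by (intro Max_in) auto
    then have i: "i < n" "a i \<le> x" unfolding S_def using a xy by (auto simp: le_less)
    have "Suc i \<notin> S" using S unfolding i_def by (meson Max_ge Suc_n_not_le_n)
    then have "x < a (Suc i)" unfolding S_def using i by auto
    moreover have "y < a (Suc i)"
    proof (rule ccontr)
      assume "\<not> y < a (Suc i)"
      then have "a (Suc i) \<in> a ` {..n} \<inter> {x<..y}" using i \<open>x < a (Suc i)\<close> by auto
      then show False using xy(4) by blast
    qed
    ultimately show "f x - x = f y - y" using f[of i x] f[of i y] i xy by simp
  qed
next
  assume f: "f \<in> Bij unit_interval \<and> step_fun (\<lambda>x. f x - x)"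
  then obtain E0 where E0: "finite E0"
    and c0: "\<And>x y. 0 \<le> x \<Longrightarrow> x \<le> y \<Longrightarrow> y < 1 \<Longrightarrow> E0 \<inter> {x<..y} = {} \<Longrightarrow> f x - x = f y - y"
    by (auto elim: step_funE)
  \<comment> \<open>The end points of the pieces are the sorted cut points, with 0 and 1 added.\<close>
  define E where "E = insert 0 (insert 1 (E0 \<inter> {0..1}))"
  have E: "finite E" "E \<subseteq> {0..1}" "0 \<in> E" "1 \<in> E" using E0 by (auto simp: E_def)
  have c: "f x - x = f y - y" if "0 \<le> x" "x \<le> y" "y < 1" "E \<inter> {x<..y} = {}" for x y
    using that by (intro c0) (auto simp: E_def)
  define l where "l = sorted_list_of_set E"
  have l: "sorted_wrt (<) l" "set l = E" "l \<noteq> []" "length l = card E"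
    unfolding l_def using E by auto
  define n where "n = length l - 1"
  have lm: "l ! i < l ! j" if "i < j" "j \<le> n" for i j
    using l that by (intro sorted_wrt_nth_less[OF l(1)]) (auto simp: n_def)
  obtain i0 where i0: "i0 < length l" "l ! i0 = 0" using E l by (metis in_set_conv_nth)
  have l0: "l ! 0 = 0"
  proof (cases i0)
    case (Suc k)
    then have "l ! 0 < 0" using lm[of 0 i0] i0 by (auto simp: n_def)
    moreover have "l ! 0 \<in> E" using l by (metis length_greater_0_conv nth_mem)
    ultimately show ?thesis using E by auto
  qed (use i0 in simp)
  obtain i1 where i1: "i1 < length l" "l ! i1 = 1" using E l by (metis in_set_conv_nth)
  have l1: "l ! n = 1"
  proof (cases "i1 = n")
    case False
    then have "1 < l ! n" using lm[of i1 n] i1 by (auto simp: n_def)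
    moreover have "l ! n \<in> E" using l by (metis n_def diff_less length_greater_0_conv nth_mem zero_less_one)
    ultimately show ?thesis using E by auto
  qed (use i1 in simp)
  have pieces: "f x = x + (f (l ! i) - l ! i)" if "i < n" "x \<in> {l ! i..<l ! Suc i}" for i x
  proof -
    have "0 \<le> l ! i" using l0 lm[of 0 i] that by (cases i) auto
    moreover have "l ! Suc i \<le> 1" using l1 lm[of "Suc i" n] that by (cases "Suc i = n") auto
    moreover have "E \<inter> {l ! i<..x} = {}"
    proof (rule ccontr)
      assume "E \<inter> {l ! i<..x} \<noteq> {}"
      then obtain j where j: "j < length l" "l ! i < l ! j" "l ! j \<le> x"
        using l by (auto simp: in_set_conv_nth dest!: equalityD2 subsetD)
      have "j \<le> n" using j by (simp add: n_def)
      then have "i < j" using j(2) lm[of j i] that by (metis less_imp_le linorder_neqE_nat not_less)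
      then have "Suc i = j \<or> Suc i < j" by auto
      then have "l ! Suc i \<le> l ! j" using lm[of "Suc i" j] \<open>j \<le> n\<close> by auto
      then show False using j that by auto
    qed
    ultimately show ?thesis using c[of "l ! i" x] that by auto
  qed
  have cont: "continuous (at_right x) f" if x: "x \<in> unit_interval" for x
  proof -
    define S where "S = E \<inter> {x<..}"
    have S: "finite S" "S \<noteq> {}" unfolding S_def using E x by auto
    define y where "y = Min S"
    have y: "y \<in> S" "\<And>e. e \<in> S \<Longrightarrow> y \<le> e" unfolding y_def using S by auto
    then have y': "x < y" "y \<le> 1" unfolding S_def using E by auto
    have "f z = z + (f x - x)" if "z \<in> {x<..<y}" for z
    proof -
      have "E \<inter> {x<..z} = {}" using y(2) that unfolding S_def by force
      then show ?thesis using c[of x z] that x y' by auto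
    qed
    then have "eventually (\<lambda>z. f z = z + (f x - x)) (at_right x)"
      using eventually_at_right_real[OF y'(1)] by (rule eventually_mono[rotated])
    moreover have "((\<lambda>z. z + (f x - x)) \<longlongrightarrow> x + (f x - x)) (at_right x)"
      by (intro tendsto_intros)
    ultimately have "(f \<longlongrightarrow> x + (f x - x)) (at_right x)"
      using tendsto_cong by fastforce
    then show ?thesis by (simp add: continuous_within)
  qed
  show "iet f" unfolding iet_def
  proof (intro conjI ballI exI)
    show "f \<in> Bij unit_interval" using f by simp
    show "(\<lambda>i. l ! i) 0 = 0" "(\<lambda>i. l ! i) n = 1" using l0 l1 by auto
    show "strict_mono_on {0..n} (\<lambda>i. l ! i)" using lm by (auto intro!: strict_mono_onI)
    show "\<forall>i<n. \<forall>x\<in>{l ! i..<l ! Suc i}. f x = x + (f (l ! i) - l ! i)" using pieces by blast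
  qed (use cont in auto)
qed


section \<open>The group of interval exchanges, pointwise\<close>

abbreviation iet_mult :: "(real \<Rightarrow> real) \<Rightarrow> (real \<Rightarrow> real) \<Rightarrow> real \<Rightarrow> real" (infixl "\<odot>" 70) where
  "f \<odot> g \<equiv> f \<otimes>\<^bsub>IET_group\<^esub> g"

abbreviation iet_inv :: "(real \<Rightarrow> real) \<Rightarrow> real \<Rightarrow> real" where
  "iet_inv f \<equiv> inv\<^bsub>IET_group\<^esub> f"

abbreviation iet_commutators :: "(real \<Rightarrow> real) set" where
  "iet_commutators \<equiv> derived_set IET_group (carrier IET_group)"

abbreviation iet_derived :: "(real \<Rightarrow> real) set" where
  "iet_derived \<equiv> derived IET_group (carrier IET_group)"

lemma iet_bij: "iet f \<Longrightarrow> bij_betw f unit_interval unit_interval"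
  by (simp add: iet_iff Bij_def)

lemma iet_step: "iet f \<Longrightarrow> step_fun (\<lambda>x. f x - x)"
  by (simp add: iet_iff)

lemma iet_range: "iet f \<Longrightarrow> x \<in> unit_interval \<Longrightarrow> f x \<in> unit_interval"
  by (erule bij_betw_apply[OF iet_bij])

lemma iet_inj: "iet f \<Longrightarrow> f x = f y \<Longrightarrow> x \<in> unit_interval \<Longrightarrow> y \<in> unit_interval \<Longrightarrow> x = y"
  using iet_bij[of f] unfolding bij_betw_def inj_on_def by blast

lemma iet_restrictI:
  assumes "bij_betw \<phi> unit_interval unit_interval" "step_fun (\<lambda>x. \<phi> x - x)"
  shows "iet (restrict \<phi> unit_interval)"
proof -
  have "bij_betw (restrict \<phi> unit_interval) unit_interval unit_interval"
    using assms(1) by (subst bij_betw_cong[where g = \<phi>]) (simp_all del: in_unit_interval)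
  moreover have "step_fun (\<lambda>x. restrict \<phi> unit_interval x - x)"
    using assms(2) by (rule step_fun_cong) simp
  ultimately show ?thesis by (simp add: iet_iff Bij_def)
qed

lemma iet_eqI:
  assumes "iet f" "iet g" "\<And>x. x \<in> unit_interval \<Longrightarrow> f x = g x"
  shows "f = g"
  using assms by (intro extensionalityI[of f unit_interval g]) (auto simp: iet_iff Bij_def)

lemma iet_subgroup: "subgroup {f. iet f} (BijGroup unit_interval)"
proof -
  interpret group "BijGroup unit_interval" by (rule group_BijGroup)
  show ?thesis
  proof (rule subgroupI)
    show "{f. iet f} \<subseteq> carrier (BijGroup unit_interval)"
      by (auto simp: iet_iff BijGroup_def)
    have "iet (\<lambda>x\<in>unit_interval. x)"
      by (rule iet_restrictI) (auto simp: bij_betw_def)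
    then show "{f. iet f} \<noteq> {}" by blast
  next
    fix f assume "f \<in> {f. iet f}"
    then have f: "iet f" by simp
    then have b: "bij_betw f unit_interval unit_interval" by (rule iet_bij)
    have "iet (restrict (inv_into unit_interval f) unit_interval)"
    proof (rule iet_restrictI)
      show "bij_betw (inv_into unit_interval f) unit_interval unit_interval"
        using b by (rule bij_betw_inv_into)
      then have r: "0 \<le> inv_into unit_interval f x \<and> inv_into unit_interval f x < 1" if "0 \<le> x" "x < 1" for x
        using bij_betw_apply[of _ unit_interval unit_interval x] that by fastforce
      have fr: "f (inv_into unit_interval f x) = x" if "0 \<le> x" "x < 1" for x
        using b that by (intro f_inv_into_f) (auto simp: bij_betw_def)
      show "step_fun (\<lambda>x. inv_into unit_interval f x - x)"
        by (rule step_fun_inverse[OF iet_step[OF f] r fr bij_betw_imp_inj_on[OF b]])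
    qed
    then show "inv\<^bsub>BijGroup unit_interval\<^esub> f \<in> {f. iet f}"
      using f by (simp add: inv_BijGroup iet_iff)
  next
    fix f g assume "f \<in> {f. iet f}" "g \<in> {f. iet f}"
    then have f: "iet f" and g: "iet g" by auto
    have "iet (restrict (f \<circ> g) unit_interval)"
    proof (rule iet_restrictI)
      show "bij_betw (f \<circ> g) unit_interval unit_interval"
        using iet_bij[OF g] iet_bij[OF f] by (rule bij_betw_trans)
      have "step_fun (\<lambda>x. f (g x) - g x)"
        using iet_range[OF g] by (intro step_fun_compose[OF iet_step[OF f] iet_step[OF g]]) auto
      then have "step_fun (\<lambda>x. (f (g x) - g x) + (g x - x))"
        by (intro step_fun_comp2[where F = "(+)"] iet_step[OF g])
      then show "step_fun (\<lambda>x. (f \<circ> g) x - x)" by simp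
    qed
    then show "f \<otimes>\<^bsub>BijGroup unit_interval\<^esub> g \<in> {f. iet f}"
      using f g by (simp add: BijGroup_def iet_iff compose_def o_def del: in_unit_interval)
  qed
qed

lemma carrier_IET [simp]: "carrier IET_group = {f. iet f}"
  by (simp add: IET_group_def)

interpretation IET: group IET_group
  unfolding IET_group_def
  by (rule subgroup.subgroup_is_group[OF iet_subgroup group_BijGroup])

lemma iet_one: "iet \<one>\<^bsub>IET_group\<^esub>"
  using IET.one_closed by simp

lemma iet_mult: "iet f \<Longrightarrow> iet g \<Longrightarrow> iet (f \<odot> g)"
  using IET.m_closed by simp

lemma iet_inv: "iet f \<Longrightarrow> iet (iet_inv f)"
  using IET.inv_closed by simp

lemma iet_one_app [simp]: "x \<in> unit_interval \<Longrightarrow> \<one>\<^bsub>IET_group\<^esub> x = x"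
  by (simp add: IET_group_def BijGroup_def)

lemma iet_mult_app [simp]: "iet f \<Longrightarrow> iet g \<Longrightarrow> x \<in> unit_interval \<Longrightarrow> (f \<odot> g) x = f (g x)"
  by (simp add: IET_group_def BijGroup_def iet_iff compose_def del: in_unit_interval)

lemma iet_inv_app1 [simp]: "iet f \<Longrightarrow> x \<in> unit_interval \<Longrightarrow> iet_inv f (f x) = x"
  using iet_mult_app[of "iet_inv f" f x] by (simp add: iet_inv)

lemma iet_inv_app2 [simp]: "iet f \<Longrightarrow> x \<in> unit_interval \<Longrightarrow> f (iet_inv f x) = x"
  using iet_mult_app[of f "iet_inv f" x] by (simp add: iet_inv)

lemma iet_restrict_inverseI:
  assumes "step_fun (\<lambda>x. \<phi> x - x)"
    and "\<And>x. x \<in> unit_interval \<Longrightarrow> \<phi> x \<in> unit_interval"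
    and "\<And>x. x \<in> unit_interval \<Longrightarrow> \<psi> x \<in> unit_interval"
    and "\<And>x. x \<in> unit_interval \<Longrightarrow> \<psi> (\<phi> x) = x"
    and "\<And>x. x \<in> unit_interval \<Longrightarrow> \<phi> (\<psi> x) = x"
  shows "iet (restrict \<phi> unit_interval)"
  using assms by (intro iet_restrictI bij_betw_byWitness[of _ \<psi>]) blast+

section \<open>Interval exchanges with finite orbits are commutators\<close>

text \<open>Every point of the unit interval is periodic; no common period is required.\<close>

definition finite_orbits :: "(real \<Rightarrow> real) \<Rightarrow> bool" where
  "finite_orbits p \<longleftrightarrow> (\<forall>x\<in>unit_interval. \<exists>k>0. (p ^^ k) x = x)"

lemma iet_funpow_range: "iet p \<Longrightarrow> x \<in> unit_interval \<Longrightarrow> (p ^^ n) x \<in> unit_interval"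
  by (induction n) (simp_all add: iet_range[of p] del: in_unit_interval)

lemma iet_funpow_inj:
  "iet p \<Longrightarrow> x \<in> unit_interval \<Longrightarrow> y \<in> unit_interval \<Longrightarrow> (p ^^ n) x = (p ^^ n) y \<Longrightarrow> x = y"
proof (induction n arbitrary: x y)
  case (Suc n)
  have "(p ^^ n) x = (p ^^ n) y"
    by (rule iet_inj[of p])
       (use Suc.prems iet_funpow_range[OF Suc.prems(1,2)] iet_funpow_range[OF Suc.prems(1,3)] in simp_all)
  then show ?case by (rule Suc.IH[OF Suc.prems(1-3)])
qed simp

lemma funpow_period: "(p ^^ n) x = x \<Longrightarrow> (p ^^ (n * k)) x = x"
  by (induction k) (simp_all add: funpow_add)

text \<open>The set \<open>E\<close> is stable under \<open>p\<close>, which translates every interval free of points of \<open>E\<close> to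
  another such interval.\<close>

definition permutes_cells :: "(real \<Rightarrow> real) \<Rightarrow> real set \<Rightarrow> bool" where
  "permutes_cells p E \<longleftrightarrow> p ` E = E \<and>
     (\<forall>x y. 0 \<le> x \<longrightarrow> x \<le> y \<longrightarrow> y < 1 \<longrightarrow> E \<inter> {x<..y} = {} \<longrightarrow>
        p y - p x = y - x \<and> E \<inter> {p x<..p y} = {})"

text \<open>The orbits of the cut points form a finite invariant set, and its cells are permuted.\<close>

lemma finite_orbits_cells:
  assumes p: "iet p" "finite_orbits p"
  obtains E where "finite E" "E \<subseteq> unit_interval" "0 \<in> E" "permutes_cells p E"
proof -
  obtain E0 where E0: "finite E0"
    and c0: "\<And>x y. 0 \<le> x \<Longrightarrow> x \<le> y \<Longrightarrow> y < 1 \<Longrightarrow> E0 \<inter> {x<..y} = {} \<Longrightarrow> p x - x = p y - y"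
    using iet_step[OF p(1)] by (auto elim: step_funE)
  define B where "B = insert 0 (E0 \<inter> unit_interval)"
  define E where "E = (\<Union>e\<in>B. range (\<lambda>k. (p ^^ k) e))"
  have B: "finite B" "B \<subseteq> unit_interval" using E0 by (auto simp: B_def)
  have "finite (range (\<lambda>k. (p ^^ k) e))" if "e \<in> B" for e
  proof -
    have "e \<in> unit_interval" using B that by blast
    then obtain n where n: "n > 0" "(p ^^ n) e = e"
      using p(2) unfolding finite_orbits_def by blast
    have "(p ^^ k) e = (p ^^ (k mod n)) e" for k
      using funpow_mod_eq[OF n(2)] by simp
    then have "range (\<lambda>k. (p ^^ k) e) \<subseteq> (\<lambda>k. (p ^^ k) e) ` {..<n}"
      using n(1) by (metis (no_types, lifting) image_subsetI imageI lessThan_iff mod_less_divisor)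
    then show ?thesis by (rule finite_subset) simp
  qed
  then have fin: "finite E" unfolding E_def using B by blast
  have sub: "E \<subseteq> unit_interval"
    using iet_funpow_range[OF p(1)] B(2) unfolding E_def by blast
  have "B \<subseteq> E"
  proof
    fix e assume "e \<in> B"
    moreover have "e = (p ^^ 0) e" by simp
    ultimately show "e \<in> E" unfolding E_def by blast
  qed
  have "p ` E \<subseteq> E"
  proof
    fix y assume "y \<in> p ` E"
    then obtain e k where "e \<in> B" "y = p ((p ^^ k) e)" unfolding E_def by blast
    then have "y = (p ^^ Suc k) e" by simp
    with \<open>e \<in> B\<close> show "y \<in> E" unfolding E_def by blast
  qed
  moreover have "inj_on p E"
    using sub iet_inj[OF p(1)] by (meson inj_onI subsetD)
  ultimately have inv: "p ` E = E" using fin by (simp add: endo_inj_surj)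
  show thesis
  proof (rule that[OF fin sub])
    show "0 \<in> E" using \<open>B \<subseteq> E\<close> by (auto simp: B_def)
    show "permutes_cells p E" unfolding permutes_cells_def
    proof (intro conjI[OF inv] allI impI)
    fix x y :: real assume xy: "0 \<le> x" "x \<le> y" "y < 1" "E \<inter> {x<..y} = {}"
    have tr: "p z - p x = z - x" if "x \<le> z" "z \<le> y" for z
    proof -
      have "E0 \<inter> {x<..z} = {}" using xy that \<open>B \<subseteq> E\<close> by (force simp: B_def)
      then show ?thesis using c0[of x z] xy that by auto
    qed
    moreover have "E \<inter> {p x<..p y} = {}"
    proof (rule ccontr)
      assume "E \<inter> {p x<..p y} \<noteq> {}"
      then obtain e where e: "e \<in> E" "p x < e" "e \<le> p y" by auto
      define z where "z = x + (e - p x)"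
      have z: "x < z" "z \<le> y" using e tr[of y] xy unfolding z_def by auto
      then have "p z = e" using tr[of z] unfolding z_def by auto
      moreover obtain e' where "e' \<in> E" "e = p e'" using e inv by blast
      ultimately have "z = e'" using iet_inj[OF p(1), of z e'] z xy sub by auto
      then show False using z xy \<open>e' \<in> E\<close> by auto
    qed
    ultimately show "p y - p x = y - x \<and> E \<inter> {p x<..p y} = {}" using xy by blast
    qed
  qed
qed

text \<open>A square root: halve every cell, send the left half to the right half of the same cell, and
  the right half to the left half of the image cell.\<close>

lemma finite_orbits_sqrt:
  assumes p: "iet p" "finite_orbits p"
  obtains d where "iet d" "finite_orbits d" "\<And>x. x \<in> unit_interval \<Longrightarrow> d (d x) = p x"
proof -
  obtain E where E: "finite E" "E \<subseteq> unit_interval" "0 \<in> E" "p ` E = E"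
    and cell: "\<And>x y. 0 \<le> x \<Longrightarrow> x \<le> y \<Longrightarrow> y < 1 \<Longrightarrow> E \<inter> {x<..y} = {} \<Longrightarrow>
           p y - p x = y - x \<and> E \<inter> {p x<..p y} = {}"
    using finite_orbits_cells[OF p] unfolding permutes_cells_def by metis
  define a where "a x = Max {e \<in> E. e \<le> x}" for x
  define b where "b x = Min (insert 1 {e \<in> E. x < e})" for x
  have a: "a x \<in> E" "a x \<le> x" "0 \<le> a x" if "0 \<le> x" for x
  proof -
    have "a x \<in> {e \<in> E. e \<le> x}" unfolding a_def using E that by (intro Max_in) auto
    then show "a x \<in> E" "a x \<le> x" "0 \<le> a x" using E by auto
  qed
  have b: "x < b x" "b x \<le> 1" "b x \<in> insert 1 E" if "x < 1" for x
  proof -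
    have "b x \<in> insert 1 {e \<in> E. x < e}" unfolding b_def using E by (intro Min_in) auto
    then show "x < b x" "b x \<le> 1" "b x \<in> insert 1 E" using E that by auto
  qed
  have ab: "E \<inter> {a x<..<b x} = {}" if "0 \<le> x" "x < 1" for x
  proof -
    have "e \<le> a x" if "e \<in> E" "e \<le> x" for e
      unfolding a_def using E that by (intro Max_ge) auto
    moreover have "b x \<le> e" if "e \<in> E" "x < e" for e
      unfolding b_def using E that by (intro Min_le) auto
    ultimately show ?thesis by force
  qed
  have a_eq: "a x = e" if "e \<in> E" "e \<le> x" "E \<inter> {e<..x} = {}" for e x
    unfolding a_def using E that by (intro Max_eqI) force+
  have same: "a y = a x \<and> b y = b x" if "0 \<le> x" "x < 1" "a x \<le> y" "y < b x" for x y
  proof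
    show "a y = a x" using that a[of x] ab[of x] by (intro a_eq) force+
    show "b y = b x" unfolding b_def[of y]
    proof (rule Min_eqI)
      show "b x \<in> insert 1 {e \<in> E. y < e}" using b[of x] that by auto
      show "b x \<le> e" if "e \<in> insert 1 {e \<in> E. y < e}" for e
        using that b(2)[of x] ab[of x] a[of x] \<open>0 \<le> x\<close> \<open>x < 1\<close> \<open>a x \<le> y\<close> by force
    qed (use E in simp)
  qed
  have tr: "p y - p x = y - x" if "0 \<le> x" "x < 1" "a x \<le> y" "y < b x" for x y
  proof -
    have "p z - p (a x) = z - a x" if "a x \<le> z" "z < b x" for z
    proof -
      have "E \<inter> {a x<..z} = {}" using ab[of x] \<open>0 \<le> x\<close> \<open>x < 1\<close> that by force
      then show ?thesis using cell[of "a x" z] a[of x] b[of x] that \<open>0 \<le> x\<close> \<open>x < 1\<close> by auto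
    qed
    from this[of x] this[of y] show ?thesis using that a[of x] b[of x] by auto
  qed
  have rng: "0 \<le> p x" "p x < 1" if "0 \<le> x" "x < 1" for x
    using iet_range[OF p(1), of x] that by auto
  have ap: "a (p x) = p (a x)" if "0 \<le> x" "x < 1" for x
  proof (rule a_eq)
    show "p (a x) \<in> E" using a[of x] E that by blast
    show "p (a x) \<le> p x" using tr[of x "a x"] a[of x] b[of x] that by auto
    have "E \<inter> {a x<..x} = {}" using ab[of x] b[of x] that by force
    then show "E \<inter> {p (a x)<..p x} = {}" using cell[of "a x" x] a[of x] that by auto
  qed
  define len where "len x = b x - a x" for x
  \<comment> \<open>The length of the cell cannot decrease along an orbit, and the orbit is periodic.\<close>
  have len_mono: "len x \<le> len (p x)" if x: "0 \<le> x" "x < 1" for x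
  proof -
    have "p x + (b x - x) \<le> b (p x)"
    proof (rule ccontr)
      assume "\<not> ?thesis"
      then have *: "b (p x) < p x + (b x - x)" by simp
      define z where "z = x + (b (p x) - p x)"
      have z: "x < z" "z < b x" using * b[of "p x"] rng[of x] x unfolding z_def by auto
      have "p z = b (p x)" using tr[of x z] z a[of x] x unfolding z_def by auto
      moreover have "p z < 1" using rng[of z] z x b[of x] by auto
      ultimately have "b (p x) \<in> E" using b[of "p x"] rng[of x] x by auto
      have "a x < z" using a[of x] z x by auto
      have "E \<inter> {a x<..z} = {}" using ab[of x] z x by force
      then have "E \<inter> {p (a x)<..p z} = {}" using cell[of "a x" z] a[of x] x z b[of x] \<open>a x < z\<close> by auto
      moreover have "p (a x) < p z" using tr[of x "a x"] tr[of x z] a[of x] x z b[of x] by auto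
      ultimately show False using \<open>b (p x) \<in> E\<close> \<open>p z = b (p x)\<close> by auto
    qed
    then show ?thesis using ap[OF x] tr[of x "a x"] a[of x] b[of x] x unfolding len_def by auto
  qed
  have len_p: "len (p x) = len x" if x: "0 \<le> x" "x < 1" for x
  proof -
    have mono: "len y \<le> len ((p ^^ k) y)" if "0 \<le> y" "y < 1" for k y
    proof (induction k)
      case (Suc k)
      then show ?case using len_mono[of "(p ^^ k) y"] iet_funpow_range[OF p(1), of y k] that by auto
    qed simp
    obtain k where "k > 0" "(p ^^ k) x = x" using p(2)[unfolded finite_orbits_def, rule_format, of x] x by auto
    then have "(p ^^ (k - 1)) (p x) = x"
      by (metis Suc_pred' comp_apply funpow_Suc_right)
    then show ?thesis using mono[of "p x" "k - 1"] rng[of x] x len_mono[of x] by auto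
  qed
  define d where "d x = (if x < a x + len x / 2 then x + len x / 2 else p x - len x / 2)" for x
  have len_pos: "0 < len x" if "0 \<le> x" "x < 1" for x
    using a[of x] b[of x] that unfolding len_def by auto
  have d1: "a (d x) = a x" "b (d x) = b x" "a x + len x / 2 \<le> d x" "d x < b x" "d x = x + len x / 2"
    if "0 \<le> x" "x < 1" "x < a x + len x / 2" for x
  proof -
    show "d x = x + len x / 2" using that by (simp add: d_def)
    then show 1: "a x + len x / 2 \<le> d x" "d x < b x"
      using that a[of x] by (auto simp: len_def field_simps)
    show "a (d x) = a x" "b (d x) = b x"
      using same[of x "d x"] 1 that len_pos[of x] by auto
  qed
  have d2: "a (d x) = p (a x)" "len (d x) = len x" "d x < p (a x) + len x / 2" "p (a x) \<le> d x"
      "d x = p x - len x / 2"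
    if "0 \<le> x" "x < 1" "\<not> x < a x + len x / 2" for x
  proof -
    show dx: "d x = p x - len x / 2" using that by (simp add: d_def)
    have *: "p x = p (a x) + (x - a x)" using tr[of x "a x"] a[of x] b[of x] that by auto
    have "x - a x < len x" using b[of x] that by (simp add: len_def)
    then show 1: "d x < p (a x) + len x / 2" "p (a x) \<le> d x"
      using dx * that by (auto simp: field_simps)
    have "d x < b (p x)" using b[of "p x"] rng[of x] dx len_pos[of x] that by auto
    then have "a (d x) = a (p x) \<and> b (d x) = b (p x)"
      using same[of "p x" "d x"] rng[of x] that 1 ap[of x] by auto
    then show "a (d x) = p (a x)" "len (d x) = len x"
      using ap[of x] len_p[of x] that by (auto simp: len_def)
  qed
  have d_rng: "d x \<in> unit_interval" if "x \<in> unit_interval" for x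
  proof (cases "x < a x + len x / 2")
    case True
    then show ?thesis using d1[of x] a[of x] b[of x] len_pos[of x] that by auto
  next
    case False
    then show ?thesis using d2[of x] rng[of "a x"] a[of x] b[of x] rng[of x] len_pos[of x] that by auto
  qed
  have dd: "d (d x) = p x" if x: "x \<in> unit_interval" for x
  proof (cases "x < a x + len x / 2")
    case True
    have "len (d x) = len x" using d1[of x] True x by (simp add: len_def)
    then have "d (d x) = p (d x) - len x / 2"
      using d1(1,3)[of x] True x unfolding d_def[of "d x"] by auto
    also have "p (d x) = p x + len x / 2"
      using tr[of x "d x"] d1[of x] len_pos[of x] True x by simp
    finally show ?thesis by simp
  next
    case False
    then show ?thesis using d2[of x] x unfolding d_def[of "d x"] by auto
  qed
  have "bij_betw d unit_interval unit_interval"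
    unfolding bij_betw_def
  proof (intro conjI equalityI)
    show "inj_on d unit_interval"
      using dd iet_inj[OF p(1)] by (intro inj_onI) metis
    show "d ` unit_interval \<subseteq> unit_interval" using d_rng by blast
    show "unit_interval \<subseteq> d ` unit_interval"
    proof
      fix x assume x: "x \<in> unit_interval"
      have "iet_inv p x \<in> unit_interval" by (rule iet_range[OF iet_inv[OF p(1)] x])
      then show "x \<in> d ` unit_interval"
        using dd[of "iet_inv p x"] d_rng[of "iet_inv p x"] x p(1) by (metis iet_inv_app2 imageI)
    qed
  qed
  moreover have "step_fun (\<lambda>x. d x - x)"
  proof -
    have sa: "step_fun a"
    proof (rule step_funI[OF E(1)])
      fix x y :: real assume "0 \<le> x" "x \<le> y" "y < 1" "E \<inter> {x<..y} = {}"
      then have "{e \<in> E. e \<le> x} = {e \<in> E. e \<le> y}" by force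
      then show "a x = a y" by (simp add: a_def)
    qed
    have "step_fun b"
    proof (rule step_funI[OF E(1)])
      fix x y :: real assume "0 \<le> x" "x \<le> y" "y < 1" "E \<inter> {x<..y} = {}"
      then have "{e \<in> E. x < e} = {e \<in> E. y < e}" by force
      then show "b x = b y" by (simp add: b_def)
    qed
    then have sl: "step_fun (\<lambda>x. len x / 2)"
      unfolding len_def using sa by (rule step_fun_comp2[where F = "\<lambda>b a. (b - a) / 2"])
    have sc: "step_fun (\<lambda>x. x < a x + len x / 2)"
      by (intro step_fun_less_step step_fun_comp2[where F = "(+)"] sa sl)
    have "step_fun (\<lambda>x. if x < a x + len x / 2 then len x / 2 else (p x - x) - len x / 2)"
      by (intro step_fun_if[OF sc sl] step_fun_comp2[where F = "(-)"] iet_step[OF p(1)] sl)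
    then show ?thesis by (rule step_fun_cong) (simp add: d_def)
  qed
  moreover define d' where "d' = restrict d unit_interval"
  ultimately have iet_d: "iet d'" by (simp add: iet_restrictI)
  have dd': "d' (d' x) = p x" if "x \<in> unit_interval" for x
    using dd[OF that] d_rng[OF that] that by (simp add: d'_def)
  have "(d' ^^ (2 * k)) x = (p ^^ k) x" if "x \<in> unit_interval" for k x
  proof (induction k)
    case (Suc k)
    have "(d' ^^ (2 * Suc k)) x = d' (d' ((d' ^^ (2 * k)) x))" by simp
    also have "\<dots> = p ((p ^^ k) x)" unfolding Suc by (rule dd'[OF iet_funpow_range[OF p(1) that]])
    finally show ?case by simp
  qed simp
  then have "finite_orbits d'"
    using p(2) unfolding finite_orbits_def by (metis mult_pos_pos zero_less_numeral)
  then show thesis using that[OF iet_d] dd' by blast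
qed

text \<open>A map with finite orbits is conjugate to its inverse: reflect every orbit in its least
  point.\<close>

lemma finite_orbits_reversible:
  assumes d: "iet d" "finite_orbits d"
  obtains s where "iet s" "\<And>x. x \<in> unit_interval \<Longrightarrow> s (s x) = x"
    and "\<And>x. x \<in> unit_interval \<Longrightarrow> d (s (d x)) = s x"
proof -
  obtain E where E: "finite E" "E \<subseteq> unit_interval" "0 \<in> E" "d ` E = E"
    and cell: "\<And>x y. 0 \<le> x \<Longrightarrow> x \<le> y \<Longrightarrow> y < 1 \<Longrightarrow> E \<inter> {x<..y} = {} \<Longrightarrow>
           d y - d x = y - x \<and> E \<inter> {d x<..d y} = {}"
    using finite_orbits_cells[OF d] unfolding permutes_cells_def by metis
  define orb where "orb x = range (\<lambda>k. (d ^^ k) x)" for x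
  define m where "m x = Min (orb x)" for x
  define k where "k x = (LEAST k. (d ^^ k) x = m x)" for x
  define s where "s x = (d ^^ k x) (m x)" for x
  have period: "\<exists>n>0. (d ^^ n) x = x" if "x \<in> unit_interval" for x
    using d(2) that unfolding finite_orbits_def by blast
  have fin: "finite (orb x)" if "x \<in> unit_interval" for x
  proof -
    obtain n where n: "n > 0" "(d ^^ n) x = x" using period \<open>x \<in> unit_interval\<close> by blast
    have "(d ^^ k) x \<in> (\<lambda>k. (d ^^ k) x) ` {..<n}" for k
      using funpow_mod_eq[OF n(2), of k] n(1) by (metis imageI lessThan_iff mod_less_divisor)
    then have "orb x \<subseteq> (\<lambda>k. (d ^^ k) x) ` {..<n}" unfolding orb_def by blast
    then show ?thesis by (rule finite_subset) simp
  qed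
  have m_orb: "m x \<in> orb x" if "x \<in> unit_interval" for x
    unfolding m_def using fin[OF that] by (intro Min_in) (auto simp: orb_def)
  have orb_d: "orb ((d ^^ i) x) = orb x" if x: "x \<in> unit_interval" for x i
  proof
    show "orb ((d ^^ i) x) \<subseteq> orb x"
      by (auto simp: orb_def simp flip: funpow_add[THEN fun_cong, simplified comp_apply])
    obtain n where n: "n > 0" "(d ^^ n) x = x" using period x by blast
    have "(d ^^ j) x = (d ^^ (j + (n * i - i))) ((d ^^ i) x)" for j
    proof -
      have "(d ^^ (j + (n * i - i))) ((d ^^ i) x) = (d ^^ (j + (n * i - i) + i)) x"
        by (simp add: funpow_add)
      also have "j + (n * i - i) + i = j + n * i"
      proof -
        have "i \<le> n * i" using n(1) by (cases n) auto
        then show ?thesis by linarith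
      qed
      also have "(d ^^ (j + n * i)) x = (d ^^ j) x"
        using funpow_period[OF n(2)] by (simp add: funpow_add)
      finally show ?thesis by simp
    qed
    then show "orb x \<subseteq> orb ((d ^^ i) x)" unfolding orb_def by blast
  qed
  then have m_d: "m ((d ^^ i) x) = m x" if "x \<in> unit_interval" for x i
    using that by (simp add: m_def)
  have ex_k: "\<exists>j. (d ^^ j) x = m x" if "x \<in> unit_interval" for x
    using m_orb[OF that] unfolding orb_def by (auto simp: image_iff)
  have k: "(d ^^ k x) x = m x" if "x \<in> unit_interval" for x
    unfolding k_def using ex_k[OF that] by (rule LeastI_ex)
  have s_eq: "s x = (d ^^ j) (m x)" if x: "x \<in> unit_interval" and j: "(d ^^ j) x = m x" for x j
  proof -
    obtain i where i: "m x = (d ^^ i) x" using ex_k[OF x] by metis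
    have "(d ^^ a) ((d ^^ i) x) = (d ^^ i) ((d ^^ a) x)" for a
      by (metis add.commute comp_apply funpow_add)
    then show ?thesis using k[OF x] j unfolding s_def i by metis
  qed
  have m_rng: "m x \<in> unit_interval" if "x \<in> unit_interval" for x
    using ex_k[OF that] iet_funpow_range[OF d(1) that] by metis
  have s_rng: "s x \<in> unit_interval" if "x \<in> unit_interval" for x
    unfolding s_def by (rule iet_funpow_range[OF d(1) m_rng[OF that]])
  have m_s: "m (s x) = m x" if "x \<in> unit_interval" for x
    using m_d[of "m x" "k x"] m_d[of x "k x"] k[OF that] m_rng[OF that] that
    unfolding s_def by metis
  have ss: "s (s x) = x" if x: "x \<in> unit_interval" for x
  proof -
    obtain n where n: "n > 0" "(d ^^ n) (m x) = m x" using period m_rng x by blast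
    define j where "j = n * k x - k x"
    have j: "j + k x = n * k x" "k x + j = n * k x" using n(1) by (simp_all add: j_def)
    have "(d ^^ j) (s x) = (d ^^ (n * k x)) (m x)"
      unfolding s_def j(1)[symmetric] by (simp add: funpow_add)
    also have "\<dots> = m (s x)" using funpow_period[OF n(2)] m_s[OF x] by simp
    finally have "s (s x) = (d ^^ j) (m (s x))" by (rule s_eq[OF s_rng[OF x]])
    then have *: "s (s x) = (d ^^ j) (m x)" using m_s[OF x] by simp
    have "(d ^^ k x) ((d ^^ j) (m x)) = (d ^^ (k x + j)) (m x)" by (simp add: funpow_add)
    also have "\<dots> = (d ^^ k x) x" unfolding j(2) using funpow_period[OF n(2)] k[OF x] by simp
    finally have "(d ^^ j) (m x) = x"
      by (rule iet_funpow_inj[OF d(1) iet_funpow_range[OF d(1) m_rng[OF x]] x])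
    then show ?thesis using * by simp
  qed
  have dsd: "d (s (d x)) = s x" if x: "x \<in> unit_interval" for x
  proof -
    obtain n where n: "n > 0" "(d ^^ n) x = x" using period x by blast
    define j where "j = k x + n - 1"
    have j: "Suc j = k x + n" using n(1) by (simp add: j_def)
    have *: "(d ^^ Suc j) x = m x" unfolding j using n k[OF x] by (simp add: funpow_add)
    then have "(d ^^ j) (d x) = m (d x)"
      using m_d[OF x, of 1] by (simp add: funpow_swap1)
    then have "s (d x) = (d ^^ j) (m (d x))" by (rule s_eq[OF iet_range[OF d(1) x]])
    then have "d (s (d x)) = (d ^^ Suc j) (m x)" using m_d[OF x, of 1] by simp
    also have "\<dots> = s x" using s_eq[OF x *] by simp
    finally show ?thesis .
  qed
  have "step_fun (\<lambda>x. s x - x)"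
  proof (rule step_funI[OF E(1)])
    fix x y :: real assume xy: "0 \<le> x" "x \<le> y" "y < 1" "E \<inter> {x<..y} = {}"
    have "(d ^^ i) y - (d ^^ i) x = y - x \<and> E \<inter> {(d ^^ i) x<..(d ^^ i) y} = {}" for i
    proof (induction i)
      case (Suc i)
      then show ?case
        using cell[of "(d ^^ i) x" "(d ^^ i) y"] iet_funpow_range[OF d(1), of x i]
          iet_funpow_range[OF d(1), of y i] xy by auto
    qed (use xy in simp)
    then have tr: "(d ^^ i) y = (d ^^ i) x + (y - x)" for i by (metis add.commute diff_add_cancel)
    then have "orb y = (\<lambda>z. z + (y - x)) ` orb x" unfolding orb_def by (simp add: image_image)
    moreover have "Min (orb x) + (y - x) = Min ((\<lambda>z. z + (y - x)) ` orb x)"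
      by (rule mono_Min_commute) (use fin[of x] xy in \<open>auto simp: mono_def orb_def\<close>)
    ultimately have m: "m y = m x + (y - x)" by (simp add: m_def)
    then have "k y = k x" unfolding k_def using tr by simp
    then have "s y = (d ^^ (k x)) ((d ^^ (k x)) y)" "s x = (d ^^ (k x)) ((d ^^ (k x)) x)"
      using k[of x] k[of y] xy unfolding s_def by auto
    then show "s x - x = s y - y"
      using tr[of "k x + k x"] by (simp add: funpow_add)
  qed
  then have "iet (restrict s unit_interval)"
    using s_rng s_rng ss ss by (rule iet_restrict_inverseI)
  then show thesis
  proof (rule that)
    fix x assume x: "x \<in> unit_interval"
    show "restrict s unit_interval (restrict s unit_interval x) = x"
      using x s_rng[OF x] ss[OF x] by (simp del: in_unit_interval)
    show "d (restrict s unit_interval (d x)) = restrict s unit_interval x"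
      using x iet_range[OF d(1) x] dsd[OF x] by (simp del: in_unit_interval)
  qed
qed

text \<open>With \<open>d\<close> a square root of \<open>p\<close> and \<open>s d s\<inverse> = d\<inverse>\<close>, the commutator of \<open>d\<close> and \<open>s\<close> is
  \<open>d d = p\<close>.\<close>

proposition finite_orbits_commutator:
  assumes p: "iet p" "finite_orbits p"
  shows "p \<in> iet_commutators"
proof -
  obtain d where d: "iet d" "finite_orbits d" "\<And>x. x \<in> unit_interval \<Longrightarrow> d (d x) = p x"
    using finite_orbits_sqrt[OF p] by blast
  obtain s where s: "iet s" "\<And>x. x \<in> unit_interval \<Longrightarrow> s (s x) = x"
    "\<And>x. x \<in> unit_interval \<Longrightarrow> d (s (d x)) = s x"
    using finite_orbits_reversible[OF d(1,2)] by blast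
  have "p = d \<odot> s \<odot> iet_inv d \<odot> iet_inv s"
  proof (rule iet_eqI[OF p(1)])
    fix x assume x: "x \<in> unit_interval"
    have "iet_inv s x = s x"
      using s(2)[OF x] iet_inv_app1[OF s(1) iet_range[OF s(1) x]] by simp
    moreover define w where "w = iet_inv d (s x)"
    have w: "w \<in> unit_interval" "d w = s x"
      unfolding w_def using iet_range[OF iet_inv[OF d(1)]] iet_range[OF s(1) x] d(1) by auto
    have "s w = d x" using s(3)[OF w(1)] w(2) s(2)[OF x] by simp
    then have "d (s w) = p x" using d(3)[OF x] by simp
    ultimately show "p x = (d \<odot> s \<odot> iet_inv d \<odot> iet_inv s) x"
      using x d(1) s(1) iet_range[OF s(1) x] iet_range[OF iet_inv[OF s(1)] x] w
      by (simp add: iet_mult iet_inv w_def del: in_unit_interval)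
  qed (use d s in \<open>simp add: iet_mult iet_inv\<close>)
  then show ?thesis using d(1) s(1) by auto
qed

section \<open>Sums of step functions against a biadditive weight\<close>

text \<open>The total length of the set on which a step function takes a given value.\<close>

abbreviation level_measure :: "(real \<Rightarrow> 'b) \<Rightarrow> 'b \<Rightarrow> real" where
  "level_measure \<phi> v \<equiv> measure lebesgue {x \<in> unit_interval. \<phi> x = v}"

lemma step_fun_lmeasurable:
  assumes "step_fun P"
  shows "{x \<in> unit_interval. P x} \<in> lmeasurable"
proof -
  obtain E where E: "finite E"
    and c: "\<And>x y. 0 \<le> x \<Longrightarrow> x \<le> y \<Longrightarrow> y < 1 \<Longrightarrow> E \<inter> {x<..y} = {} \<Longrightarrow> P x = P y"
    using assms by (auto elim: step_funE)
  define C where "C F = {y \<in> {0..<1}. \<forall>e\<in>E. e \<le> y \<longleftrightarrow> e \<in> F}" for F :: "real set"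
  have "C F \<in> sets borel" for F
  proof -
    have "C F = {0..<1} \<inter> (\<Inter>e\<in>E. {y. e \<le> y \<longleftrightarrow> e \<in> F})"
      unfolding C_def by auto
    moreover have "{y. e \<le> y \<longleftrightarrow> e \<in> F} \<in> sets borel" for e
    proof -
      have "{y. e \<le> y \<longleftrightarrow> e \<in> F} = (if e \<in> F then {e..} else {..<e})" by auto
      then show ?thesis by simp
    qed
    ultimately show ?thesis using sets.Int[OF _ sets.finite_INT[OF E, of "\<lambda>e. {y. e \<le> y \<longleftrightarrow> e \<in> F}"]]
      by (cases "E = {}") simp_all
  qed
  then have "C F \<in> sets lebesgue" for F by (simp add: sets_completionI_sets)
  moreover have "bounded (C F)" for F
    by (rule bounded_subset[of "{0..1::real}"]) (auto simp: C_def)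
  ultimately have C: "C F \<in> lmeasurable" for F by (rule bounded_set_imp_lmeasurable[rotated])
  have "{x \<in> unit_interval. P x} = (\<Union>F\<in>{F \<in> Pow E. \<exists>x\<in>unit_interval. P x \<and> F = E \<inter> {..x}}. C F)"
  proof (intro equalityI subsetI)
    fix x assume "x \<in> {x \<in> unit_interval. P x}"
    then show "x \<in> (\<Union>F\<in>{F \<in> Pow E. \<exists>x\<in>unit_interval. P x \<and> F = E \<inter> {..x}}. C F)"
      by (intro UN_I[of "E \<inter> {..x}"]) (auto simp: C_def)
  next
    fix y assume "y \<in> (\<Union>F\<in>{F \<in> Pow E. \<exists>x\<in>unit_interval. P x \<and> F = E \<inter> {..x}}. C F)"
    then obtain x where x: "x \<in> unit_interval" "P x" "y \<in> C (E \<inter> {..x})" by blast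
    then have y: "0 \<le> y" "y < 1" "\<And>e. e \<in> E \<Longrightarrow> e \<le> y \<longleftrightarrow> e \<le> x" by (auto simp: C_def)
    then have "E \<inter> {x<..y} = {}" "E \<inter> {y<..x} = {}" by force+
    then have "P x = P y" using c[of x y] c[of y x] x y by (cases "x \<le> y") auto
    then show "y \<in> {x \<in> unit_interval. P x}" using x y by simp
  qed
  moreover have "finite {F \<in> Pow E. \<exists>x\<in>unit_interval. P x \<and> F = E \<inter> {..x}}" using E by simp
  ultimately show ?thesis using C by (simp add: fmeasurable.finite_UN)
qed

lemma step_fun_measure_sum:
  assumes \<eta>: "step_fun \<eta>" and P: "step_fun P"
  shows "measure lebesgue {x \<in> unit_interval. P x} =
    (\<Sum>c\<in>\<eta> ` unit_interval. measure lebesgue {x \<in> unit_interval. \<eta> x = c \<and> P x})"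
proof -
  define A where "A c = {x \<in> unit_interval. \<eta> x = c \<and> P x}" for c
  have A: "A c \<in> lmeasurable" for c
    unfolding A_def
    by (rule step_fun_lmeasurable, rule step_fun_comp2[where F = "\<lambda>a b. a = c \<and> b", OF \<eta> P])
  have "{x \<in> unit_interval. P x} = (\<Union>c\<in>\<eta> ` unit_interval. A c)"
    by (auto simp: A_def)
  also have "measure lebesgue \<dots> = (\<Sum>c\<in>\<eta> ` unit_interval. measure lebesgue (A c))"
  proof (rule measure_finite_Union[OF step_fun_finite_range[OF \<eta>]])
    show "A ` \<eta> ` unit_interval \<subseteq> sets lebesgue" using fmeasurableD[OF A] by blast
    show "disjoint_family_on A (\<eta> ` unit_interval)" by (auto simp: disjoint_family_on_def A_def)
    show "emeasure lebesgue (A c) \<noteq> \<infinity>" for c using fmeasurableD2[OF A] by simp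
  qed
  finally show ?thesis by (simp add: A_def)
qed

lemma level_measure_total:
  assumes "step_fun \<eta>"
  shows "(\<Sum>c\<in>\<eta> ` unit_interval. level_measure \<eta> c) = 1"
proof -
  have "measure lebesgue unit_interval = 1" unfolding unit_interval_def by simp
  then show ?thesis using step_fun_measure_sum[OF assms, of "\<lambda>x. True"]
    by (simp del: in_unit_interval)
qed

lemma iet_measure:
  assumes f: "iet f" and P: "step_fun P"
  shows "measure lebesgue {x \<in> unit_interval. P (f x)} = measure lebesgue {x \<in> unit_interval. P x}"
proof -
  define T where "T = (\<lambda>x. f x - x) ` unit_interval"
  define g where "g = iet_inv f"
  have g: "iet g" "\<And>x. x \<in> unit_interval \<Longrightarrow> g (f x) = x" "\<And>x. x \<in> unit_interval \<Longrightarrow> f (g x) = x"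
    using f by (auto simp: g_def iet_inv)
  have step: "step_fun (\<lambda>x. x - g x)"
    using step_fun_comp1[OF iet_step[OF g(1)], of uminus] by simp
  have T: "T = (\<lambda>x. x - g x) ` unit_interval"
  proof -
    have "f x - x \<in> (\<lambda>x. x - g x) ` unit_interval" if "x \<in> unit_interval" for x
      using g(2)[OF that] iet_range[OF f that] by (intro image_eqI[of _ _ "f x"]) simp_all
    moreover have "x - g x \<in> T" if "x \<in> unit_interval" for x
      using g(3)[OF that] iet_range[OF g(1) that] unfolding T_def by (intro image_eqI[of _ _ "g x"]) simp_all
    ultimately show ?thesis unfolding T_def by blast
  qed
  have Pf: "step_fun (\<lambda>x. P (f x))"
    using step_fun_compose[OF P iet_step[OF f]] iet_range[OF f] by simp
  have "measure lebesgue {x \<in> unit_interval. P (f x)} =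
      (\<Sum>t\<in>T. measure lebesgue {x \<in> unit_interval. f x - x = t \<and> P (f x)})"
    unfolding T_def by (rule step_fun_measure_sum[OF iet_step[OF f] Pf])
  also have "\<dots> = (\<Sum>t\<in>T. measure lebesgue {x \<in> unit_interval. x - g x = t \<and> P x})"
  proof (rule sum.cong[OF refl])
    fix t
    have "(+) t ` {x \<in> unit_interval. f x - x = t \<and> P (f x)} = {x \<in> unit_interval. x - g x = t \<and> P x}"
    proof (intro equalityI subsetI)
      fix y assume "y \<in> (+) t ` {x \<in> unit_interval. f x - x = t \<and> P (f x)}"
      then obtain x where x: "x \<in> unit_interval" "f x - x = t" "P (f x)" "y = t + x" by blast
      have "y = f x" using x by simp
      show "y \<in> {x \<in> unit_interval. x - g x = t \<and> P x}"
        using x g(2)[OF x(1)] iet_range[OF f x(1)] unfolding \<open>y = f x\<close> by simp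
    next
      fix y assume "y \<in> {x \<in> unit_interval. x - g x = t \<and> P x}"
      then have y: "y \<in> unit_interval" "y - g y = t" "P y" by auto
      then show "y \<in> (+) t ` {x \<in> unit_interval. f x - x = t \<and> P (f x)}"
        using g(3)[OF y(1)] iet_range[OF g(1) y(1)] by (intro image_eqI[of _ _ "g y"]) simp_all
    qed
    then show "measure lebesgue {x \<in> unit_interval. f x - x = t \<and> P (f x)} =
        measure lebesgue {x \<in> unit_interval. x - g x = t \<and> P x}"
      using measure_translation[of t "{x \<in> unit_interval. f x - x = t \<and> P (f x)}"] by (simp only:)
  qed
  also have "\<dots> = measure lebesgue {x \<in> unit_interval. P x}"
    unfolding T by (rule step_fun_measure_sum[OF step P, symmetric])
  finally show ?thesis .
qed

text \<open>The first argument of a weight is a length of at most 1.\<close>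

locale biadditive_weight =
  fixes w :: "real \<Rightarrow> real \<Rightarrow> 'h::ab_group_add"
  assumes add_left: "0 \<le> a \<Longrightarrow> 0 \<le> b \<Longrightarrow> a + b \<le> 1 \<Longrightarrow> w (a + b) t = w a t + w b t"
    and add_right: "0 \<le> a \<Longrightarrow> a \<le> 1 \<Longrightarrow> w a (s + t) = w a s + w a t"
begin

text \<open>The sum of \<open>w \<mu> v\<close> over the values \<open>v\<close> of a step function, where \<open>\<mu>\<close> is the length of the set
  on which the value is taken.\<close>

definition step_sum :: "(real \<Rightarrow> real) \<Rightarrow> 'h" where
  "step_sum \<phi> = (\<Sum>v\<in>\<phi> ` unit_interval. w (level_measure \<phi> v) v)"

lemma step_sum_cong:
  assumes "\<And>x. x \<in> unit_interval \<Longrightarrow> \<phi> x = \<psi> x"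
  shows "step_sum \<phi> = step_sum \<psi>"
proof -
  have "\<phi> ` unit_interval = \<psi> ` unit_interval" using assms by (intro image_cong) auto
  moreover have "{x \<in> unit_interval. \<phi> x = v} = {x \<in> unit_interval. \<psi> x = v}" for v using assms by auto
  ultimately show ?thesis by (simp only: step_sum_def)
qed

lemma left_zero [simp]: "w 0 t = 0"
  using add_left[of 0 0 t] by simp

lemma right_zero [simp]: "0 \<le> a \<Longrightarrow> a \<le> 1 \<Longrightarrow> w a 0 = 0"
  using add_right[of a 0 0] by simp

lemma right_of_nat: "0 \<le> a \<Longrightarrow> a \<le> 1 \<Longrightarrow> w a (real n * t) = (\<Sum>i<n. w a t)"
  by (induction n) (simp_all add: distrib_right add_right add.commute)

lemma left_sum:
  assumes "finite C" "\<And>c. c \<in> C \<Longrightarrow> 0 \<le> m c" "sum m C \<le> 1"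
  shows "w (sum m C) t = (\<Sum>c\<in>C. w (m c) t)"
  using assms
proof (induction C rule: finite_induct)
  case (insert c C)
  have nn: "0 \<le> sum m C" "0 \<le> m c" using insert.prems by (auto intro: sum_nonneg)
  moreover have "sum m C \<le> 1" using insert.hyps insert.prems(2) nn by simp
  ultimately show ?case using insert by (simp add: add_left)
qed simp

lemma step_sum_refine:
  assumes "step_fun \<eta>"
  shows "step_sum (\<lambda>x. F (\<eta> x)) = (\<Sum>c\<in>\<eta> ` unit_interval. w (level_measure \<eta> c) (F c))"
proof -
  define C where "C = \<eta> ` unit_interval"
  have C: "finite C" unfolding C_def using assms by (rule step_fun_finite_range)
  have lev: "level_measure (\<lambda>x. F (\<eta> x)) v = (\<Sum>c\<in>{c \<in> C. F c = v}. level_measure \<eta> c)" for v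
  proof -
    have "level_measure (\<lambda>x. F (\<eta> x)) v = (\<Sum>c\<in>C. measure lebesgue {x \<in> unit_interval. \<eta> x = c \<and> F (\<eta> x) = v})"
      unfolding C_def using assms
      by (intro step_fun_measure_sum step_fun_comp1[where F = "\<lambda>c. F c = v"])
    also have "\<dots> = (\<Sum>c\<in>{c \<in> C. F c = v}. level_measure \<eta> c)"
    proof (rule sum.mono_neutral_cong_right)
      show "\<forall>c\<in>C - {c \<in> C. F c = v}. measure lebesgue {x \<in> unit_interval. \<eta> x = c \<and> F (\<eta> x) = v} = 0"
        by (auto intro!: arg_cong[where f = "measure lebesgue" and y = "{}", simplified])
      show "measure lebesgue {x \<in> unit_interval. \<eta> x = c \<and> F (\<eta> x) = v} = level_measure \<eta> c"
        if "c \<in> {c \<in> C. F c = v}" for c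
        using that by (intro arg_cong[where f = "measure lebesgue"]) auto
    qed (use C in auto)
    finally show ?thesis .
  qed
  have tot: "(\<Sum>c\<in>{c \<in> C. F c = v}. level_measure \<eta> c) \<le> 1" for v
  proof -
    have "(\<Sum>c\<in>{c \<in> C. F c = v}. level_measure \<eta> c) \<le> (\<Sum>c\<in>C. level_measure \<eta> c)"
      using C by (intro sum_mono2) auto
    then show ?thesis using level_measure_total[OF assms] by (simp add: C_def)
  qed
  have "step_sum (\<lambda>x. F (\<eta> x)) = (\<Sum>v\<in>F ` C. w (level_measure (\<lambda>x. F (\<eta> x)) v) v)"
    unfolding step_sum_def C_def by (simp add: image_image)
  also have "\<dots> = (\<Sum>v\<in>F ` C. \<Sum>c\<in>{c \<in> C. F c = v}. w (level_measure \<eta> c) (F c))"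
  proof (rule sum.cong[OF refl])
    fix v
    have "w (level_measure (\<lambda>x. F (\<eta> x)) v) v = (\<Sum>c\<in>{c \<in> C. F c = v}. w (level_measure \<eta> c) v)"
      unfolding lev using C tot by (intro left_sum) auto
    then show "w (level_measure (\<lambda>x. F (\<eta> x)) v) v = (\<Sum>c\<in>{c \<in> C. F c = v}. w (level_measure \<eta> c) (F c))"
      by simp
  qed
  also have "\<dots> = (\<Sum>c\<in>C. w (level_measure \<eta> c) (F c))"
    by (rule sum.image_gen[OF C, symmetric])
  finally show ?thesis by (simp add: C_def)
qed

lemma level_measure_bounds:
  "step_fun \<eta> \<Longrightarrow> 0 \<le> level_measure \<eta> c \<and> level_measure \<eta> c \<le> 1"
proof -
  assume \<eta>: "step_fun \<eta>"
  have "measure lebesgue {x \<in> unit_interval. \<eta> x = c} \<le> measure lebesgue unit_interval"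
  proof (rule measure_mono_fmeasurable)
    show "{x \<in> unit_interval. \<eta> x = c} \<in> sets lebesgue"
      by (rule fmeasurableD, rule step_fun_lmeasurable, rule step_fun_comp1[OF \<eta>])
    show "unit_interval \<in> lmeasurable"
      using step_fun_lmeasurable[of "\<lambda>x. True"] by (simp del: in_unit_interval)
  qed blast
  also have "\<dots> = 1" unfolding unit_interval_def by simp
  finally show ?thesis by simp
qed

lemma step_sum_add:
  assumes \<phi>: "step_fun \<phi>" and \<psi>: "step_fun \<psi>"
  shows "step_sum (\<lambda>x. \<phi> x + \<psi> x) = step_sum \<phi> + step_sum \<psi>"
proof -
  define \<eta> where "\<eta> x = (\<phi> x, \<psi> x)" for x
  have \<eta>: "step_fun \<eta>"
    unfolding \<eta>_def by (rule step_fun_comp2[OF \<phi> \<psi>])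
  have "step_sum (\<lambda>x. (\<lambda>(a, b). a + b) (\<eta> x)) = step_sum (\<lambda>x. fst (\<eta> x)) + step_sum (\<lambda>x. snd (\<eta> x))"
    unfolding step_sum_refine[OF \<eta>] sum.distrib[symmetric]
    using level_measure_bounds[OF \<eta>] by (intro sum.cong) (auto simp: add_right split: prod.splits)
  then show ?thesis by (simp add: \<eta>_def)
qed

lemma step_sum_iet:
  assumes \<phi>: "step_fun \<phi>" and f: "iet f"
  shows "step_sum (\<lambda>x. \<phi> (f x)) = step_sum \<phi>"
proof -
  have "(\<lambda>x. \<phi> (f x)) ` unit_interval = \<phi> ` unit_interval"
    using bij_betw_imp_surj_on[OF iet_bij[OF f]] by (metis image_image)
  moreover have "level_measure (\<lambda>x. \<phi> (f x)) v = level_measure \<phi> v" for v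
    by (rule iet_measure[OF f step_fun_comp1[OF \<phi>]])
  ultimately show ?thesis by (simp add: step_sum_def)
qed

text \<open>For every scale \<open>\<alpha>\<close>, summing the weight over the displacements multiplied by \<open>\<alpha>\<close> gives a
  homomorphism on the group of interval exchanges.\<close>

definition displacement_sum :: "real \<Rightarrow> (real \<Rightarrow> real) \<Rightarrow> 'h" where
  "displacement_sum \<alpha> f = step_sum (\<lambda>x. \<alpha> * (f x - x))"

lemma displacement_sum_mult:
  assumes f: "iet f" and g: "iet g"
  shows "displacement_sum \<alpha> (f \<odot> g) = displacement_sum \<alpha> f + displacement_sum \<alpha> g"
proof -
  have sf: "step_fun (\<lambda>x. \<alpha> * (f x - x))" if "iet f" for f
    using that step_fun_comp1[OF iet_step, of f "(*) \<alpha>"] by simp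
  have "displacement_sum \<alpha> (f \<odot> g) = step_sum (\<lambda>x. \<alpha> * (f (g x) - g x) + \<alpha> * (g x - x))"
    unfolding displacement_sum_def
    by (rule step_sum_cong) (use f g in \<open>auto simp: algebra_simps\<close>)
  also have "\<dots> = step_sum (\<lambda>x. \<alpha> * (f (g x) - g x)) + step_sum (\<lambda>x. \<alpha> * (g x - x))"
  proof (rule step_sum_add[OF _ sf[OF g]])
    show "step_fun (\<lambda>x. \<alpha> * (f (g x) - g x))"
      by (rule step_fun_compose[OF sf[OF f] iet_step[OF g]]) (use iet_range[OF g] in simp)
  qed
  also have "step_sum (\<lambda>x. \<alpha> * (f (g x) - g x)) = displacement_sum \<alpha> f"
    unfolding displacement_sum_def by (rule step_sum_iet[OF sf[OF f] g])
  finally show ?thesis by (simp add: displacement_sum_def)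
qed

end

section \<open>The abelianization\<close>

text \<open>The quotient by the commutator subgroup as a type, written additively.\<close>

typedef iet_ab = "carrier (IET_group Mod iet_derived)"
proof -
  interpret Q: comm_group "IET_group Mod iet_derived"
    by (rule IET.derived_quot_is_comm_group)
  show ?thesis using Q.one_closed by blast
qed

instantiation iet_ab :: ab_group_add
begin

definition zero_iet_ab :: iet_ab where
  "0 = Abs_iet_ab \<one>\<^bsub>IET_group Mod iet_derived\<^esub>"
definition plus_iet_ab :: "iet_ab \<Rightarrow> iet_ab \<Rightarrow> iet_ab" where
  "a + b = Abs_iet_ab (Rep_iet_ab a \<otimes>\<^bsub>IET_group Mod iet_derived\<^esub> Rep_iet_ab b)"
definition uminus_iet_ab :: "iet_ab \<Rightarrow> iet_ab" where
  "- a = Abs_iet_ab (inv\<^bsub>IET_group Mod iet_derived\<^esub> Rep_iet_ab a)"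
definition minus_iet_ab :: "iet_ab \<Rightarrow> iet_ab \<Rightarrow> iet_ab" where
  "a - b = a + - (b :: iet_ab)"

instance
proof
  interpret Q: comm_group "IET_group Mod iet_derived"
    by (rule IET.derived_quot_is_comm_group)
  fix a b c :: iet_ab
  note R = Rep_iet_ab
  note inv = Abs_iet_ab_inverse[OF Q.m_closed] Abs_iet_ab_inverse[OF Q.inv_closed] Abs_iet_ab_inverse[OF Q.one_closed]
  show "a + b + c = a + (b + c)"
    unfolding plus_iet_ab_def using R[of a] R[of b] R[of c] by (simp only: inv Q.m_assoc)
  show "a + b = b + a"
    unfolding plus_iet_ab_def using R[of a] R[of b] by (simp only: Q.m_comm)
  show "0 + a = a"
    unfolding plus_iet_ab_def zero_iet_ab_def using R[of a] by (simp only: inv Q.l_one Rep_iet_ab_inverse)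
  show "- a + a = 0"
    unfolding plus_iet_ab_def zero_iet_ab_def uminus_iet_ab_def using R[of a] by (simp only: inv Q.l_inv)
  show "a - b = a + - b" by (rule minus_iet_ab_def)
qed

end

text \<open>The class of an interval exchange in the abelianization.\<close>

definition cls :: "(real \<Rightarrow> real) \<Rightarrow> iet_ab" where
  "cls f = Abs_iet_ab (iet_derived #>\<^bsub>IET_group\<^esub> f)"

lemma derived_subgroup: "subgroup (iet_derived) IET_group"
  by (rule IET.derived_is_subgroup) simp

lemma coset_in_quotient:
  "iet f \<Longrightarrow> iet_derived #>\<^bsub>IET_group\<^esub> f
    \<in> carrier (IET_group Mod iet_derived)"
  by (simp add: carrier_FactGroup)

lemma cls_mult:
  assumes "iet f" "iet g"
  shows "cls (f \<odot> g) = cls f + cls g"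
proof -
  interpret N: normal "iet_derived" IET_group
    by (rule IET.derived_self_is_normal)
  show ?thesis
    unfolding cls_def plus_iet_ab_def Abs_iet_ab_inverse[OF coset_in_quotient[OF assms(1)]]
      Abs_iet_ab_inverse[OF coset_in_quotient[OF assms(2)]]
    using N.rcos_sum[of f g] assms by simp
qed

lemma cls_eq_0_iff:
  assumes "iet f"
  shows "cls f = 0 \<longleftrightarrow> f \<in> iet_derived"
proof -
  interpret Q: comm_group "IET_group Mod iet_derived"
    by (rule IET.derived_quot_is_comm_group)
  have "cls f = 0 \<longleftrightarrow> iet_derived #>\<^bsub>IET_group\<^esub> f = iet_derived"
    unfolding cls_def zero_iet_ab_def
    using Abs_iet_ab_inject[OF coset_in_quotient[OF assms] Q.one_closed] by simp
  then show ?thesis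
    using IET.coset_join1[of "iet_derived" f]
      IET.coset_join2[of f "iet_derived"] assms derived_subgroup by auto
qed

lemma cls_one [simp]: "cls \<one>\<^bsub>IET_group\<^esub> = 0"
  using cls_mult[OF iet_one iet_one] by (simp add: iet_one)

lemma cls_inv: "iet f \<Longrightarrow> cls (iet_inv f) = - cls f"
  using cls_mult[of f "iet_inv f"] by (simp add: iet_inv eq_neg_iff_add_eq_0 add.commute)

lemma cls_finite_orbits:
  assumes "iet p" "finite_orbits p"
  shows "cls p = 0"
proof -
  have "p \<in> iet_derived"
    unfolding derived_def by (rule generate.incl[OF finite_orbits_commutator[OF assms]])
  then show ?thesis using cls_eq_0_iff[OF assms(1)] by simp
qed

text \<open>A homomorphism to an abelian group vanishes on the commutator subgroup.\<close>

lemma hom_derived_zero: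
  fixes h :: "(real \<Rightarrow> real) \<Rightarrow> 'h::ab_group_add"
  assumes h: "\<And>f g. iet f \<Longrightarrow> iet g \<Longrightarrow> h (f \<odot> g) = h f + h g"
    and f: "f \<in> iet_derived"
  shows "h f = 0"
proof -
  have hone: "h \<one>\<^bsub>IET_group\<^esub> = 0" using h[OF iet_one iet_one] by (simp add: iet_one)
  have inv: "h (iet_inv f) = - h f" if "iet f" for f
    using h[OF that iet_inv[OF that]] that hone by (simp add: eq_neg_iff_add_eq_0 add.commute)
  have comm: "iet c \<and> h c = 0" if c: "c \<in> iet_commutators" for c
  proof -
    obtain a b where ab: "iet a" "iet b" "c = a \<odot> b \<odot> iet_inv a \<odot> iet_inv b" using c by auto
    have "h c = h a + h b + h (iet_inv a) + h (iet_inv b)"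
      unfolding ab(3) using ab(1,2) by (simp only: h iet_mult iet_inv)
    moreover have "iet c" unfolding ab(3) using ab(1,2) by (simp only: iet_mult iet_inv)
    ultimately show ?thesis using inv ab(1,2) by simp
  qed
  have "iet f \<and> h f = 0"
    using f unfolding derived_def
  proof (induction rule: generate.induct)
    case one
    show ?case using hone iet_one by simp
  next
    case (incl c)
    show ?case by (rule comm[OF incl])
  next
    case (inv c)
    have "iet c" "h c = 0" using comm[OF inv] by simp_all
    then show ?case using \<open>\<And>f. iet f \<Longrightarrow> h (iet_inv f) = - h f\<close> iet_inv by simp
  next
    case (eng c d)
    then show ?case using h[of c d] iet_mult[of c d] by simp
  qed
  then show ?thesis by simp
qed

section \<open>Rotations of initial intervals\<close>

text \<open>The map \<open>rot L a\<close> rotates \<open>[0, L)\<close> by \<open>a\<close> modulo \<open>L\<close> and fixes the rest of the unit interval.\<close>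

definition rot :: "real \<Rightarrow> real \<Rightarrow> real \<Rightarrow> real" where
  "rot L a = restrict (\<lambda>x. if x < L then L * frac ((x + a) / L) else x) unit_interval"

lemma rot_eq: "x \<in> unit_interval \<Longrightarrow> rot L a x = (if x < L then L * frac ((x + a) / L) else x)"
  by (simp add: rot_def)

lemma rot_small:
  assumes "0 \<le> a" "a \<le> L" "x \<in> unit_interval"
  shows "rot L a x = (if x < L then if x + a < L then x + a else x + a - L else x)"
proof (cases "x < L")
  case True
  then have L: "0 < L" using assms by simp
  show ?thesis
  proof (cases "x + a < L")
    case True
    then have "frac ((x + a) / L) = (x + a) / L" using assms L by (simp add: frac_eq)
    then show ?thesis using assms True L by (simp add: rot_eq)
  next
    case False
    have "frac ((x + a) / L) = frac ((x + a - L) / L + 1)" using L by (simp add: field_simps)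
    also have "\<dots> = (x + a - L) / L"
      unfolding frac_1_eq using False assms \<open>x < L\<close> L by (simp add: frac_eq)
    finally show ?thesis using assms False L \<open>x < L\<close> by (simp add: rot_eq)
  qed
qed (use assms in \<open>simp add: rot_eq\<close>)

lemma rot_range:
  assumes "L \<le> 1" "x \<in> unit_interval"
  shows "rot L a x \<in> unit_interval" "rot L a x < L \<longleftrightarrow> x < L"
proof -
  have *: "0 \<le> L * frac ((x + a) / L) \<and> L * frac ((x + a) / L) < L" if "x < L"
    using that assms mult_strict_left_mono[OF frac_lt_1[of "(x + a) / L"], of L] by auto
  then show "rot L a x < L \<longleftrightarrow> x < L" using assms by (auto simp: rot_eq)
  show "rot L a x \<in> unit_interval"
    using * assms by (fastforce simp: rot_eq)
qed

lemma rot_rot: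
  assumes "L \<le> 1" "x \<in> unit_interval"
  shows "rot L a (rot L b x) = rot L (a + b) x"
proof (cases "x < L")
  case True
  then have "0 < L" using assms by simp
  have "rot L b x = L * frac ((x + b) / L)" using True assms by (simp add: rot_eq)
  then have "(rot L b x + a) / L = frac ((x + b) / L) + a / L"
    using \<open>0 < L\<close> by (simp add: add_divide_distrib)
  then have "frac ((rot L b x + a) / L) = frac ((x + b) / L + a / L)" by simp
  also have "(x + b) / L + a / L = (x + (a + b)) / L" by (simp add: add_divide_distrib)
  finally have "frac ((rot L b x + a) / L) = frac ((x + (a + b)) / L)" .
  then show ?thesis
    using True rot_range[OF assms, of b] assms by (simp add: rot_eq)
next
  case False
  then have "rot L c x = x" for c using assms by (simp add: rot_eq)
  then show ?thesis by simp
qed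

lemma rot_0 [simp]: "x \<in> unit_interval \<Longrightarrow> rot L 0 x = x"
  by (cases "0 < L") (auto simp: rot_eq frac_eq)

lemma iet_rot:
  assumes "L \<le> 1"
  shows "iet (rot L a)"
proof -
  define k where "k = \<lfloor>a / L\<rfloor>"
  have "step_fun (\<lambda>x. if x < L then if x < L * (k + 1) - a then a - L * k else a - L * (k + 1) else 0)"
    by (intro step_fun_if) auto
  then have "step_fun (\<lambda>x. rot L a x - x)"
  proof (rule step_fun_cong)
    fix x :: real assume x: "0 \<le> x" "x < 1"
    show "(if x < L then if x < L * (k + 1) - a then a - L * k else a - L * (k + 1) else 0) = rot L a x - x"
    proof (cases "x < L")
      case True
      then have L: "0 < L" using x by simp
      have k: "k \<le> a / L" "a / L < k + 1" unfolding k_def by linarith+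
      have "\<lfloor>(x + a) / L\<rfloor> = (if x < L * (k + 1) - a then k else k + 1)"
      proof (cases "x < L * (k + 1) - a")
        case True
        then have "(x + a) / L < k + 1" using L by (simp add: field_simps)
        moreover have "k \<le> (x + a) / L" using k(1) x(1) L by (simp add: field_simps)
        ultimately show ?thesis using True by (simp add: floor_eq_iff)
      next
        case False
        then have "k + 1 \<le> (x + a) / L" using L by (simp add: field_simps)
        moreover have "(x + a) / L < k + 2" using k(2) \<open>x < L\<close> L by (simp add: field_simps)
        ultimately show ?thesis using False by (simp add: floor_eq_iff)
      qed
      moreover have "L * frac ((x + a) / L) = x + a - L * \<lfloor>(x + a) / L\<rfloor>"
        using L by (simp add: frac_def right_diff_distrib)
      ultimately show ?thesis using True x by (simp add: rot_eq)
    qed (use x in \<open>simp add: rot_eq\<close>)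
  qed
  then have "iet (restrict (rot L a) unit_interval)"
    by (rule iet_restrict_inverseI[where \<psi> = "rot L (- a)"])
       (use rot_range[OF assms] rot_rot[OF assms] in simp_all)
  then show ?thesis by (simp add: rot_def)
qed

lemma rot_mult: "L \<le> 1 \<Longrightarrow> rot L a \<odot> rot L b = rot L (a + b)"
  by (rule iet_eqI) (simp_all add: iet_mult iet_rot rot_rot del: in_unit_interval)

lemma rot_0_one: "rot L 0 = \<one>\<^bsub>IET_group\<^esub>"
proof (rule extensionalityI[of _ unit_interval])
  show "rot L 0 \<in> extensional unit_interval" by (simp add: rot_def)
  show "\<one>\<^bsub>IET_group\<^esub> \<in> extensional unit_interval" using iet_one by (simp add: iet_iff Bij_def)
qed simp

lemma rot_full: "L \<le> 1 \<Longrightarrow> 0 \<le> L \<Longrightarrow> rot L L = \<one>\<^bsub>IET_group\<^esub>"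
  by (rule iet_eqI) (simp_all add: iet_one iet_rot rot_small)

text \<open>The class of a rotation as a function of the length and the angle.  It is additive in both: this is
  clear for the angle, and proved below for the length.\<close>

definition rot_cls :: "real \<Rightarrow> real \<Rightarrow> iet_ab" where
  "rot_cls L a = cls (rot L a)"

lemma rot_cls_add_right: "L \<le> 1 \<Longrightarrow> rot_cls L (a + b) = rot_cls L a + rot_cls L b"
  unfolding rot_cls_def by (simp add: rot_mult[symmetric] cls_mult iet_rot)

lemma rot_cls_minus: "L \<le> 1 \<Longrightarrow> rot_cls L (- a) = - rot_cls L a"
  using rot_cls_add_right[of L a "- a"]
  by (simp add: rot_cls_def rot_0_one eq_neg_iff_add_eq_0 add.commute)

lemma rot_cls_full: "L \<le> 1 \<Longrightarrow> 0 \<le> L \<Longrightarrow> rot_cls L L = 0"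
  by (simp add: rot_cls_def rot_full)

lemma rot_cls_of_nat: "L \<le> 1 \<Longrightarrow> rot_cls L (real n * a) = (\<Sum>i<n. rot_cls L a)"
proof (induction n)
  case 0
  then show ?case by (simp add: rot_cls_def rot_0_one)
next
  case (Suc n)
  have "rot_cls L (real (Suc n) * a) = rot_cls L (real n * a) + rot_cls L a"
    using rot_cls_add_right[OF Suc.prems] by (simp add: distrib_right add.commute)
  then show ?case using Suc by simp
qed

text \<open>Rotating two adjacent intervals by a small amount separately, and then swapping the two pieces
  that have come out at the wrong place, rotates their union.  The swap is an involution, so it does
  not contribute to the class.\<close>

lemma rot_cls_add_left_small:
  assumes "0 < a" "a \<le> L" "a \<le> M" "L + M \<le> 1"
  shows "rot_cls (L + M) a = rot_cls L a + rot_cls M a"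
proof -
  define \<sigma> where "\<sigma> = restrict (\<lambda>x. if x < a then x + L else if L \<le> x \<and> x < L + a then x - L else x) unit_interval"
  have \<sigma>: "\<sigma> x = (if x < a then x + L else if L \<le> x \<and> x < L + a then x - L else x)" if "0 \<le> x" "x < 1" for x
    using that by (simp add: \<sigma>_def)
  have \<sigma>\<sigma>: "0 \<le> \<sigma> x \<and> \<sigma> x < 1 \<and> \<sigma> (\<sigma> x) = x" if "0 \<le> x" "x < 1" for x
    using that assms \<sigma>[of x] \<sigma>[of "x + L"] \<sigma>[of "x - L"] by (auto split: if_splits)
  have "step_fun (\<lambda>x. if x < a then L else if L \<le> x then if x < L + a then - L else 0 else 0)"
    by (intro step_fun_if) auto
  then have "step_fun (\<lambda>x. \<sigma> x - x)" by (rule step_fun_cong) (use \<sigma> in auto)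
  then have "iet (restrict \<sigma> unit_interval)"
    by (rule iet_restrict_inverseI[where \<psi> = \<sigma>]) (use \<sigma>\<sigma> in simp_all)
  then have \<sigma>_iet: "iet \<sigma>" by (simp add: \<sigma>_def)
  moreover have "finite_orbits \<sigma>"
    unfolding finite_orbits_def using \<sigma>\<sigma> by (auto intro!: exI[of _ "2::nat"] simp: numeral_2_eq_2)
  ultimately have "cls \<sigma> = 0" by (rule cls_finite_orbits)
  define B where "B = rot (L + M) L \<odot> rot M a \<odot> rot (L + M) M"
  note iets = iet_rot[of "L + M"] iet_rot[of L] iet_rot[of M]
  have B_iet: "iet B" unfolding B_def using assms iets by (simp add: iet_mult)
  have B: "B x = (if L \<le> x \<and> x < L + M then if x + a < L + M then x + a else x + a - M else x)"
    if "0 \<le> x" "x < 1" for x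
  proof -
    have "B x = rot (L + M) L (rot M a (rot (L + M) M x))"
      unfolding B_def using assms iets that iet_range[OF iets(1), of x M] by (simp add: iet_mult)
    then show ?thesis using assms that by (auto simp: rot_small)
  qed
  have "rot (L + M) a = \<sigma> \<odot> B \<odot> rot L a"
  proof (rule iet_eqI)
    fix x assume x: "x \<in> unit_interval"
    have "(\<sigma> \<odot> B \<odot> rot L a) x = \<sigma> (B (rot L a x))"
      using \<sigma>_iet B_iet iets(2)[of a] x iet_range[OF iets(2), of x a] assms
      by (simp add: iet_mult del: in_unit_interval)
    then show "rot (L + M) a x = (\<sigma> \<odot> B \<odot> rot L a) x"
      using x assms by (auto simp: rot_small B \<sigma>)
  qed (use assms iets \<sigma>_iet B_iet in \<open>simp_all add: iet_mult\<close>)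
  then have "rot_cls (L + M) a = cls B + rot_cls L a"
    using assms \<sigma>_iet B_iet \<open>cls \<sigma> = 0\<close> by (simp add: rot_cls_def cls_mult iet_mult iet_rot)
  also have "cls B = rot_cls (L + M) (L + M) + rot_cls M a"
    unfolding B_def using assms iets by (simp add: rot_cls_def cls_mult iet_mult rot_mult[symmetric])
  also have "rot_cls (L + M) (L + M) = 0" using assms by (intro rot_cls_full) auto
  finally show ?thesis by (simp add: add.commute)
qed

lemma rot_cls_zero: "rot_cls 0 a = 0"
proof -
  have "rot 0 a = \<one>\<^bsub>IET_group\<^esub>" by (rule iet_eqI) (simp_all add: iet_rot iet_one rot_eq)
  then show ?thesis by (simp add: rot_cls_def)
qed

text \<open>The general case of additivity in the length: a large angle is a multiple of a small one.\<close>

interpretation rot: biadditive_weight rot_cls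
proof
  fix L M t :: real
  assume LM: "0 \<le> L" "0 \<le> M" "L + M \<le> 1"
  have pos: "rot_cls (L + M) a = rot_cls L a + rot_cls M a" if "0 < a" for a
  proof (cases "L = 0 \<or> M = 0")
    case False
    then have "0 < min L M" using LM by auto
    then obtain n where n: "a < real n * min L M" using reals_Archimedean3 by blast
    then have "n \<noteq> 0" using that by (cases n) auto
    define b where "b = a / real n"
    have b: "0 < b" "a = real n * b"
      using \<open>n \<noteq> 0\<close> that unfolding b_def by simp_all
    have "b < min L M"
      using n \<open>n \<noteq> 0\<close> pos_divide_less_eq[of "real n" a "min L M"] unfolding b_def
      by (simp add: mult.commute)
    have "rot_cls (L + M) b = rot_cls L b + rot_cls M b"
      using b \<open>b < min L M\<close> LM by (intro rot_cls_add_left_small) auto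
    then show ?thesis
      using LM unfolding b(2) by (simp add: rot_cls_of_nat sum.distrib)
  qed (auto simp: rot_cls_zero)
  consider "t = 0" | "0 < t" | "0 < - t" by linarith
  then show "rot_cls (L + M) t = rot_cls L t + rot_cls M t"
  proof cases
    case 3
    then have "- rot_cls (L + M) t = - (rot_cls L t + rot_cls M t)"
      using pos[of "- t"] LM by (simp add: rot_cls_minus)
    then show ?thesis by (simp only: neg_equal_iff_equal)
  qed (use pos in \<open>simp_all add: rot_cls_def rot_0_one\<close>)
qed (rule rot_cls_add_right)

section \<open>The class of an interval exchange is the sum of its displacements\<close>

lemma rot_cls_antisym:
  assumes "0 < a" "0 < b" "a + b \<le> 1"
  shows "rot_cls a b = - rot_cls b a"
proof -
  have *: "rot_cls (a + b) b = rot_cls a b" "rot_cls (a + b) a = rot_cls b a"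
    using assms by (simp_all add: rot.add_left rot_cls_full)
  have "rot_cls (a + b) a + rot_cls (a + b) b = 0"
    using assms rot_cls_full[of "a + b"] by (simp add: rot.add_right)
  then show ?thesis unfolding * by (simp add: eq_neg_iff_add_eq_0 add.commute)
qed

text \<open>The property to be proved for all interval exchanges.  The factor \<open>1/2\<close> is needed because exchanging
  two intervals of lengths \<open>a\<close> and \<open>b\<close> gives \<open>rot_cls a b - rot_cls b a\<close> as displacement sum at scale 1,
  and by antisymmetry this is twice the class \<open>rot_cls a b\<close>.\<close>

definition displacement_class :: "(real \<Rightarrow> real) \<Rightarrow> bool" where
  "displacement_class f \<longleftrightarrow> iet f \<and> cls f = rot.displacement_sum (1/2) f"

lemma displacement_class_rot:
  assumes "0 < a" "a < L" "L \<le> 1"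
  shows "displacement_class (rot L a)"
proof -
  define b where "b = L - a"
  have b: "0 < b" "L = a + b" "a + b \<le> 1" using assms by (auto simp: b_def)
  define \<eta> :: "real \<Rightarrow> nat" where "\<eta> x = (if x < b then 0 else if x < L then 1 else 2)" for x
  define F :: "nat \<Rightarrow> real" where "F n = (if n = 0 then a / 2 else if n = 1 then - b / 2 else 0)" for n
  have \<eta>: "step_fun \<eta>" unfolding \<eta>_def by (intro step_fun_if) auto
  have lev: "level_measure \<eta> 0 = b" "level_measure \<eta> 1 = a" "level_measure \<eta> 2 = 1 - L"
  proof -
    have "{x \<in> unit_interval. \<eta> x = 0} = {0..<b}" "{x \<in> unit_interval. \<eta> x = 1} = {b..<L}"
      "{x \<in> unit_interval. \<eta> x = 2} = {L..<1}"
      using b assms by (auto simp: \<eta>_def split: if_splits)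
    then show "level_measure \<eta> 0 = b" "level_measure \<eta> 1 = a" "level_measure \<eta> 2 = 1 - L"
      using b assms by simp_all
  qed
  have "rot.displacement_sum (1/2) (rot L a) = rot.step_sum (\<lambda>x. F (\<eta> x))"
    unfolding rot.displacement_sum_def
    by (rule rot.step_sum_cong) (use assms in \<open>auto simp: rot_small F_def \<eta>_def b_def\<close>)
  also have "\<dots> = (\<Sum>c\<in>\<eta> ` unit_interval. rot_cls (level_measure \<eta> c) (F c))"
    by (rule rot.step_sum_refine[OF \<eta>])
  also have "\<dots> = (\<Sum>c\<in>{0, 1, 2}. rot_cls (level_measure \<eta> c) (F c))"
  proof (rule sum.mono_neutral_left)
    show "\<forall>c\<in>{0, 1, 2} - \<eta> ` unit_interval. rot_cls (level_measure \<eta> c) (F c) = 0"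
    proof
      fix c assume "c \<in> {0, 1, 2} - \<eta> ` unit_interval"
      then have "{x \<in> unit_interval. \<eta> x = c} = {}" by blast
      then have "level_measure \<eta> c = 0" by (simp only: measure_empty)
      then show "rot_cls (level_measure \<eta> c) (F c) = 0" by (simp only: rot_cls_zero)
    qed
  qed (auto simp: \<eta>_def)
  also have "\<dots> = rot_cls b (a / 2) + rot_cls a (- (b / 2))"
    using lev assms by (simp add: F_def)
  also have "rot_cls b (a / 2) = rot_cls (b / 2) a"
    using rot.add_left[of "b / 2" "b / 2" "a / 2"] rot.add_right[of "b / 2" "a / 2" "a / 2"] b assms by simp
  also have "rot_cls a (- (b / 2)) = rot_cls (b / 2) a"
    using rot_cls_antisym[of a "b / 2"] rot_cls_minus[of a "b / 2"] b assms by simp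
  also have "rot_cls (b / 2) a + rot_cls (b / 2) a = rot_cls b a"
    using rot.add_left[of "b / 2" "b / 2" a] b assms by simp
  also have "\<dots> = rot_cls L a"
    using rot.add_left[of a b a] b assms by (simp add: rot_cls_full)
  finally have "rot.displacement_sum (1/2) (rot L a) = cls (rot L a)"
    by (simp only: rot_cls_def[of L a])
  then show ?thesis using assms by (simp add: displacement_class_def iet_rot)
qed


lemma displacement_class_mult:
  "displacement_class f \<Longrightarrow> displacement_class g \<Longrightarrow> displacement_class (f \<odot> g)"
  by (simp add: displacement_class_def cls_mult rot.displacement_sum_mult iet_mult)

lemma displacement_class_cancel:
  "displacement_class (f \<odot> g) \<Longrightarrow> iet f \<Longrightarrow> displacement_class g \<Longrightarrow> displacement_class f"
  by (simp add: displacement_class_def cls_mult rot.displacement_sum_mult)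

lemma displacement_class_one: "displacement_class \<one>\<^bsub>IET_group\<^esub>"
proof -
  have "rot.displacement_sum (1/2) \<one>\<^bsub>IET_group\<^esub> = 0"
    using rot.displacement_sum_mult[OF iet_one iet_one, of "1/2"] by (simp add: iet_one)
  then show ?thesis by (simp add: displacement_class_def iet_one)
qed

text \<open>The map that sends \<open>[u, u+w-v)\<close> to \<open>[v, w)\<close> and \<open>[u+w-v, w)\<close> to \<open>[u, v)\<close>: a rotation of an initial
  interval, conjugated by a rotation of the circle.\<close>

definition adjacent_swap :: "real \<Rightarrow> real \<Rightarrow> real \<Rightarrow> real \<Rightarrow> real" where
  "adjacent_swap u v w = rot 1 u \<odot> rot (w - u) (v - u) \<odot> rot 1 (1 - u)"

lemma displacement_class_adjacent_swap:
  assumes "0 \<le> u" "u < v" "v < w" "w \<le> 1"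
  shows "displacement_class (adjacent_swap u v w)"
proof -
  have "displacement_class (rot 1 u)" "displacement_class (rot 1 (1 - u))"
    using assms displacement_class_rot[of u 1] displacement_class_rot[of "1 - u" 1]
    by (cases "u = 0"; simp add: rot_0_one rot_full displacement_class_one)+
  moreover have "displacement_class (rot (w - u) (v - u))"
    using assms by (intro displacement_class_rot) auto
  ultimately show ?thesis
    unfolding adjacent_swap_def by (intro displacement_class_mult)
qed

lemma adjacent_swap_eq:
  assumes "0 \<le> u" "u < v" "v < w" "w \<le> 1" "x \<in> unit_interval"
  shows "adjacent_swap u v w x =
    (if x < u then x else if x < u + (w - v) then x + (v - u) else if x < w then x - (w - v) else x)"
proof -
  have "adjacent_swap u v w x = rot 1 u (rot (w - u) (v - u) (rot 1 (1 - u) x))"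
    unfolding adjacent_swap_def using assms
      iet_rot[of 1 u] iet_rot[of "w - u" "v - u"] iet_rot[of 1 "1 - u"]
      iet_range[of "rot 1 (1 - u)" x] iet_range[of "rot (w - u) (v - u)" "rot 1 (1 - u) x"]
    by (simp add: iet_mult del: in_unit_interval)
  then show ?thesis using assms by (auto simp: rot_small)
qed

text \<open>Sorting the pieces: a map that is the identity to the left of \<open>u\<close> is composed with a swap that
  brings the piece landing at \<open>u\<close> to \<open>u\<close>.  This lowers the number of cut points to the right of the part
  on which the map is the identity.\<close>

lemma displacement_class_sorting:
  assumes "iet f" "0 \<le> u" "u \<le> 1" "\<And>x. 0 \<le> x \<Longrightarrow> x < u \<Longrightarrow> f x = x" "finite E"
    and "\<And>x y. u \<le> x \<Longrightarrow> x \<le> y \<Longrightarrow> y < 1 \<Longrightarrow> E \<inter> {x<..y} = {} \<Longrightarrow> f x - x = f y - y"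
  shows "displacement_class f"
  using assms
proof (induction "card (E \<inter> {u<..<1})" arbitrary: f u E rule: less_induct)
  case less
  note f = less.prems(1) and u = less.prems(2,3) and fix_u = less.prems(4) and E = less.prems(5)
    and cuts = less.prems(6)
  have id_case: "displacement_class f" if "\<And>x. 0 \<le> x \<Longrightarrow> x < 1 \<Longrightarrow> f x = x"
  proof -
    have "f = \<one>\<^bsub>IET_group\<^esub>" by (rule iet_eqI[OF f iet_one]) (use that in simp)
    then show ?thesis using displacement_class_one by simp
  qed
  show ?case
  proof (cases "u = 1")
    case True
    then show ?thesis using fix_u by (intro id_case) auto
  next
    case False
    then have u1: "u < 1" using u by simp
    define v where "v = iet_inv f u"
    have v: "0 \<le> v" "v < 1" "f v = u"
      using iet_range[OF iet_inv[OF f], of u] f u u1 by (auto simp: v_def)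
    have "u \<le> v" using fix_u[of v] v by (cases "v < u") auto
    define w where "w = Min (insert 1 {e \<in> E. v < e})"
    have "w \<in> insert 1 {e \<in> E. v < e}" unfolding w_def using E by (intro Min_in) auto
    then have w: "v < w" "w = 1 \<or> w \<in> E" using v by auto
    have w_le: "w \<le> e" if "e = 1 \<or> e \<in> E \<and> v < e" for e
      unfolding w_def using E that by (intro Min_le) auto
    then have "w \<le> 1" by simp
    have piece: "f x = u + (x - v)" if "v \<le> x" "x < w" for x
    proof -
      have "E \<inter> {v<..x} = {}" using w_le that by force
      then show ?thesis using cuts[of v x] that \<open>u \<le> v\<close> \<open>w \<le> 1\<close> v by simp
    qed
    show ?thesis
    proof (cases "u = v")
      case True
      have fix_w: "f x = x" if "0 \<le> x" "x < w" for x
        using fix_u[of x] piece[of x] that True by (cases "x < u") auto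
      show ?thesis
      proof (cases "w = 1")
        case True
        then show ?thesis using fix_w by (intro id_case) auto
      next
        case False
        then have "w \<in> E \<inter> {u<..<1}" using w \<open>w \<le> 1\<close> \<open>u = v\<close> by auto
        moreover have "E \<inter> {w<..<1} \<subseteq> E \<inter> {u<..<1}" using w \<open>u = v\<close> by auto
        ultimately have "card (E \<inter> {w<..<1}) < card (E \<inter> {u<..<1})"
          using E by (intro psubset_card_mono) auto
        then show ?thesis
          by (rule less.hyps) (use f w v \<open>w \<le> 1\<close> fix_w E cuts \<open>u = v\<close> in auto)
      qed
    next
      case False
      then have "u < v" using \<open>u \<le> v\<close> by simp
      \<comment> \<open>If \<open>v\<close> were not a cut point, then points just to the left of \<open>v\<close> would go to points just to the
        left of \<open>u\<close>, which are fixed.\<close>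
      have "v \<in> E"
      proof (rule ccontr)
        assume "v \<notin> E"
        define x where "x = Max (insert u {e \<in> E. e < v})"
        define z where "z = (max x u + v) / 2"
        have "x \<in> insert u {e \<in> E. e < v}" unfolding x_def using E by (intro Max_in) auto
        then have x: "x < v" using \<open>u < v\<close> by auto
        have "e \<le> x" if "e \<in> E" "e < v" for e
          unfolding x_def using E that by (intro Max_ge) auto
        then have "E \<inter> {z<..v} = {}"
          using \<open>v \<notin> E\<close> x \<open>u < v\<close> unfolding z_def by (force simp: max_def split: if_splits)
        moreover have z: "u < z" "z < v" using x \<open>u < v\<close> by (auto simp: z_def)
        ultimately have fz: "f z = u - (v - z)" using cuts[of z v] v by simp
        have "0 \<le> f z" using iet_range[OF f, of z] z v u by simp
        then have "f (f z) = f z" using fix_u[of "f z"] fz z by simp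
        then have "f z = z" using iet_inj[OF f, of "f z" z] iet_range[OF f, of z] z v u by simp
        then show False using fz \<open>u < v\<close> by simp
      qed
      define g where "g = adjacent_swap u v w"
      have g: "displacement_class g"
        unfolding g_def using u \<open>u < v\<close> \<open>v < w\<close> \<open>w \<le> 1\<close> by (intro displacement_class_adjacent_swap)
      have g_eq: "g x =
          (if x < u then x else if x < u + (w - v) then x + (v - u) else if x < w then x - (w - v) else x)"
        if "0 \<le> x" "x < 1" for x
        unfolding g_def using u \<open>u < v\<close> \<open>v < w\<close> \<open>w \<le> 1\<close> that by (intro adjacent_swap_eq) auto
      have g_iet: "iet g" using g by (simp add: displacement_class_def)
      have fg: "(f \<odot> g) x = f (g x)" if "0 \<le> x" "x < 1" for x
        using f g_iet that by simp
      define u' where "u' = u + (w - v)"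
      define E' where "E' = (\<lambda>e. e + (w - v)) ` (E \<inter> {u<..<v}) \<union> (E \<inter> {w..<1})"
      have "displacement_class (f \<odot> g)"
      proof (rule less.hyps)
        have "card (E' \<inter> {u'<..<1}) \<le> card E'" using E by (intro card_mono) (auto simp: E'_def)
        also have "\<dots> \<le> card ((\<lambda>e. e + (w - v)) ` (E \<inter> {u<..<v})) + card (E \<inter> {w..<1})"
          unfolding E'_def by (rule card_Un_le)
        also have "\<dots> \<le> card (E \<inter> {u<..<v}) + card (E \<inter> {w..<1})"
          using E by (intro add_mono card_image_le) auto
        also have "\<dots> = card (E \<inter> {u<..<v} \<union> E \<inter> {w..<1})"
          using E w by (intro card_Un_disjoint[symmetric]) auto
        also have "\<dots> < card (E \<inter> {u<..<1})"
        proof (rule psubset_card_mono)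
          have "v \<in> E \<inter> {u<..<1}" "v \<notin> E \<inter> {u<..<v} \<union> E \<inter> {w..<1}"
            using \<open>v \<in> E\<close> \<open>u < v\<close> v w by auto
          moreover have "E \<inter> {u<..<v} \<union> E \<inter> {w..<1} \<subseteq> E \<inter> {u<..<1}"
            using \<open>u < v\<close> v w by auto
          ultimately show "E \<inter> {u<..<v} \<union> E \<inter> {w..<1} \<subset> E \<inter> {u<..<1}" by blast
        qed (use E in simp)
        finally show "card (E' \<inter> {u'<..<1}) < card (E \<inter> {u<..<1})" .
        show "iet (f \<odot> g)" using f g_iet by (rule iet_mult)
        show "0 \<le> u'" "u' \<le> 1" using u w \<open>u < v\<close> \<open>w \<le> 1\<close> by (auto simp: u'_def)
        show "finite E'" using E by (simp add: E'_def)
        show "(f \<odot> g) x = x" if "0 \<le> x" "x < u'" for x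
        proof (cases "x < u")
          case True
          then show ?thesis using fg[of x] g_eq[of x] fix_u[of x] that u1 by simp
        next
          case False
          then have "(f \<odot> g) x = f (x + (v - u))"
            using fg[of x] g_eq[of x] that \<open>u < v\<close> \<open>w \<le> 1\<close> by (simp add: u'_def)
          then show ?thesis using piece[of "x + (v - u)"] that False \<open>u < v\<close> by (simp add: u'_def)
        qed
        fix x y assume xy: "u' \<le> x" "x \<le> y" "y < 1" "E' \<inter> {x<..y} = {}"
        have x0: "0 \<le> x" using xy u w by (simp add: u'_def)
        show "(f \<odot> g) x - x = (f \<odot> g) y - y"
        proof (cases "y < w")
          case True
          have "E \<inter> {x - (w - v)<..y - (w - v)} = {}"
          proof (rule ccontr)
            assume "E \<inter> {x - (w - v)<..y - (w - v)} \<noteq> {}"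
            then obtain e where e: "e \<in> E" "x - (w - v) < e" "e \<le> y - (w - v)" by auto
            then have "e + (w - v) \<in> E' \<inter> {x<..y}"
              using True xy(1) by (auto simp: E'_def u'_def)
            then show False using xy(4) by blast
          qed
          then show ?thesis
            using cuts[of "x - (w - v)" "y - (w - v)"] fg[of x] fg[of y] g_eq[of x] g_eq[of y] xy x0 True w
            by (simp add: u'_def)
        next
          case False
          show ?thesis
          proof (cases "x < w")
            case True
            then have "w \<in> E' \<inter> {x<..y}" using False w xy by (auto simp: E'_def)
            then show ?thesis using xy(4) by blast
          next
            case False
            then have "E \<inter> {x<..y} = {}" using xy by (auto simp: E'_def)
            then show ?thesis
              using cuts[of x y] fg[of x] fg[of y] g_eq[of x] g_eq[of y] xy x0 False \<open>u < v\<close> \<open>v < w\<close> by simp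
          qed
        qed
      qed
      then show ?thesis using f g by (rule displacement_class_cancel)
    qed
  qed
qed

proposition cls_eq_displacement_sum:
  assumes "iet f"
  shows "cls f = rot.displacement_sum (1/2) f"
proof -
  obtain E where E: "finite E"
    "\<And>x y. 0 \<le> x \<Longrightarrow> x \<le> y \<Longrightarrow> y < 1 \<Longrightarrow> E \<inter> {x<..y} = {} \<Longrightarrow> f x - x = f y - y"
    using iet_step[OF assms] unfolding step_fun_def by auto
  have "displacement_class f"
    by (rule displacement_class_sorting[OF assms _ _ _ E, of 0]) simp_all
  then show ?thesis by (simp add: displacement_class_def)
qed

section \<open>Block diagonal maps\<close>

text \<open>The unit interval consists of \<open>m\<close> blocks \<open>[j/m, (j+1)/m)\<close>; a point of block \<open>j\<close> is written
  \<open>(j + y)/m\<close> with \<open>y\<close> in the unit interval.\<close>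

definition block :: "nat \<Rightarrow> real \<Rightarrow> nat" where
  "block m x = nat \<lfloor>real m * x\<rfloor>"

lemma block_eq [simp]: "y \<in> unit_interval \<Longrightarrow> 0 < m \<Longrightarrow> block m ((real j + y) / real m) = j"
proof -
  assume "y \<in> unit_interval" "0 < m"
  then have "\<lfloor>real j + y\<rfloor> = int j" by (simp add: floor_eq_iff)
  then show ?thesis using \<open>0 < m\<close> by (simp add: block_def)
qed

lemma block_point_range: "j < m \<Longrightarrow> y \<in> unit_interval \<Longrightarrow> (real j + y) / real m \<in> unit_interval"
proof -
  assume j: "j < m" and y: "y \<in> unit_interval"
  have "real j + 1 \<le> real m" using j by linarith
  then have "real j + y < real m" using y by simp
  then show ?thesis using j y by simp
qed

lemma block_cases:
  assumes "x \<in> unit_interval" "0 < m"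
  obtains j y where "j < m" "y \<in> unit_interval" "x = (real j + y) / real m"
    "block m x = j" "real m * x - real j = y"
proof -
  define j where "j = block m x"
  define y where "y = real m * x - real j"
  have *: "0 \<le> real m * x" "real m * x < real m" using assms by simp_all
  have j: "real j = \<lfloor>real m * x\<rfloor>" using *(1) by (simp add: j_def block_def)
  then have y: "y \<in> unit_interval" unfolding y_def in_unit_interval by linarith
  have "j < m" using j * by linarith
  moreover have "x = (real j + y) / real m" using assms by (simp add: y_def)
  ultimately show thesis by (rule that[OF _ y]) (simp_all add: j_def y_def)
qed

lemma block_bounds:
  assumes "x \<in> unit_interval" "0 < m"
  shows "block m x < m" "real m * x - real (block m x) \<in> unit_interval"
  by (rule block_cases[OF assms], simp)+

lemma step_fun_block: "0 < m \<Longrightarrow> step_fun (block m)"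
proof (rule step_funI)
  assume m: "0 < m"
  show "finite ((\<lambda>j. real j / real m) ` {..m})" by simp
  fix x y :: real
  assume xy: "0 \<le> x" "x \<le> y" "y < 1" "(\<lambda>j. real j / real m) ` {..m} \<inter> {x<..y} = {}"
  have x: "x \<in> unit_interval" and y: "y \<in> unit_interval" using xy by auto
  have le: "block m x \<le> block m y"
    unfolding block_def using xy m by (intro nat_mono floor_mono) simp
  show "block m x = block m y"
  proof (rule ccontr)
    assume "block m x \<noteq> block m y"
    then have "real (block m x) + 1 \<le> real (block m y)" using le by linarith
    moreover have "real m * x - real (block m x) < 1" "0 \<le> real m * y - real (block m y)"
      using block_bounds(2)[OF x m] block_bounds(2)[OF y m] by simp_all
    ultimately have "real m * x < real (block m y)" "real (block m y) \<le> real m * y" by linarith+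
    then have "real (block m y) / real m \<in> {x<..y}" using m by (simp add: field_simps)
    moreover have "block m y \<in> {..m}" using block_bounds(1)[OF y m] by simp
    ultimately show False using xy(4) by blast
  qed
qed

text \<open>The map acting on block \<open>j\<close> as a rescaled copy of \<open>W j\<close>.\<close>

definition diag :: "nat \<Rightarrow> (nat \<Rightarrow> real \<Rightarrow> real) \<Rightarrow> real \<Rightarrow> real" where
  "diag m W = restrict (\<lambda>x. (real (block m x) + W (block m x) (real m * x - real (block m x))) / real m) unit_interval"

lemma diag_eq:
  "j < m \<Longrightarrow> y \<in> unit_interval \<Longrightarrow> diag m W ((real j + y) / real m) = (real j + W j y) / real m"
  using block_point_range[of j m y] by (simp add: diag_def)

context
  fixes m :: nat
  assumes m: "0 < m"
begin

lemma diag_step: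
  assumes W: "\<And>j. j < m \<Longrightarrow> step_fun (\<lambda>x. W j x - x)"
  shows "step_fun (\<lambda>x. diag m W x - x)"
proof -
  define \<psi> where "\<psi> j x = (if real m * x + (- real j) \<in> unit_interval
      then (W j (real m * x + (- real j)) - (real m * x + (- real j))) / real m else 0)" for j x
  have "step_fun (\<psi> j)" if "j < m" for j
    unfolding \<psi>_def
    by (rule step_fun_affine[OF step_fun_comp1[OF W[OF that], of "\<lambda>t. t / real m"]]) (use m in simp)
  then have "step_fun (\<psi> j)" if "j \<in> block m ` unit_interval" for j
    using that block_bounds(1)[OF _ m] by blast
  then have "step_fun (\<lambda>x. \<psi> (block m x) x)"
    by (rule step_fun_select[OF step_fun_block[OF m], of \<psi>])
  then show ?thesis
  proof (rule step_fun_cong)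
    fix x :: real assume "0 \<le> x" "x < 1"
    then have "x \<in> unit_interval" by simp
    then show "\<psi> (block m x) x = diag m W x - x"
    proof (rule block_cases[OF _ m])
      fix j y assume jy: "j < m" "y \<in> unit_interval" "x = (real j + y) / real m"
        "block m x = j" "real m * x - real j = y"
      have "real m * x + - real j = y" using jy(5) by simp
      then have "\<psi> (block m x) x = (W j y - y) / real m"
        unfolding \<psi>_def jy(4) using jy(2) by simp
      also have "\<dots> = (real j + W j y) / real m - x"
        unfolding jy(3) by (simp flip: diff_divide_distrib)
      also have "(real j + W j y) / real m = diag m W x"
        unfolding jy(3) by (rule diag_eq[OF jy(1,2), symmetric])
      finally show ?thesis .
    qed
  qed
qed

lemma diag_range:
  assumes "\<And>j y. j < m \<Longrightarrow> y \<in> unit_interval \<Longrightarrow> W j y \<in> unit_interval" "x \<in> unit_interval"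
  shows "diag m W x \<in> unit_interval"
proof (rule block_cases[OF assms(2) m])
  fix j y assume jy: "j < m" "y \<in> unit_interval" "x = (real j + y) / real m"
  show ?thesis unfolding jy(3) diag_eq[OF jy(1,2)] by (rule block_point_range[OF jy(1) assms(1)[OF jy(1,2)]])
qed

lemma diag_diag:
  assumes "\<And>j y. j < m \<Longrightarrow> y \<in> unit_interval \<Longrightarrow> V j y \<in> unit_interval" "x \<in> unit_interval"
  shows "diag m W (diag m V x) = diag m (\<lambda>j y. W j (V j y)) x"
proof (rule block_cases[OF assms(2) m])
  fix j y assume jy: "j < m" "y \<in> unit_interval" "x = (real j + y) / real m"
  show ?thesis unfolding jy(3) diag_eq[OF jy(1,2)] by (rule diag_eq[OF jy(1) assms(1)[OF jy(1,2)]])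
qed

lemma diag_id:
  assumes "\<And>j y. j < m \<Longrightarrow> y \<in> unit_interval \<Longrightarrow> V j y = y" "x \<in> unit_interval"
  shows "diag m V x = x"
proof (rule block_cases[OF assms(2) m])
  fix j y assume jy: "j < m" "y \<in> unit_interval" "x = (real j + y) / real m"
  show ?thesis unfolding jy(3) diag_eq[OF jy(1,2)] assms(1)[OF jy(1,2)] ..
qed

lemma diag_cong:
  assumes "\<And>j y. j < m \<Longrightarrow> y \<in> unit_interval \<Longrightarrow> V j y = W j y"
  shows "diag m V = diag m W"
proof (rule extensionalityI[of _ unit_interval])
  show "diag m V x = diag m W x" if "x \<in> unit_interval" for x
  proof (rule block_cases[OF that m])
    fix j y assume jy: "j < m" "y \<in> unit_interval" "x = (real j + y) / real m"
    show ?thesis unfolding jy(3) diag_eq[OF jy(1,2)] assms[OF jy(1,2)] ..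
  qed
qed (simp_all add: diag_def)

lemma iet_diag:
  assumes W: "\<And>j. j < m \<Longrightarrow> iet (W j)"
  shows "iet (diag m W)"
proof -
  have inv: "iet (iet_inv (W j))" if "j < m" for j using iet_inv[OF W[OF that]] .
  have r: "W j y \<in> unit_interval" "iet_inv (W j) y \<in> unit_interval" if "j < m" "y \<in> unit_interval" for j y
    using that iet_range[OF W] iet_range[OF inv] by blast+
  have "iet (restrict (diag m W) unit_interval)"
  proof (rule iet_restrict_inverseI[where \<psi> = "diag m (\<lambda>j. iet_inv (W j))"])
    show "step_fun (\<lambda>x. diag m W x - x)" by (rule diag_step) (rule iet_step[OF W])
    fix x assume x: "x \<in> unit_interval"
    show "diag m W x \<in> unit_interval" by (rule diag_range[OF r(1) x])
    show "diag m (\<lambda>j. iet_inv (W j)) x \<in> unit_interval" by (rule diag_range[OF r(2) x])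
    show "diag m (\<lambda>j. iet_inv (W j)) (diag m W x) = x"
      using diag_diag[of W, OF r(1) x] diag_id[OF iet_inv_app1[OF W] x] by simp
    show "diag m W (diag m (\<lambda>j. iet_inv (W j)) x) = x"
      using diag_diag[of "\<lambda>j. iet_inv (W j)", OF r(2) x] diag_id[OF iet_inv_app2[OF W] x] by simp
  qed
  then show ?thesis by (simp add: diag_def)
qed

lemma diag_mult:
  assumes W: "\<And>j. j < m \<Longrightarrow> iet (W j)" and V: "\<And>j. j < m \<Longrightarrow> iet (V j)"
  shows "diag m W \<odot> diag m V = diag m (\<lambda>j. W j \<odot> V j)"
proof -
  have WV: "diag m (\<lambda>j. W j \<odot> V j) = diag m (\<lambda>j y. W j (V j y))"
    by (rule diag_cong) (rule iet_mult_app[OF W V])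
  have i: "iet (diag m W)" "iet (diag m V)" "iet (diag m (\<lambda>j. W j \<odot> V j))"
    using iet_diag[of W] iet_diag[of V] iet_diag[of "\<lambda>j. W j \<odot> V j"] W V by (simp_all add: iet_mult)
  show ?thesis
  proof (rule iet_eqI[OF iet_mult[OF i(1,2)] i(3)])
    fix x assume x: "x \<in> unit_interval"
    show "(diag m W \<odot> diag m V) x = diag m (\<lambda>j. W j \<odot> V j) x"
      unfolding iet_mult_app[OF i(1,2) x] WV by (rule diag_diag[OF _ x]) (rule iet_range[OF V])
  qed
qed

lemma diag_one: "diag m (\<lambda>j. \<one>\<^bsub>IET_group\<^esub>) = \<one>\<^bsub>IET_group\<^esub>"
  by (rule iet_eqI[OF iet_diag iet_one]) (simp_all add: iet_one diag_id del: in_unit_interval)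

lemma diag_inv:
  assumes W: "\<And>j. j < m \<Longrightarrow> iet (W j)"
  shows "iet_inv (diag m W) = diag m (\<lambda>j. iet_inv (W j))"
proof (rule IET.inv_equality)
  have "diag m (\<lambda>j. iet_inv (W j)) \<odot> diag m W = diag m (\<lambda>j. iet_inv (W j) \<odot> W j)"
    using W by (intro diag_mult) (auto simp: iet_inv)
  also have "\<dots> = diag m (\<lambda>j. \<one>\<^bsub>IET_group\<^esub>)"
    by (rule diag_cong) (use W in \<open>simp add: IET.l_inv del: in_unit_interval\<close>)
  finally show "diag m (\<lambda>j. iet_inv (W j)) \<odot> diag m W = \<one>\<^bsub>IET_group\<^esub>" by (simp add: diag_one)
qed (use iet_diag[of W] iet_diag[of "\<lambda>j. iet_inv (W j)"] W in \<open>simp_all add: iet_inv\<close>)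

text \<open>The rotation by \<open>1/m\<close> permutes the blocks cyclically.\<close>

lemma rot_block:
  assumes "j < m" "y \<in> unit_interval"
  shows "rot 1 (1 / real m) ((real j + y) / real m) = (real (if Suc j < m then Suc j else 0) + y) / real m"
proof (cases "Suc j < m")
  case True
  have "(real j + y) / real m + 1 / real m = (real (Suc j) + y) / real m"
    by (simp add: add_divide_distrib)
  then show ?thesis
    using block_point_range[OF assms] block_point_range[OF True assms(2)] True m
    by (simp add: rot_small)
next
  case False
  then have "m = Suc j" using assms by simp
  then have "(real j + y) / real m + 1 / real m = y / real m + 1"
    by (simp add: field_simps)
  then show ?thesis
    using block_point_range[OF assms] block_point_range[OF m assms(2)] False m assms(2)
    by (simp add: rot_small not_less[symmetric])
qed

lemma diag_rot:
  assumes W: "\<And>j. j < m \<Longrightarrow> iet (W j)"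
  shows "rot 1 (1 / real m) \<odot> diag m W \<odot> iet_inv (rot 1 (1 / real m))
    = diag m (\<lambda>j. W (if j = 0 then m - 1 else j - 1))" (is "?\<phi> \<odot> _ \<odot> _ = diag m ?V")
proof -
  have V: "\<And>j. j < m \<Longrightarrow> iet (?V j)" using W m by simp
  note i = iet_rot[of 1 "1 / real m"] iet_diag[of W, OF W] iet_diag[of ?V, OF V]
  have "?\<phi> \<odot> diag m W = diag m ?V \<odot> ?\<phi>"
  proof (rule iet_eqI)
    fix x assume x: "x \<in> unit_interval"
    then show "(?\<phi> \<odot> diag m W) x = (diag m ?V \<odot> ?\<phi>) x"
    proof (rule block_cases[OF _ m])
      fix j y assume jy: "j < m" "y \<in> unit_interval" "x = (real j + y) / real m"
      define j' where "j' = (if Suc j < m then Suc j else 0)"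
      have "j = m - 1" if "\<not> Suc j < m" using that jy(1) by simp
      then have j': "j' < m" "?V j' = W j" using jy(1) m by (auto simp: j'_def)
      have "(?\<phi> \<odot> diag m W) x = (real j' + W j y) / real m"
        using iet_mult_app[OF i(1,2) x] diag_eq[OF jy(1,2), of W]
          rot_block[OF jy(1) iet_range[OF W[OF jy(1)] jy(2)]] jy(3) by (simp add: j'_def)
      moreover have "(diag m ?V \<odot> ?\<phi>) x = (real j' + ?V j' y) / real m"
        using iet_mult_app[OF i(3,1) x] rot_block[OF jy(1,2)] diag_eq[OF j'(1) jy(2), of ?V] jy(3)
        by (simp add: j'_def)
      ultimately show ?thesis using j'(2) by simp
    qed
  qed (use i in \<open>simp_all add: iet_mult\<close>)
  then show ?thesis
    using IET.inv_solve_right[of "diag m ?V" "?\<phi> \<odot> diag m W" ?\<phi>] i by (simp add: iet_mult iet_inv)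
qed

text \<open>Passing from a map supported in the first block to its rescaling \<open>k\<close> on the whole interval multiplies
  both lengths and displacements by \<open>m\<close>.\<close>

lemma cls_rescale:
  assumes k: "iet k"
  shows "cls k = rot.displacement_sum ((real m)\<^sup>2 / 2) (diag m (\<lambda>j. if j = 0 then k else \<one>\<^bsub>IET_group\<^esub>))"
    (is "_ = rot.displacement_sum _ ?h")
proof -
  define \<tau> where "\<tau> = (\<lambda>y. k y - y)"
  have \<tau>: "step_fun \<tau>" unfolding \<tau>_def using k by (rule iet_step)
  define T where "T = \<tau> ` unit_interval"
  have T: "finite T" unfolding T_def using \<tau> by (rule step_fun_finite_range)
  define \<eta> where "\<eta> x = (if x < 1 / real m then Some (\<tau> (real m * x)) else None)" for x
  define F where "F v = (case v of Some t \<Rightarrow> real m * t / 2 | None \<Rightarrow> 0)" for v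
  have \<eta>: "step_fun \<eta>"
  proof -
    have "step_fun (\<lambda>x. if real m * x + 0 \<in> unit_interval then Some (\<tau> (real m * x + 0)) else None)"
      by (rule step_fun_affine[OF step_fun_comp1[OF \<tau>, of Some]]) (use m in simp)
    then show ?thesis by (rule step_fun_cong) (use m in \<open>simp add: \<eta>_def field_simps\<close>)
  qed
  have h: "(real m)\<^sup>2 / 2 * (?h x - x) = F (\<eta> x)" if x: "x \<in> unit_interval" for x
  proof (rule block_cases[OF x m])
    fix j y assume jy: "j < m" "y \<in> unit_interval" "x = (real j + y) / real m"
      "real m * x - real j = y"
    have hx: "?h x = (real j + (if j = 0 then k else \<one>\<^bsub>IET_group\<^esub>) y) / real m"
      unfolding jy(3) by (rule diag_eq[OF jy(1,2)])
    show ?thesis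
    proof (cases "j = 0")
      case True
      then have "\<eta> x = Some (\<tau> y)" "?h x - x = \<tau> y / real m"
        using jy hx m by (simp_all add: \<eta>_def \<tau>_def divide_strict_right_mono diff_divide_distrib)
      then show ?thesis using m by (simp add: F_def power2_eq_square)
    next
      case False
      then have "\<not> x < 1 / real m" using jy m by (simp add: divide_less_cancel)
      then show ?thesis using hx jy False by (simp add: \<eta>_def F_def)
    qed
  qed
  have lev: "level_measure \<eta> (Some t) = level_measure \<tau> t / real m" for t
  proof -
    have "{x \<in> unit_interval. \<eta> x = Some t} = (\<lambda>y. (1 / real m) *\<^sub>R y + 0) ` {y \<in> unit_interval. \<tau> y = t}"
    proof (intro equalityI subsetI)
      fix x assume "x \<in> {x \<in> unit_interval. \<eta> x = Some t}"
      then have "0 \<le> x" "x < 1 / real m" "\<tau> (real m * x) = t" by (auto simp: \<eta>_def split: if_splits)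
      then show "x \<in> (\<lambda>y. (1 / real m) *\<^sub>R y + 0) ` {y \<in> unit_interval. \<tau> y = t}"
        using m by (intro image_eqI[of _ _ "real m * x"]) (auto simp: field_simps)
    next
      fix x assume "x \<in> (\<lambda>y. (1 / real m) *\<^sub>R y + 0) ` {y \<in> unit_interval. \<tau> y = t}"
      then obtain y where y: "0 \<le> y" "y < 1" "\<tau> y = t" "x = y / real m" by auto
      have "1 / real m \<le> 1" using m by simp
      moreover have "y / real m < 1 / real m" using y m by (simp add: divide_strict_right_mono)
      ultimately show "x \<in> {x \<in> unit_interval. \<eta> x = Some t}" using y m by (simp add: \<eta>_def)
    qed
    then show ?thesis by (simp only: measure_lebesgue_affine) simp
  qed
  have scale: "rot_cls (level_measure \<tau> t / real m) (real m * t / 2) = rot_cls (level_measure \<tau> t) (t / 2)" for t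
  proof -
    define l where "l = level_measure \<tau> t"
    have l: "0 \<le> l" "l \<le> 1" using rot.level_measure_bounds[OF \<tau>] by (simp_all add: l_def)
    have "l / real m \<le> l / 1" using l m by (intro divide_left_mono) auto
    then have "l / real m \<le> 1" using l by simp
    then have "rot_cls (l / real m) (real m * (t / 2)) = (\<Sum>i<m. rot_cls (l / real m) (t / 2))"
      using l m by (intro rot.right_of_nat) auto
    also have "\<dots> = rot_cls (\<Sum>i<m. l / real m) (t / 2)"
      using l m by (intro rot.left_sum[symmetric]) auto
    finally show ?thesis using m by (simp add: l_def)
  qed
  have "rot.displacement_sum ((real m)\<^sup>2 / 2) ?h = rot.step_sum (\<lambda>x. F (\<eta> x))"
    unfolding rot.displacement_sum_def by (rule rot.step_sum_cong) (rule h)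
  also have "\<dots> = (\<Sum>c\<in>\<eta> ` unit_interval. rot_cls (level_measure \<eta> c) (F c))"
    by (rule rot.step_sum_refine[OF \<eta>])
  also have "\<dots> = (\<Sum>c\<in>Some ` T. rot_cls (level_measure \<eta> c) (F c))"
  proof (rule sum.mono_neutral_right)
    show "finite (\<eta> ` unit_interval)" using \<eta> by (rule step_fun_finite_range)
    show "Some ` T \<subseteq> \<eta> ` unit_interval"
    proof
      fix v assume "v \<in> Some ` T"
      then obtain y where y: "0 \<le> y" "y < 1" "v = Some (\<tau> y)" by (auto simp: T_def)
      have "1 / real m \<le> 1" "y / real m < 1 / real m" using y m by (simp_all add: divide_strict_right_mono)
      then show "v \<in> \<eta> ` unit_interval"
        using y m by (intro image_eqI[of _ _ "y / real m"]) (simp_all add: \<eta>_def)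
    qed
    show "\<forall>c\<in>\<eta> ` unit_interval - Some ` T. rot_cls (level_measure \<eta> c) (F c) = 0"
    proof
      fix c assume c: "c \<in> \<eta> ` unit_interval - Some ` T"
      then obtain x where x: "0 \<le> x" "c = \<eta> x" by auto
      have "c = None"
      proof (cases "x < 1 / real m")
        case True
        then have "real m * x \<in> unit_interval" using x m by (simp add: field_simps)
        then have "\<eta> x \<in> Some ` T" using True by (auto simp: \<eta>_def T_def)
        then show ?thesis using c x by simp
      qed (simp add: x \<eta>_def)
      then show "rot_cls (level_measure \<eta> c) (F c) = 0"
        using rot.level_measure_bounds[OF \<eta>, of c] by (simp add: F_def)
    qed
  qed
  also have "\<dots> = (\<Sum>t\<in>T. rot_cls (level_measure \<tau> t) (t / 2))"
    by (subst sum.reindex) (simp_all add: lev F_def scale del: in_unit_interval)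
  also have "\<dots> = rot.step_sum (\<lambda>y. \<tau> y / 2)"
    unfolding T_def by (rule rot.step_sum_refine[OF \<tau>, symmetric])
  also have "\<dots> = cls k"
    unfolding cls_eq_displacement_sum[OF k] rot.displacement_sum_def \<tau>_def by simp
  finally show ?thesis by simp
qed

text \<open>A map supported in the first block may be a product of commutators of maps with larger support, but its
  rescaling is a product of commutators all the same: the displacement sum is a homomorphism on the
  whole group.\<close>

proposition derived_rescale:
  assumes k: "iet k"
    and h: "diag m (\<lambda>j. if j = 0 then k else \<one>\<^bsub>IET_group\<^esub>) \<in> iet_derived"
  shows "k \<in> iet_derived"
proof -
  have "cls k = 0"
    unfolding cls_rescale[OF k] by (rule hom_derived_zero[OF rot.displacement_sum_mult h])
  then show ?thesis using cls_eq_0_iff[OF k] by simp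
qed

end

section \<open>First return maps\<close>

lemma funpow_iet_inv:
  assumes "iet g" "x \<in> unit_interval"
  shows "(iet_inv g ^^ n) ((g ^^ n) x) = x" "(g ^^ n) ((iet_inv g ^^ n) x) = x"
proof -
  have "(iet_inv g ^^ n) ((g ^^ n) x) = x \<and> (g ^^ n) ((iet_inv g ^^ n) x) = x"
  proof (induction n)
    case (Suc n)
    have "(iet_inv g ^^ Suc n) ((g ^^ Suc n) x) = (iet_inv g ^^ n) (iet_inv g (g ((g ^^ n) x)))"
      by (simp add: funpow_swap1)
    moreover have "(g ^^ Suc n) ((iet_inv g ^^ Suc n) x) = (g ^^ n) (g (iet_inv g ((iet_inv g ^^ n) x)))"
      by (simp add: funpow_swap1)
    ultimately show ?case
      using Suc iet_inv_app1[OF assms(1) iet_funpow_range[OF assms]]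
        iet_inv_app2[OF assms(1) iet_funpow_range[OF iet_inv[OF assms(1)] assms(2)]] by simp
  qed simp
  then show "(iet_inv g ^^ n) ((g ^^ n) x) = x" "(g ^^ n) ((iet_inv g ^^ n) x) = x" by blast+
qed

lemma funpow_iet_inv_diff:
  assumes "iet g" "x \<in> unit_interval" "j \<le> n"
  shows "(iet_inv g ^^ j) ((g ^^ n) x) = (g ^^ (n - j)) x"
proof -
  have "(g ^^ n) x = (g ^^ j) ((g ^^ (n - j)) x)"
    using assms(3) by (metis comp_apply funpow_add le_add_diff_inverse)
  then show ?thesis
    using funpow_iet_inv(1)[OF assms(1) iet_funpow_range[OF assms(1,2)], of j "n - j"] by simp
qed

text \<open>The points of \<open>C\<close> cut \<open>J\<close> into pieces that move rigidly until they return to \<open>J\<close>.\<close>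

definition return_cuts :: "(real \<Rightarrow> real) \<Rightarrow> real set \<Rightarrow> real set \<Rightarrow> bool" where
  "return_cuts g J C \<longleftrightarrow> (\<forall>x y. 0 \<le> x \<longrightarrow> x \<le> y \<longrightarrow> y < 1 \<longrightarrow> C \<inter> {x<..y} = {} \<longrightarrow>
     (x \<in> J \<longleftrightarrow> y \<in> J) \<and>
     (x \<in> J \<longrightarrow> (\<forall>i. (\<forall>j. 0 < j \<longrightarrow> j < i \<longrightarrow> (g ^^ j) x \<notin> J) \<longrightarrow>
        (\<forall>z. x \<le> z \<longrightarrow> z \<le> y \<longrightarrow> (g ^^ i) z = (g ^^ i) x + (z - x) \<and> ((g ^^ i) z \<in> J \<longleftrightarrow> (g ^^ i) x \<in> J)))))"

lemma return_cutsD: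
  assumes "return_cuts g J C" "0 \<le> x" "x \<le> y" "y < 1" "C \<inter> {x<..y} = {}"
  shows "x \<in> J \<longleftrightarrow> y \<in> J"
    and "x \<in> J \<Longrightarrow> (\<And>j. 0 < j \<Longrightarrow> j < i \<Longrightarrow> (g ^^ j) x \<notin> J) \<Longrightarrow> x \<le> z \<Longrightarrow> z \<le> y \<Longrightarrow>
      (g ^^ i) z = (g ^^ i) x + (z - x) \<and> ((g ^^ i) z \<in> J \<longleftrightarrow> (g ^^ i) x \<in> J)"
proof -
  have r: "(x \<in> J \<longleftrightarrow> y \<in> J) \<and>
     (x \<in> J \<longrightarrow> (\<forall>i. (\<forall>j. 0 < j \<longrightarrow> j < i \<longrightarrow> (g ^^ j) x \<notin> J) \<longrightarrow>
        (\<forall>z. x \<le> z \<longrightarrow> z \<le> y \<longrightarrow> (g ^^ i) z = (g ^^ i) x + (z - x) \<and> ((g ^^ i) z \<in> J \<longleftrightarrow> (g ^^ i) x \<in> J))))"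
    by (rule assms(1)[unfolded return_cuts_def, rule_format, OF assms(2-5)])
  show "x \<in> J \<longleftrightarrow> y \<in> J" using r by (rule conjunct1)
  show "(g ^^ i) z = (g ^^ i) x + (z - x) \<and> ((g ^^ i) z \<in> J \<longleftrightarrow> (g ^^ i) x \<in> J)"
    if "x \<in> J" "\<And>j. 0 < j \<Longrightarrow> j < i \<Longrightarrow> (g ^^ j) x \<notin> J" "x \<le> z" "z \<le> y"
    by (rule conjunct2[OF r, rule_format, OF that])
qed

lemma no_cut_mono: "A \<inter> {a<..b} = {} \<Longrightarrow> B \<subseteq> A \<Longrightarrow> c \<le> b \<Longrightarrow> B \<inter> {a<..c} = {}"
  for a b c :: real
  by fastforce

text \<open>It suffices to cut at the cut points of the map and of \<open>J\<close>, and at the points whose orbit meets one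
  of these no later than it returns to \<open>J\<close>.\<close>

lemma return_cells:
  assumes g: "iet g" and J: "step_fun (\<lambda>x. x \<in> J)"
  shows "\<exists>C. finite C \<and> return_cuts g J C"
proof -
  obtain E where E: "finite E"
    and cutE: "\<And>x y. 0 \<le> x \<Longrightarrow> x \<le> y \<Longrightarrow> y < 1 \<Longrightarrow> E \<inter> {x<..y} = {} \<Longrightarrow> g x - x = g y - y"
    using iet_step[OF g] by (auto elim: step_funE)
  obtain D where D: "finite D"
    and cutD: "\<And>x y. 0 \<le> x \<Longrightarrow> x \<le> y \<Longrightarrow> y < 1 \<Longrightarrow> D \<inter> {x<..y} = {} \<Longrightarrow> x \<in> J \<longleftrightarrow> y \<in> J"
    using J by (auto elim: step_funE)
  define q where "q = iet_inv g"
  define orig where "orig e = (q ^^ (LEAST k. 0 < k \<and> (q ^^ k) e \<in> J)) e" for e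
  define C where "C = E \<union> D \<union> orig ` (E \<union> D)"
  have gr: "(g ^^ i) z \<in> unit_interval" if "0 \<le> z" "z < 1" for i z
    using iet_funpow_range[OF g] that by simp
  have main: "(\<forall>z. x \<le> z \<longrightarrow> z \<le> y \<longrightarrow> (g ^^ i) z = (g ^^ i) x + (z - x)) \<and> (E \<union> D) \<inter> {(g ^^ i) x<..(g ^^ i) y} = {}"
    if xy: "0 \<le> x" "x \<le> y" "y < 1" "C \<inter> {x<..y} = {}" "x \<in> J"
      and ret: "\<And>j. 0 < j \<Longrightarrow> j < i \<Longrightarrow> (g ^^ j) x \<notin> J" for x y i
    using ret
  proof (induction i rule: less_induct)
    case (less i)
    have IH: "(\<forall>z. x \<le> z \<longrightarrow> z \<le> y \<longrightarrow> (g ^^ j) z = (g ^^ j) x + (z - x)) \<and> (E \<union> D) \<inter> {(g ^^ j) x<..(g ^^ j) y} = {}"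
      if "j < i" for j
      using that less.prems by (intro less.IH) auto
    have notJ: "(g ^^ j) z \<in> J \<longleftrightarrow> (g ^^ j) x \<in> J" if "j < i" "x \<le> z" "z \<le> y" for j z
    proof -
      have "(g ^^ j) x \<le> (g ^^ j) z" "(g ^^ j) z \<le> (g ^^ j) y"
        using IH[OF that(1), THEN conjunct1, rule_format, of z]
          IH[OF that(1), THEN conjunct1, rule_format, of y] that xy by simp_all
      moreover from this have "D \<inter> {(g ^^ j) x<..(g ^^ j) z} = {}"
        by (intro no_cut_mono[OF IH[OF that(1), THEN conjunct2]]) auto
      ultimately show ?thesis
        using cutD[of "(g ^^ j) x" "(g ^^ j) z"] gr[of x j] gr[of z j] that xy by auto
    qed
    show ?case
    proof (cases i)
      case 0
      then show ?thesis using xy by (auto simp: C_def)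
    next
      case (Suc n)
      have n: "n < i" using Suc by simp
      have tr: "(g ^^ i) z = (g ^^ i) x + (z - x)" if "x \<le> z" "z \<le> y" for z
      proof -
        have *: "(g ^^ n) z = (g ^^ n) x + (z - x)" "(g ^^ n) y = (g ^^ n) x + (y - x)"
          using IH[OF n, THEN conjunct1, rule_format, of z]
            IH[OF n, THEN conjunct1, rule_format, of y] that xy by simp_all
        then have "E \<inter> {(g ^^ n) x<..(g ^^ n) z} = {}"
          by (intro no_cut_mono[OF IH[OF n, THEN conjunct2]]) (use that in auto)
        then have "g ((g ^^ n) x) - (g ^^ n) x = g ((g ^^ n) z) - (g ^^ n) z"
        proof (rule cutE[rotated -1])
          show "0 \<le> (g ^^ n) x" using gr[of x n] xy by simp
          show "(g ^^ n) x \<le> (g ^^ n) z" using * that by simp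
          show "(g ^^ n) z < 1" using gr[of z n] xy that by simp
        qed
        then show ?thesis using *(1) unfolding Suc by simp
      qed
      moreover have "(E \<union> D) \<inter> {(g ^^ i) x<..(g ^^ i) y} = {}"
      proof (rule ccontr)
        assume "(E \<union> D) \<inter> {(g ^^ i) x<..(g ^^ i) y} \<noteq> {}"
        then obtain e where "e \<in> (E \<union> D) \<inter> {(g ^^ i) x<..(g ^^ i) y}" by blast
        then have e: "e \<in> E \<union> D" "(g ^^ i) x < e" "e \<le> (g ^^ i) y" by simp_all
        define z where "z = x + (e - (g ^^ i) x)"
        have z: "x < z" "z \<le> y" using e tr[of y] xy by (auto simp: z_def)
        then have ge: "(g ^^ i) z = e" using tr[of z] by (simp add: z_def)
        have zI: "z \<in> unit_interval" using z xy by simp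
        have qe: "(q ^^ j) e = (g ^^ (i - j)) z" if "j \<le> i" for j
          using funpow_iet_inv_diff[OF g zI that] ge by (simp add: q_def)
        have "(LEAST k. 0 < k \<and> (q ^^ k) e \<in> J) = i"
        proof (rule Least_equality)
          show "0 < i \<and> (q ^^ i) e \<in> J"
            using qe[of i] notJ[of 0 z] z xy Suc by simp
          fix k assume k: "0 < k \<and> (q ^^ k) e \<in> J"
          show "i \<le> k"
          proof (rule ccontr)
            assume "\<not> i \<le> k"
            then have "(g ^^ (i - k)) x \<in> J"
              using k qe[of k] notJ[of "i - k" z] z by simp
            then show False using less.prems[of "i - k"] k \<open>\<not> i \<le> k\<close> by simp
          qed
        qed
        then have "orig e = z" using qe[of i] by (simp add: orig_def)
        then have "z \<in> C" using e by (auto simp: C_def)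
        then show False using z xy by auto
      qed
      ultimately show ?thesis by blast
    qed
  qed
  show ?thesis unfolding return_cuts_def
  proof (intro exI conjI allI impI)
    show "finite C" using E D by (simp add: C_def)
    fix x y :: real assume xy: "0 \<le> x" "x \<le> y" "y < 1" "C \<inter> {x<..y} = {}"
    show "x \<in> J \<longleftrightarrow> y \<in> J" using xy by (intro cutD) (auto simp: C_def)
    fix i z assume *: "x \<in> J" "\<forall>j. 0 < j \<longrightarrow> j < i \<longrightarrow> (g ^^ j) x \<notin> J" "x \<le> z" "z \<le> y"
    have "C \<inter> {x<..z} = {}" using xy * by force
    then have m: "(\<forall>z'. x \<le> z' \<longrightarrow> z' \<le> z \<longrightarrow> (g ^^ i) z' = (g ^^ i) x + (z' - x)) \<and> (E \<union> D) \<inter> {(g ^^ i) x<..(g ^^ i) z} = {}"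
      by (intro main) (use xy * in auto)
    show tr: "(g ^^ i) z = (g ^^ i) x + (z - x)"
      by (rule m[THEN conjunct1, rule_format]) (use * in auto)
    have "(g ^^ i) x \<in> J \<longleftrightarrow> (g ^^ i) z \<in> J"
    proof (rule cutD)
      show "0 \<le> (g ^^ i) x" "(g ^^ i) z < 1" using gr[of x i] gr[of z i] * xy by simp_all
      show "(g ^^ i) x \<le> (g ^^ i) z" using tr * by simp
      show "D \<inter> {(g ^^ i) x<..(g ^^ i) z} = {}" using m[THEN conjunct2] by blast
    qed
    then show "(g ^^ i) z \<in> J \<longleftrightarrow> (g ^^ i) x \<in> J" by (rule sym)
  qed
qed

text \<open>Poincare recurrence, for every point: a piece that never returned would have infinitely many
  disjoint images of the same length.\<close>

lemma recurrence:
  assumes g: "iet g" and J: "step_fun (\<lambda>x. x \<in> J)" and x: "x \<in> unit_interval" "x \<in> J"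
  shows "\<exists>k>0. (g ^^ k) x \<in> J"
proof (rule ccontr)
  assume "\<not> ?thesis"
  then have never: "\<And>k. 0 < k \<Longrightarrow> (g ^^ k) x \<notin> J" by blast
  obtain C where C: "finite C"
    and cuts: "return_cuts g J C"
    using return_cells[OF g J] by blast
  note cell = return_cutsD(2)[OF cuts]
  define w where "w = Min (insert 1 {c \<in> C. x < c})"
  have "w \<in> insert 1 {c \<in> C. x < c}" unfolding w_def using C by (intro Min_in) auto
  then have w: "x < w" using x by auto
  have w_le: "w \<le> c" if "c = 1 \<or> c \<in> C \<and> x < c" for c
    unfolding w_def using C that by (intro Min_le) auto
  define y where "y = (x + w) / 2"
  define \<delta> where "\<delta> = y - x"
  have y: "x < y" "y < w" "y < 1" "0 < \<delta>" using w w_le[of 1] by (auto simp: y_def \<delta>_def)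
  have "C \<inter> {x<..y} = {}" using w_le y by force
  then have tr: "(g ^^ i) z = (g ^^ i) x + (z - x)" "(g ^^ i) z \<in> J \<longleftrightarrow> (g ^^ i) x \<in> J"
    if "x \<le> z" "z \<le> y" for i z
    using cell[of x y i z] x y never that \<open>C \<inter> {x<..y} = {}\<close> by auto
  have rng: "(g ^^ i) x \<in> unit_interval" for i by (rule iet_funpow_range[OF g x(1)])
  \<comment> \<open>Two points of the orbit are closer than \<open>\<delta>\<close>, so the images of the piece \<open>[x, y]\<close> overlap.\<close>
  define b where "b i = nat \<lfloor>(g ^^ i) x / \<delta>\<rfloor>" for i
  have "b i \<le> nat \<lfloor>1 / \<delta>\<rfloor>" for i
    unfolding b_def using rng[of i] y by (intro nat_mono floor_mono divide_right_mono) auto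
  then have "finite (range b)" by (intro finite_subset[of "range b" "{..nat \<lfloor>1 / \<delta>\<rfloor>}"]) auto
  then have "\<not> inj b" using finite_imageD infinite_UNIV_nat by blast
  then obtain i0 j0 where ij0: "i0 \<noteq> j0" "b i0 = b j0" by (auto simp: inj_def)
  obtain i j where ij: "i \<noteq> j" "b i = b j" "(g ^^ i) x \<le> (g ^^ j) x"
  proof (cases "(g ^^ i0) x \<le> (g ^^ j0) x")
    case True
    then show thesis using that[of i0 j0] ij0 by auto
  next
    case False
    then show thesis using that[of j0 i0] ij0 by auto
  qed
  have "0 \<le> (g ^^ i) x / \<delta>" "0 \<le> (g ^^ j) x / \<delta>" using rng[of i] rng[of j] y by auto
  then have "\<lfloor>(g ^^ i) x / \<delta>\<rfloor> = \<lfloor>(g ^^ j) x / \<delta>\<rfloor>"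
    using ij(2) unfolding b_def by (metis nat_eq_iff2 zero_le_floor)
  then have "(g ^^ j) x / \<delta> - (g ^^ i) x / \<delta> < 1" by linarith
  then have "(g ^^ j) x - (g ^^ i) x < \<delta>" using y by (simp add: field_simps)
  moreover define z where "z = x + ((g ^^ j) x - (g ^^ i) x)"
  ultimately have z: "x \<le> z" "z \<le> y" using ij by (auto simp: \<delta>_def)
  then have eq: "(g ^^ i) z = (g ^^ j) x" using tr(1)[of z i] by (simp add: z_def)
  have zI: "z \<in> unit_interval" using z x y by simp
  have "z \<in> J" using tr(2)[of z 0] z x by simp
  show False
  proof (cases "i < j")
    case True
    have "(iet_inv g ^^ i) ((g ^^ i) z) = (iet_inv g ^^ i) ((g ^^ j) x)" using eq by simp
    then have "z = (g ^^ (j - i)) x"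
      using funpow_iet_inv(1)[OF g zI] funpow_iet_inv_diff[OF g x(1), of i j] True by simp
    then show False using never[of "j - i"] True \<open>z \<in> J\<close> by simp
  next
    case False
    then have "j < i" using ij by simp
    have "(iet_inv g ^^ j) ((g ^^ i) z) = (iet_inv g ^^ j) ((g ^^ j) x)" using eq by simp
    then have "(g ^^ (i - j)) z = x"
      using funpow_iet_inv(1)[OF g x(1)] funpow_iet_inv_diff[OF g zI, of j i] \<open>j < i\<close> by simp
    then show False using never[of "i - j"] tr(2)[of z "i - j"] z \<open>j < i\<close> x by simp
  qed
qed

text \<open>The time of first return to \<open>J\<close>, and the first return map extended by the identity outside \<open>J\<close>: the
  value 0 of the return time there makes the map the identity.\<close>

definition return_time :: "(real \<Rightarrow> real) \<Rightarrow> real set \<Rightarrow> real \<Rightarrow> nat" where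
  "return_time g J x = (if x \<in> J then LEAST k. 0 < k \<and> (g ^^ k) x \<in> J else 0)"

definition return_map :: "(real \<Rightarrow> real) \<Rightarrow> real set \<Rightarrow> real \<Rightarrow> real" where
  "return_map g J = restrict (\<lambda>x. (g ^^ return_time g J x) x) unit_interval"

lemma step_fun_funpow:
  assumes g: "iet g"
  shows "step_fun (\<lambda>x. (g ^^ k) x - x)"
proof (induction k)
  case (Suc k)
  have "step_fun (\<lambda>x. g ((g ^^ k) x) - (g ^^ k) x)"
    by (rule step_fun_compose[OF iet_step[OF g] Suc]) (use iet_funpow_range[OF g] in simp)
  then have "step_fun (\<lambda>x. (g ((g ^^ k) x) - (g ^^ k) x) + ((g ^^ k) x - x))"
    using Suc by (rule step_fun_comp2)
  then show ?case by simp
qed simp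

context
  fixes g J
  assumes g: "iet g" and J: "step_fun (\<lambda>x. x \<in> J)" "J \<subseteq> unit_interval"
begin

lemma return_time_props:
  assumes "x \<in> J"
  shows "0 < return_time g J x" "(g ^^ return_time g J x) x \<in> J"
    and "\<And>j. 0 < j \<Longrightarrow> j < return_time g J x \<Longrightarrow> (g ^^ j) x \<notin> J"
proof -
  have "\<exists>k. 0 < k \<and> (g ^^ k) x \<in> J" using recurrence[OF g J(1)] assms J(2) by blast
  then have "0 < return_time g J x \<and> (g ^^ return_time g J x) x \<in> J"
    unfolding return_time_def using assms LeastI_ex[of "\<lambda>k. 0 < k \<and> (g ^^ k) x \<in> J"] by simp
  then show "0 < return_time g J x" "(g ^^ return_time g J x) x \<in> J" by blast+
  show "(g ^^ j) x \<notin> J" if "0 < j" "j < return_time g J x" for j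
    using that assms not_less_Least[of j "\<lambda>k. 0 < k \<and> (g ^^ k) x \<in> J"] by (auto simp: return_time_def)
qed

lemma return_time_eqI:
  assumes "x \<in> J" "0 < k" "(g ^^ k) x \<in> J" "\<And>j. 0 < j \<Longrightarrow> j < k \<Longrightarrow> (g ^^ j) x \<notin> J"
  shows "return_time g J x = k"
  using return_time_props[OF assms(1)] assms(2-) by (metis linorder_neqE_nat)

lemma step_fun_return_time: "step_fun (return_time g J)"
proof -
  obtain C where C: "finite C"
    and cuts: "return_cuts g J C"
    using return_cells[OF g J(1)] by blast
  note cell = return_cutsD[OF cuts]
  show ?thesis
  proof (rule step_funI[OF C])
    fix x y :: real assume xy: "0 \<le> x" "x \<le> y" "y < 1" "C \<inter> {x<..y} = {}"
    show "return_time g J x = return_time g J y"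
    proof (cases "x \<in> J")
      case True
      note r = return_time_props[OF True]
      have same: "(g ^^ i) y \<in> J \<longleftrightarrow> (g ^^ i) x \<in> J" if "i \<le> return_time g J x" for i
      proof -
        have "(g ^^ i) y = (g ^^ i) x + (y - x) \<and> ((g ^^ i) y \<in> J \<longleftrightarrow> (g ^^ i) x \<in> J)"
          by (rule cell(2)[OF xy True]) (use r(3) that xy in auto)
        then show ?thesis by (rule conjunct2)
      qed
      have "return_time g J y = return_time g J x"
        using cell(1)[OF xy] True r same by (intro return_time_eqI) auto
      then show ?thesis by simp
    next
      case False
      then show ?thesis using cell(1)[OF xy] by (simp add: return_time_def)
    qed
  qed
qed

lemma return_map_eq: "x \<in> unit_interval \<Longrightarrow> return_map g J x = (g ^^ return_time g J x) x"
  by (simp add: return_map_def)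

lemma return_map_outside: "x \<in> unit_interval \<Longrightarrow> x \<notin> J \<Longrightarrow> return_map g J x = x"
  by (simp add: return_map_def return_time_def)

end

lemma iet_return_map:
  assumes g: "iet g" and J: "step_fun (\<lambda>x. x \<in> J)" "J \<subseteq> unit_interval"
  shows "iet (return_map g J)"
proof -
  define q where "q = iet_inv g"
  have q: "iet q" unfolding q_def using g by (rule iet_inv)
  note rg = return_time_props[OF g J] and rq = return_time_props[OF q J]
  have "iet (restrict (return_map g J) unit_interval)"
  proof (rule iet_restrict_inverseI)
    have "step_fun (\<lambda>x. (\<lambda>k x. (g ^^ k) x - x) (return_time g J x) x)"
      by (rule step_fun_select[OF step_fun_return_time[OF g J]]) (rule step_fun_funpow[OF g])
    then show "step_fun (\<lambda>x. return_map g J x - x)"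
      by (rule step_fun_cong) (simp add: return_map_eq[OF g J])
    fix x assume x: "x \<in> unit_interval"
    show "return_map g J x \<in> unit_interval"
      unfolding return_map_eq[OF g J x] by (rule iet_funpow_range[OF g x])
    show "return_map q J x \<in> unit_interval"
      unfolding return_map_eq[OF q J x] by (rule iet_funpow_range[OF q x])
    show "return_map q J (return_map g J x) = x"
    proof (cases "x \<in> J")
      case True
      define k where "k = return_time g J x"
      note r = rg[OF True, folded k_def]
      have y: "(g ^^ k) x \<in> unit_interval" by (rule iet_funpow_range[OF g x])
      have "return_time q J ((g ^^ k) x) = k"
      proof (rule return_time_eqI[OF q J])
        show "(q ^^ k) ((g ^^ k) x) \<in> J" using funpow_iet_inv(1)[OF g x, of k] True by (simp add: q_def)
        show "(q ^^ j) ((g ^^ k) x) \<notin> J" if "0 < j" "j < k" for j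
          using funpow_iet_inv_diff[OF g x, of j k] r(3)[of "k - j"] that by (simp add: q_def)
      qed (use r in auto)
      then show ?thesis
        using funpow_iet_inv(1)[OF g x, of k] return_map_eq[OF q J y] return_map_eq[OF g J x]
        by (simp add: k_def q_def)
    next
      case False
      then show ?thesis using return_map_outside[OF g J x] return_map_outside[OF q J x] by simp
    qed
    show "return_map g J (return_map q J x) = x"
    proof (cases "x \<in> J")
      case True
      define k where "k = return_time q J x"
      note r = rq[OF True, folded k_def]
      have y: "(q ^^ k) x \<in> unit_interval" by (rule iet_funpow_range[OF q x])
      have gq: "(g ^^ j) ((q ^^ k) x) = (q ^^ (k - j)) x" if "j \<le> k" for j
        using funpow_iet_inv_diff[OF q x that] g by (simp add: q_def)
      have "return_time g J ((q ^^ k) x) = k"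
      proof (rule return_time_eqI[OF g J])
        show "(g ^^ k) ((q ^^ k) x) \<in> J" using gq[of k] True by simp
        show "(g ^^ j) ((q ^^ k) x) \<notin> J" if "0 < j" "j < k" for j
          using gq[of j] r(3)[of "k - j"] that by simp
      qed (use r in auto)
      then show ?thesis
        using gq[of k] return_map_eq[OF g J y] return_map_eq[OF q J x] by (simp add: k_def)
    next
      case False
      then show ?thesis using return_map_outside[OF g J x] return_map_outside[OF q J x] by simp
    qed
  qed
  then show ?thesis by (simp add: return_map_def)
qed


text \<open>Composing a map with the inverse of its first return map leaves a map all of whose orbits are finite:
  an orbit now runs from \<open>J\<close> until its return to \<open>J\<close> and is then closed up.  An orbit that never meets \<open>J\<close> is
  already finite, since the cut points lie in \<open>J\<close>.\<close>

lemma finite_orbits_return_quotient: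
  assumes g: "iet g" and J: "step_fun (\<lambda>x. x \<in> J)" "J \<subseteq> unit_interval"
    and E: "E \<inter> unit_interval \<subseteq> J"
    and cuts: "\<And>x y. 0 \<le> x \<Longrightarrow> x \<le> y \<Longrightarrow> y < 1 \<Longrightarrow> E \<inter> {x<..y} = {} \<Longrightarrow> g x - x = g y - y"
  shows "finite_orbits (g \<odot> iet_inv (return_map g J))"
proof -
  define h where "h = return_map g J"
  have h: "iet h" unfolding h_def using assms by (intro iet_return_map)
  define p where "p = g \<odot> iet_inv h"
  have p: "iet p" unfolding p_def using g h by (simp add: iet_mult iet_inv)
  have ph: "p (h x) = g x" if "x \<in> unit_interval" for x
    unfolding p_def using iet_mult_app[OF g iet_inv[OF h] iet_range[OF h that]] iet_inv_app1[OF h that] by simp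
  have p_out: "p x = g x" if "x \<in> unit_interval" "x \<notin> J" for x
    using ph[OF that(1)] return_map_outside[OF g J that] by (simp add: h_def)
  define q where "q = iet_inv g"
  have q: "iet q" unfolding q_def using g by (rule iet_inv)
  note r = return_time_props[OF g J]
  have gr: "(g ^^ i) x \<in> unit_interval" if "x \<in> unit_interval" for i x
    by (rule iet_funpow_range[OF g that])
  have qr: "(q ^^ i) x \<in> unit_interval" if "x \<in> unit_interval" for i x
    by (rule iet_funpow_range[OF q that])
  have gq: "(g ^^ j) ((q ^^ k) x) = (q ^^ (k - j)) x" if "x \<in> unit_interval" "j \<le> k" for j k x
    using funpow_iet_inv_diff[OF q that] g by (simp add: q_def)
  have qg: "(q ^^ j) ((g ^^ k) x) = (g ^^ (k - j)) x" if "x \<in> unit_interval" "j \<le> k" for j k x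
    using funpow_iet_inv_diff[OF g that] by (simp add: q_def)
  have J_I: "x \<in> unit_interval" if "x \<in> J" for x using that J(2) by blast
  \<comment> \<open>The orbit of \<open>p\<close> through the return point \<open>h b\<close> follows the orbit of \<open>b\<close> under \<open>g\<close>.\<close>
  have tower: "(p ^^ Suc i) (h b) = (g ^^ Suc i) b" if b: "b \<in> J" and i: "Suc i \<le> return_time g J b" for b i
    using i
  proof (induction i)
    case 0
    then show ?case using ph[OF J_I[OF b]] by simp
  next
    case (Suc i)
    then have "(g ^^ Suc i) b \<notin> J" using r(3)[OF b, of "Suc i"] by simp
    moreover have "(p ^^ Suc i) (h b) = (g ^^ Suc i) b" using Suc by simp
    ultimately show ?case using p_out[OF gr[OF J_I[OF b]], of "Suc i"] by simp
  qed
  have h_eq: "h b = (g ^^ return_time g J b) b" if "b \<in> J" for b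
    using return_map_eq[OF g J J_I[OF that]] by (simp add: h_def)
  have closed: "(p ^^ return_time g J b) (h b) = h b" if b: "b \<in> J" for b
    using tower[OF b, of "return_time g J b - 1"] r(1)[OF b] h_eq[OF b] by simp
  \<comment> \<open>The points whose backward orbit avoids \<open>J\<close>; their forward orbit then avoids \<open>J\<close>, too.\<close>
  define K where "K = {x \<in> unit_interval. \<forall>k. (q ^^ k) x \<notin> J}"
  \<comment> \<open>A point of some tower over \<open>J\<close>: it lies strictly below the top.\<close>
  have in_tower: "\<exists>b\<in>J. \<exists>k. x = (g ^^ k) b \<and> k < return_time g J b" if x: "x \<in> unit_interval" "x \<notin> K" for x
  proof -
    obtain k0 where "(q ^^ k0) x \<in> J" using x by (auto simp: K_def)
    define k where "k = (LEAST k. (q ^^ k) x \<in> J)"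
    have k: "(q ^^ k) x \<in> J" "\<And>j. j < k \<Longrightarrow> (q ^^ j) x \<notin> J"
      unfolding k_def using \<open>(q ^^ k0) x \<in> J\<close> by (auto intro: LeastI dest: not_less_Least)
    define b where "b = (q ^^ k) x"
    have "b \<in> J" using k by (simp add: b_def)
    have "x = (g ^^ k) b" using gq[OF x(1), of k k] by (simp add: b_def)
    moreover have "k < return_time g J b"
    proof (rule ccontr)
      assume "\<not> k < return_time g J b"
      then have le: "return_time g J b \<le> k" by simp
      then have "(g ^^ return_time g J b) b = (q ^^ (k - return_time g J b)) x"
        unfolding b_def by (intro gq[OF x(1)]) (simp add: b_def)
      then show False
        using r(1,2)[OF \<open>b \<in> J\<close>] k(2)[of "k - return_time g J b"] le by simp
    qed
    ultimately show ?thesis using \<open>b \<in> J\<close> by blast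
  qed
  have fin_tower: "\<exists>n>0. (p ^^ n) x = x" if x: "x \<in> unit_interval" "x \<notin> K" for x
  proof -
    obtain b k where b: "b \<in> J" "x = (g ^^ k) b" "k < return_time g J b" using in_tower[OF x] by blast
    show ?thesis
    proof (cases k)
      case 0
      then have "x \<in> J" using b by simp
      define b' where "b' = iet_inv h x"
      have b': "b' \<in> unit_interval" "h b' = x"
        unfolding b'_def using iet_range[OF iet_inv[OF h] x(1)] iet_inv_app2[OF h x(1)] by blast+
      have "b' \<in> J"
      proof (rule ccontr)
        assume "b' \<notin> J"
        then have "h b' = b'" unfolding h_def by (rule return_map_outside[OF g J b'(1)])
        then show False using b'(2) \<open>x \<in> J\<close> \<open>b' \<notin> J\<close> by simp
      qed
      then show ?thesis using closed[of b'] b' r(1)[of b'] by auto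
    next
      case (Suc i)
      then have x_eq: "x = (p ^^ k) (h b)" using tower[OF b(1), of i] b by simp
      have "(p ^^ return_time g J b) x = (p ^^ k) ((p ^^ return_time g J b) (h b))"
        unfolding x_eq by (metis add.commute comp_apply funpow_add)
      then have "(p ^^ return_time g J b) x = x" using closed[OF b(1)] x_eq by simp
      then show ?thesis using r(1)[OF b(1)] by blast
    qed
  qed
  have K_J: "x \<notin> J" if "x \<in> K" for x using that by (auto simp: K_def dest: spec[of _ 0])
  have K_g: "g x \<in> K" if x: "x \<in> K" for x
  proof -
    have xI: "x \<in> unit_interval" using x by (simp add: K_def)
    have "(q ^^ k) (g x) \<notin> J" for k
    proof (cases k)
      case (Suc i)
      then show ?thesis using x g xI by (simp add: K_def q_def funpow_swap1)
    next
      case 0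
      have "g x \<notin> J"
      proof
        assume gx: "g x \<in> J"
        define b where "b = iet_inv h (g x)"
        have gxI: "g x \<in> unit_interval" using J_I[OF gx] .
        have b: "b \<in> unit_interval" "h b = g x"
          unfolding b_def using iet_range[OF iet_inv[OF h] gxI] iet_inv_app2[OF h gxI] by blast+
        have bJ: "b \<in> J"
        proof (rule ccontr)
          assume "b \<notin> J"
          then have "h b = b" unfolding h_def by (rule return_map_outside[OF g J b(1)])
          then show False using b(2) gx \<open>b \<notin> J\<close> by simp
        qed
        define n where "n = return_time g J b - 1"
        have n: "return_time g J b = Suc n" using r(1)[OF bJ] by (simp add: n_def)
        have "g ((g ^^ n) b) = g x" using h_eq[OF bJ] b(2) n by simp
        then have "(g ^^ n) b = x" using iet_inj[OF g] gr[OF b(1)] xI by blast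
        then have "(q ^^ n) x = b" using qg[OF b(1), of n n] by simp
        then show False using bJ x by (auto simp: K_def)
      qed
      then show ?thesis using 0 by simp
    qed
    then show ?thesis using iet_range[OF g xI] by (simp add: K_def)
  qed
  have K_step: "step_fun (\<lambda>x. x \<in> K)"
  proof -
    define M where "M = Suc (Max (return_time g J ` unit_interval))"
    have bound: "return_time g J b < M" if "b \<in> J" for b
      unfolding M_def using step_fun_finite_range[OF step_fun_return_time[OF g J]] J_I[OF that]
      by (intro le_imp_less_Suc Max_ge) auto
    have "step_fun (\<lambda>x. (q ^^ k) x \<notin> J)" for k
    proof -
      have "step_fun (\<lambda>x. (q ^^ k) x \<in> J)"
        by (rule step_fun_compose[OF J(1) step_fun_funpow[OF q]]) (use qr in simp)
      then show ?thesis by (rule step_fun_comp1)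
    qed
    then have "step_fun (\<lambda>x. \<forall>k\<in>{..<M}. (q ^^ k) x \<notin> J)"
      by (intro step_fun_finite_Ball) simp_all
    then show ?thesis
    proof (rule step_fun_cong)
      fix x :: real assume "0 \<le> x" "x < 1"
      then have x: "x \<in> unit_interval" by simp
      show "(\<forall>k\<in>{..<M}. (q ^^ k) x \<notin> J) = (x \<in> K)"
      proof
        assume *: "\<forall>k\<in>{..<M}. (q ^^ k) x \<notin> J"
        show "x \<in> K"
        proof (rule ccontr)
          assume "x \<notin> K"
          then obtain b k where b: "b \<in> J" "x = (g ^^ k) b" "k < return_time g J b"
            using in_tower[OF x] by blast
          then have "(q ^^ k) x \<in> J" using qg[OF J_I[OF b(1)], of k k] by simp
          then show False using * bound[OF b(1)] b(3) by simp
        qed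
      qed (simp add: K_def)
    qed
  qed
  have K_I: "x \<in> unit_interval" if "x \<in> K" for x using that by (simp add: K_def)
  \<comment> \<open>There are no cut points in \<open>K\<close>, so intervals inside \<open>K\<close> stay intervals forever.\<close>
  have rigid: "(\<forall>z. a \<le> z \<longrightarrow> z \<le> b \<longrightarrow> (g ^^ n) z = (g ^^ n) a + (z - a) \<and> (g ^^ n) z \<in> K)"
    if ab: "a \<le> b" "{a..b} \<subseteq> K" for a b n
  proof (induction n)
    case 0
    then show ?case using ab by auto
  next
    case (Suc n)
    show ?case
    proof (intro allI impI)
      fix z assume z: "a \<le> z" "z \<le> b"
      have tr: "(g ^^ n) u = (g ^^ n) a + (u - a)" "(g ^^ n) u \<in> K" if "a \<le> u" "u \<le> b" for u
        using Suc[rule_format, OF that] by blast+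
      have "E \<inter> {(g ^^ n) a<..(g ^^ n) z} = {}"
      proof (rule ccontr)
        assume "E \<inter> {(g ^^ n) a<..(g ^^ n) z} \<noteq> {}"
        then obtain e where "e \<in> E \<inter> {(g ^^ n) a<..(g ^^ n) z}" by blast
        then have e: "e \<in> E" "(g ^^ n) a < e" "e \<le> (g ^^ n) z" by simp_all
        define u where "u = a + (e - (g ^^ n) a)"
        have u: "a \<le> u" "u \<le> b" using e tr(1)[OF z] z by (simp_all add: u_def)
        have "(g ^^ n) u = e" using tr(1)[OF u] by (simp add: u_def)
        then have "e \<in> K" using tr(2)[OF u] by simp
        then show False using K_J[of e] K_I[of e] e(1) E by blast
      qed
      then have "g ((g ^^ n) a) - (g ^^ n) a = g ((g ^^ n) z) - (g ^^ n) z"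
        using cuts[of "(g ^^ n) a" "(g ^^ n) z"] K_I[OF tr(2)[of a]] K_I[OF tr(2)[OF z]] tr(1)[OF z] z ab by simp
      then show "(g ^^ Suc n) z = (g ^^ Suc n) a + (z - a) \<and> (g ^^ Suc n) z \<in> K"
        using tr(1)[OF z] K_g[OF tr(2)[OF z]] by simp
    qed
  qed
  have fin_K: "\<exists>n>0. (g ^^ n) x = x" if x: "x \<in> K" for x
  proof -
    have K_pow: "(g ^^ i) x \<in> K" for i
      by (induction i) (simp_all add: x K_g)
    obtain D where D: "finite D"
      and cutD: "\<And>x y. 0 \<le> x \<Longrightarrow> x \<le> y \<Longrightarrow> y < 1 \<Longrightarrow> D \<inter> {x<..y} = {} \<Longrightarrow> x \<in> K \<longleftrightarrow> y \<in> K"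
      using K_step by (auto elim: step_funE)
    \<comment> \<open>Two points of the orbit lie in the same component of \<open>K\<close>.  If they differed by \<open>s \<noteq> 0\<close>, then an
      iterate of \<open>g\<close> would move the interval between them by \<open>s\<close> again and again.\<close>
    define F where "F i = D \<inter> {..(g ^^ i) x}" for i
    have "finite (range F)" by (rule finite_subset[of _ "Pow D"]) (use D in \<open>auto simp: F_def\<close>)
    then have "\<not> inj F" using finite_imageD infinite_UNIV_nat by blast
    then obtain i0 j0 where ij0: "i0 \<noteq> j0" "F i0 = F j0" by (auto simp: inj_def)
    define i where "i = min i0 j0"
    define j where "j = max i0 j0"
    have ij: "i < j" "F i = F j" using ij0 by (auto simp: i_def j_def min_def max_def)
    define n where "n = j - i"
    define u where "u = (g ^^ i) x"
    define s where "s = (g ^^ j) x - u"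
    have n: "0 < n" "(g ^^ n) u = u + s"
    proof -
      show "0 < n" using ij by (simp add: n_def)
      have "(g ^^ n) u = (g ^^ (n + i)) x" unfolding u_def by (simp add: funpow_add)
      then show "(g ^^ n) u = u + s" using ij by (simp add: n_def s_def)
    qed
    define lo hi where "lo = min u (u + s)" and "hi = max u (u + s)"
    have sub: "{lo..hi} \<subseteq> K"
    proof
      fix z assume z: "z \<in> {lo..hi}"
      have e: "e \<le> u \<longleftrightarrow> e \<le> u + s" if "e \<in> D" for e
        using ij(2) that by (auto simp: F_def u_def s_def)
      have lohi: "lo \<in> K" "0 \<le> lo" "hi < 1"
        using K_pow[of i] K_pow[of j] K_I[OF K_pow[of i]] K_I[OF K_pow[of j]]
        by (auto simp: lo_def hi_def u_def s_def min_def max_def)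
      have "D \<inter> {lo<..z} = {}" using e z by (force simp: lo_def hi_def min_def max_def split: if_splits)
      then show "z \<in> K" using cutD[of lo z] lohi z by auto
    qed
    have "s = 0"
    proof (rule ccontr)
      assume "s \<noteq> 0"
      have shift: "{lo + real k * s..hi + real k * s} \<subseteq> K \<and> (g ^^ n) (u + real k * s) = u + real (Suc k) * s" for k
      proof (induction k)
        case 0
        then show ?case using sub n by simp
      next
        case (Suc k)
        define a b where "a = lo + real k * s" and "b = hi + real k * s"
        have ab: "a \<le> b" "{a..b} \<subseteq> K" using Suc by (auto simp: a_def b_def lo_def hi_def)
        have uab: "a \<le> u + real k * s" "u + real k * s \<le> b" "a \<le> u + real (Suc k) * s" "u + real (Suc k) * s \<le> b"
          by (auto simp: a_def b_def lo_def hi_def algebra_simps)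
        have tr: "(g ^^ n) z = (g ^^ n) a + (z - a)" "(g ^^ n) z \<in> K" if "a \<le> z" "z \<le> b" for z
          using rigid[OF ab, rule_format, OF that, of n] by blast+
        have "(g ^^ n) a = a + s" using tr(1)[OF uab(1,2)] Suc by (simp add: algebra_simps)
        then have trs: "(g ^^ n) z = z + s" if "a \<le> z" "z \<le> b" for z using tr(1)[OF that] by simp
        have "{lo + real (Suc k) * s..hi + real (Suc k) * s} \<subseteq> K"
        proof
          fix z assume "z \<in> {lo + real (Suc k) * s..hi + real (Suc k) * s}"
          then have z: "a \<le> z - s" "z - s \<le> b" by (auto simp: a_def b_def algebra_simps)
          then show "z \<in> K" using trs[OF z] tr(2)[OF z] by simp
        qed
        moreover have "(g ^^ n) (u + real (Suc k) * s) = u + real (Suc (Suc k)) * s"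
          using trs[OF uab(3,4)] by (simp add: algebra_simps)
        ultimately show ?case by blast
      qed
      obtain k :: nat where k: "1 / \<bar>s\<bar> < real k" using reals_Archimedean2 by blast
      then have "1 < real k * \<bar>s\<bar>" using \<open>s \<noteq> 0\<close> by (simp add: field_simps)
      have "u + real k * s \<in> {lo + real k * s..hi + real k * s}" by (auto simp: lo_def hi_def)
      then have "u + real k * s \<in> unit_interval" using shift[of k] K_I by blast
      moreover have "u \<in> unit_interval" unfolding u_def using K_I[OF K_pow] .
      ultimately have "\<bar>real k * s\<bar> < 1" by auto
      then show False using \<open>1 < real k * \<bar>s\<bar>\<close> by (simp add: abs_mult)
    qed
    then have "(g ^^ i) ((g ^^ n) x) = (g ^^ i) x"
      using n(2) unfolding u_def by (metis add.commute add.right_neutral comp_apply funpow_add)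
    then have "(g ^^ n) x = x"
      by (rule iet_funpow_inj[OF g gr[OF K_I[OF x]] K_I[OF x]])
    then show ?thesis using n by blast
  qed
  have "finite_orbits p"
    unfolding finite_orbits_def
  proof
    fix x assume x: "x \<in> unit_interval"
    show "\<exists>k>0. (p ^^ k) x = x"
    proof (cases "x \<in> K")
      case True
      then obtain n where n: "n > 0" "(g ^^ n) x = x" using fin_K by blast
      have "(p ^^ i) x = (g ^^ i) x \<and> (g ^^ i) x \<in> K" for i
        by (induction i) (use True K_g K_J K_I p_out in auto)
      then show ?thesis using n by auto
    qed (use fin_tower x in blast)
  qed
  then show ?thesis by (simp add: p_def h_def)
qed

section \<open>Concentrating an interval exchange on a short interval\<close>

text \<open>The permutation \<open>\<pi>\<close> applied to \<open>N\<close> blocks of equal length, each of which is translated.\<close>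

definition block_perm :: "nat \<Rightarrow> (nat \<Rightarrow> nat) \<Rightarrow> real \<Rightarrow> real" where
  "block_perm N \<pi> = restrict (\<lambda>x. (real (\<pi> (block N x)) + (real N * x - real (block N x))) / real N) unit_interval"

lemma block_perm_eq:
  "j < N \<Longrightarrow> y \<in> unit_interval \<Longrightarrow> block_perm N \<pi> ((real j + y) / real N) = (real (\<pi> j) + y) / real N"
  using block_point_range[of j N y] by (simp add: block_perm_def)

lemma block_perm_block_perm:
  assumes N: "0 < N" and \<pi>: "\<And>j. j < N \<Longrightarrow> \<pi> j < N \<and> \<sigma> (\<pi> j) = j" and x: "x \<in> unit_interval"
  shows "block_perm N \<pi> x \<in> unit_interval" "block_perm N \<sigma> (block_perm N \<pi> x) = x"
proof -
  have "block_perm N \<pi> x \<in> unit_interval \<and> block_perm N \<sigma> (block_perm N \<pi> x) = x"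
  proof (rule block_cases[OF x N])
    fix j y assume jy: "j < N" "y \<in> unit_interval" "x = (real j + y) / real N"
    have \<pi>j: "\<pi> j < N" "\<sigma> (\<pi> j) = j" using \<pi>[OF jy(1)] by blast+
    have "block_perm N \<pi> x = (real (\<pi> j) + y) / real N"
      unfolding jy(3) by (rule block_perm_eq[OF jy(1,2)])
    moreover have "block_perm N \<sigma> ((real (\<pi> j) + y) / real N) = x"
      unfolding jy(3) block_perm_eq[OF \<pi>j(1) jy(2)] \<pi>j(2) ..
    ultimately show ?thesis using block_point_range[OF \<pi>j(1) jy(2)] by simp
  qed
  then show "block_perm N \<pi> x \<in> unit_interval" "block_perm N \<sigma> (block_perm N \<pi> x) = x" by blast+
qed

lemma iet_block_perm:
  assumes N: "0 < N" and \<pi>: "bij_betw \<pi> {..<N} {..<N}"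
  shows "iet (block_perm N \<pi>)"
proof -
  define \<sigma> where "\<sigma> = inv_into {..<N} \<pi>"
  have 1: "\<pi> j < N \<and> \<sigma> (\<pi> j) = j" if "j < N" for j
    using bij_betw_apply[OF \<pi>, of j] bij_betw_inv_into_left[OF \<pi>, of j] that by (simp add: \<sigma>_def)
  have 2: "\<sigma> j < N \<and> \<pi> (\<sigma> j) = j" if "j < N" for j
    using bij_betw_apply[OF bij_betw_inv_into[OF \<pi>], of j] bij_betw_inv_into_right[OF \<pi>, of j] that
    by (simp add: \<sigma>_def)
  have "iet (restrict (block_perm N \<pi>) unit_interval)"
  proof (rule iet_restrict_inverseI[where \<psi> = "block_perm N \<sigma>"])
    have "step_fun (\<lambda>x. (real (\<pi> (block N x)) - real (block N x)) / real N)"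
      by (rule step_fun_comp1[OF step_fun_block[OF N]])
    then show "step_fun (\<lambda>x. block_perm N \<pi> x - x)"
      by (rule step_fun_cong) (use N in \<open>simp add: block_perm_def field_simps\<close>)
  qed (use block_perm_block_perm[OF N 1] block_perm_block_perm[OF N 2] in \<open>simp_all del: in_unit_interval\<close>)
  then show ?thesis by (simp add: block_perm_def)
qed

lemma permutation_into_initial_segment:
  assumes "Q \<subseteq> {..<N}"
  obtains \<pi> where "bij_betw \<pi> {..<N} {..<N::nat}" "\<And>j. j \<in> Q \<Longrightarrow> \<pi> j < card Q"
proof -
  have Q: "finite Q" using assms finite_subset by blast
  have le: "card Q \<le> N" using card_mono[OF _ assms] by simp
  obtain f where f: "bij_betw f Q {..<card Q}"
    using finite_same_card_bij[OF Q, of "{..<card Q}"] by auto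
  have "card ({..<N} - Q) = card {card Q..<N}" using card_Diff_subset[OF Q assms] by simp
  then obtain f' where f': "bij_betw f' ({..<N} - Q) {card Q..<N}"
    using finite_same_card_bij[of "{..<N} - Q" "{card Q..<N}"] by auto
  define \<pi> where "\<pi> j = (if j \<in> Q then f j else f' j)" for j
  have "bij_betw \<pi> Q {..<card Q}" using f by (subst bij_betw_cong[where g = f]) (simp_all add: \<pi>_def)
  moreover have "bij_betw \<pi> ({..<N} - Q) {card Q..<N}"
    using f' by (subst bij_betw_cong[where g = f']) (simp_all add: \<pi>_def)
  ultimately have "bij_betw \<pi> (Q \<union> ({..<N} - Q)) ({..<card Q} \<union> {card Q..<N})"
    by (rule bij_betw_combine) auto
  moreover have "Q \<union> ({..<N} - Q) = {..<N}" "{..<card Q} \<union> {card Q..<N} = {..<N}" using assms le by auto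
  ultimately have "bij_betw \<pi> {..<N} {..<N}" by simp
  moreover have "\<pi> j < card Q" if "j \<in> Q" for j
    using bij_betw_apply[OF f that] that by (simp add: \<pi>_def)
  ultimately show thesis by (rule that)
qed

text \<open>A map supported in the first of \<open>m\<close> blocks is block diagonal.\<close>

lemma supported_in_first_block:
  assumes H: "iet H" and m: "0 < m" and fix_H: "\<And>x. 1 / real m \<le> x \<Longrightarrow> x < 1 \<Longrightarrow> H x = x"
  obtains k where "iet k" "H = diag m (\<lambda>j. if j = 0 then k else \<one>\<^bsub>IET_group\<^esub>)"
proof -
  have m1: "1 / real m \<le> 1" using m by simp
  have small: "0 \<le> F x \<and> F x < 1 / real m"
    if F: "iet F" "\<And>x. 1 / real m \<le> x \<Longrightarrow> x < 1 \<Longrightarrow> F x = x" and x: "0 \<le> x" "x < 1 / real m" for F x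
  proof -
    have xI: "x \<in> unit_interval" using x m1 by simp
    have Fx: "F x \<in> unit_interval" by (rule iet_range[OF F(1) xI])
    have "F x < 1 / real m"
    proof (rule ccontr)
      assume "\<not> F x < 1 / real m"
      then have "F (F x) = F x" using F(2)[of "F x"] Fx by simp
      then have "F x = x" by (rule iet_inj[OF F(1) _ Fx xI])
      then show False using x \<open>\<not> F x < 1 / real m\<close> by simp
    qed
    then show ?thesis using Fx by simp
  qed
  define H' where "H' = iet_inv H"
  have H': "iet H'" unfolding H'_def using H by (rule iet_inv)
  have fix_H': "H' x = x" if "1 / real m \<le> x" "x < 1" for x
  proof -
    have "0 \<le> x" using that m by (meson order_trans divide_nonneg_nonneg of_nat_0_le_iff zero_le_one)
    then show ?thesis using iet_inv_app1[OF H, of x] fix_H[OF that] that by (simp add: H'_def)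
  qed
  define k where "k = restrict (\<lambda>y. real m * H (y / real m)) unit_interval"
  have scale: "0 \<le> y / real m" "y / real m < 1 / real m" if "y \<in> unit_interval" for y
    using that m by (simp_all add: divide_strict_right_mono)
  have range_scale: "real m * F (y / real m) \<in> unit_interval"
    if F: "iet F" "\<And>x. 1 / real m \<le> x \<Longrightarrow> x < 1 \<Longrightarrow> F x = x" and y: "y \<in> unit_interval" for F y
    using small[OF F scale[OF y]] m by (simp add: field_simps)
  have k: "iet k"
    unfolding k_def
  proof (rule iet_restrict_inverseI[where \<psi> = "\<lambda>y. real m * H' (y / real m)"])
    have "step_fun (\<lambda>x. if (1 / real m) * x + 0 \<in> unit_interval
        then real m * (H ((1 / real m) * x + 0) - ((1 / real m) * x + 0)) else 0)"
      by (rule step_fun_affine[OF step_fun_comp1[OF iet_step[OF H]]]) (use m in simp)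
    then show "step_fun (\<lambda>y. real m * H (y / real m) - y)"
    proof (rule step_fun_cong)
      fix y :: real assume y: "0 \<le> y" "y < 1"
      then have "y / real m \<in> unit_interval" using scale[of y] m1 by simp
      then show "(if (1 / real m) * y + 0 \<in> unit_interval
        then real m * (H ((1 / real m) * y + 0) - ((1 / real m) * y + 0)) else 0) = real m * H (y / real m) - y"
        using m by (simp add: right_diff_distrib)
    qed
    fix y assume y: "y \<in> unit_interval"
    have yI: "y / real m \<in> unit_interval" using scale[OF y] m1 by simp
    show "real m * H (y / real m) \<in> unit_interval" by (rule range_scale[OF H fix_H y])
    show "real m * H' (y / real m) \<in> unit_interval" by (rule range_scale[OF H' fix_H' y])
    show "real m * H' (real m * H (y / real m) / real m) = y"
      using iet_inv_app1[OF H yI] m by (simp add: H'_def)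
    show "real m * H (real m * H' (y / real m) / real m) = y"
      using iet_inv_app2[OF H yI] m by (simp add: H'_def)
  qed
  have "H = diag m (\<lambda>j. if j = 0 then k else \<one>\<^bsub>IET_group\<^esub>)" (is "_ = ?D")
  proof (rule iet_eqI[OF H])
    show "iet ?D" using k by (intro iet_diag[OF m]) (simp add: iet_one)
    fix x assume x: "x \<in> unit_interval"
    show "H x = ?D x"
    proof (rule block_cases[OF x m])
      fix j y assume jy: "j < m" "y \<in> unit_interval" "x = (real j + y) / real m"
      have D: "?D x = (real j + (if j = 0 then k else \<one>\<^bsub>IET_group\<^esub>) y) / real m"
        unfolding jy(3) by (rule diag_eq[OF jy(1,2)])
      show ?thesis
      proof (cases "j = 0")
        case True
        then show ?thesis using D jy m by (simp add: k_def)
      next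
        case False
        then have "1 / real m \<le> x" using jy by (simp add: divide_right_mono)
        then have "H x = x" using fix_H x by simp
        then show ?thesis using D jy False by simp
      qed
    qed
  qed
  then show thesis by (rule that[OF k])
qed

text \<open>The set \<open>J\<close> below consists of the blocks containing a cut point; with sufficiently many blocks its total
  length is at most \<open>1/m\<close>.\<close>

proposition concentrate:
  assumes g: "iet g" and m: "0 < m"
  obtains p t k where "iet p" "finite_orbits p" "iet t" "iet k"
    "g = p \<odot> (iet_inv t \<odot> diag m (\<lambda>j. if j = 0 then k else \<one>\<^bsub>IET_group\<^esub>) \<odot> t)"
proof -
  obtain E where E: "finite E"
    and cuts: "\<And>x y. 0 \<le> x \<Longrightarrow> x \<le> y \<Longrightarrow> y < 1 \<Longrightarrow> E \<inter> {x<..y} = {} \<Longrightarrow> g x - x = g y - y"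
    using iet_step[OF g] by (auto elim: step_funE)
  define n where "n = Suc (card (E \<inter> unit_interval))"
  define N where "N = n * m"
  have N: "0 < N" using m by (simp add: N_def n_def)
  define Q where "Q = block N ` (E \<inter> unit_interval)"
  have Q: "Q \<subseteq> {..<N}" unfolding Q_def using block_bounds(1)[OF _ N] by blast
  have card_Q: "card Q \<le> n" unfolding Q_def n_def using E by (intro le_SucI card_image_le) simp
  define J where "J = {x \<in> unit_interval. block N x \<in> Q}"
  have J: "step_fun (\<lambda>x. x \<in> J)" "J \<subseteq> unit_interval"
  proof -
    show "step_fun (\<lambda>x. x \<in> J)"
      by (rule step_fun_cong[OF step_fun_comp1[OF step_fun_block[OF N], of "\<lambda>j. j \<in> Q"]]) (simp add: J_def)
    show "J \<subseteq> unit_interval" unfolding J_def by blast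
  qed
  have EJ: "E \<inter> unit_interval \<subseteq> J" unfolding J_def Q_def by blast
  define h where "h = return_map g J"
  have h: "iet h" unfolding h_def by (rule iet_return_map[OF g J])
  define p where "p = g \<odot> iet_inv h"
  have p: "iet p" unfolding p_def using g h by (simp add: iet_mult iet_inv)
  have fin: "finite_orbits p"
    unfolding p_def h_def by (rule finite_orbits_return_quotient[OF g J EJ cuts])
  obtain \<pi> where \<pi>: "bij_betw \<pi> {..<N} {..<N}" "\<And>j. j \<in> Q \<Longrightarrow> \<pi> j < card Q"
    using permutation_into_initial_segment[OF Q] by blast
  define t where "t = block_perm N \<pi>"
  have t: "iet t" unfolding t_def by (rule iet_block_perm[OF N \<pi>(1)])
  have t_J: "t x < 1 / real m" if "x \<in> J" for x
  proof -
    have x: "x \<in> unit_interval" "block N x \<in> Q" using that unfolding J_def by blast+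
    have "\<pi> (block N x) < n" using \<pi>(2)[OF x(2)] card_Q by simp
    then have "real (\<pi> (block N x)) + 1 \<le> real n" by linarith
    moreover have "real N * x - real (block N x) < 1" using block_bounds(2)[OF x(1) N] by simp
    ultimately have "real (\<pi> (block N x)) + (real N * x - real (block N x)) < real n" by linarith
    then have "t x < real n / real N"
      using x(1) N unfolding t_def block_perm_def by (simp add: divide_strict_right_mono)
    also have "real n / real N = 1 / real m"
    proof -
      have "n \<noteq> 0" by (simp add: n_def)
      then show ?thesis by (simp add: N_def)
    qed
    finally show ?thesis .
  qed
  define H where "H = t \<odot> h \<odot> iet_inv t"
  have H: "iet H" unfolding H_def using t h by (simp add: iet_mult iet_inv)
  have "H x = x" if x: "1 / real m \<le> x" "x < 1" for x
  proof -
    have "0 \<le> x" using x m by (meson order_trans divide_nonneg_nonneg of_nat_0_le_iff zero_le_one)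
    then have xI: "x \<in> unit_interval" using x by simp
    define y where "y = iet_inv t x"
    have y: "y \<in> unit_interval" "t y = x"
      unfolding y_def using iet_range[OF iet_inv[OF t] xI] iet_inv_app2[OF t xI] by blast+
    then have "y \<notin> J" using t_J[of y] x by auto
    then have "h y = y" unfolding h_def by (rule return_map_outside[OF g J y(1)])
    moreover have "H x = t (h (iet_inv t x))"
      unfolding H_def using t h xI iet_range[OF iet_inv[OF t] xI]
      by (simp add: iet_mult iet_inv del: in_unit_interval)
    ultimately show ?thesis using y by (simp add: y_def)
  qed
  then obtain k where k: "iet k" "H = diag m (\<lambda>j. if j = 0 then k else \<one>\<^bsub>IET_group\<^esub>)"
    using supported_in_first_block[OF H m] by blast
  have "iet_inv t \<odot> H \<odot> t = h"
    unfolding H_def using t h by (simp add: IET.m_assoc IET.inv_solve_left' iet_mult iet_inv)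
  moreover have "g = p \<odot> h"
    unfolding p_def using g h by (simp add: IET.m_assoc iet_mult iet_inv)
  ultimately have "g = p \<odot> (iet_inv t \<odot> diag m (\<lambda>j. if j = 0 then k else \<one>\<^bsub>IET_group\<^esub>) \<odot> t)"
    using k(2) by simp
  then show thesis by (rule that[OF p fin t k(1)])
qed

section \<open>Products of commutators supported on a short interval\<close>

lemma commutatorI:
  "iet a \<Longrightarrow> iet b \<Longrightarrow> a \<odot> b \<odot> iet_inv a \<odot> iet_inv b \<in> iet_commutators"
  by auto

lemma commutatorE:
  assumes "c \<in> iet_commutators"
  obtains a b where "iet a" "iet b" "c = a \<odot> b \<odot> iet_inv a \<odot> iet_inv b"
  using assms by auto

lemma commutator_iet: "c \<in> iet_commutators \<Longrightarrow> iet c"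
  by (auto simp: iet_mult iet_inv)

lemma conj_mult:
  assumes "iet t" "iet a" "iet b"
  shows "(iet_inv t \<odot> a \<odot> t) \<odot> (iet_inv t \<odot> b \<odot> t) = iet_inv t \<odot> (a \<odot> b) \<odot> t"
proof -
  have "t \<odot> (iet_inv t \<odot> (b \<odot> t)) = b \<odot> t"
    using assms by (simp add: IET.m_assoc[symmetric] IET.r_inv iet_mult iet_inv)
  then show ?thesis using assms by (simp add: IET.m_assoc iet_mult iet_inv)
qed

lemma conj_inv:
  assumes "iet t" "iet a"
  shows "iet_inv (iet_inv t \<odot> a \<odot> t) = iet_inv t \<odot> iet_inv a \<odot> t"
proof (rule IET.inv_equality)
  show "(iet_inv t \<odot> iet_inv a \<odot> t) \<odot> (iet_inv t \<odot> a \<odot> t) = \<one>\<^bsub>IET_group\<^esub>"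
    unfolding conj_mult[OF assms(1) iet_inv[OF assms(2)] assms(2)]
    using assms by (simp add: IET.l_inv IET.r_one iet_inv)
qed (use assms in \<open>simp_all add: iet_mult iet_inv\<close>)

lemma commutator_conj:
  assumes "c \<in> iet_commutators" "iet t"
  shows "iet_inv t \<odot> c \<odot> t \<in> iet_commutators"
proof -
  obtain a b where ab: "iet a" "iet b" "c = a \<odot> b \<odot> iet_inv a \<odot> iet_inv b"
    using assms(1) by (rule commutatorE)
  have eq: "(iet_inv t \<odot> a \<odot> t) \<odot> (iet_inv t \<odot> b \<odot> t) \<odot>
      iet_inv (iet_inv t \<odot> a \<odot> t) \<odot> iet_inv (iet_inv t \<odot> b \<odot> t) = iet_inv t \<odot> c \<odot> t"
    unfolding ab(3) using ab(1,2) assms(2) by (simp only: conj_mult conj_inv iet_mult iet_inv)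
  have i: "iet (iet_inv t \<odot> a \<odot> t)" "iet (iet_inv t \<odot> b \<odot> t)"
    using ab(1,2) assms(2) by (simp_all only: iet_mult iet_inv)
  show ?thesis using commutatorI[OF i] unfolding eq .
qed

lemma iet_word: "set ws \<subseteq> iet_commutators \<Longrightarrow> iet (foldr (\<odot>) ws \<one>\<^bsub>IET_group\<^esub>)"
proof (induction ws)
  case Nil
  show ?case by (simp add: iet_one)
next
  case (Cons w ws)
  have "iet w" by (rule commutator_iet) (use Cons.prems in \<open>simp only: list.set insert_subset\<close>)
  moreover have "iet (foldr (\<odot>) ws \<one>\<^bsub>IET_group\<^esub>)"
    by (rule Cons.IH) (use Cons.prems in \<open>simp only: list.set insert_subset\<close>)
  ultimately show ?case by (simp add: iet_mult)
qed

text \<open>Let \<open>k\<close> be a product \<open>w\<^sub>1 \<dots> w\<^sub>l\<close> of fewer than \<open>m\<close> commutators, and let \<open>U\<close> act on block \<open>j\<close> as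
  \<open>w\<^bsub>j+1\<^esub> \<dots> w\<^sub>l\<close>.  The commutator of \<open>U\<close> with the cyclic permutation of the blocks acts on
  the first block as \<open>k\<close> and on block \<open>j\<close> as the inverse of \<open>w\<^sub>j\<close>.  The product of the \<open>w\<^sub>j\<close>, each on its own
  block, is a single commutator because the blocks are disjoint.\<close>

proposition diag_two_commutators:
  assumes ws: "set ws \<subseteq> iet_commutators" and len: "length ws < m"
  defines "k \<equiv> foldr (\<odot>) ws \<one>\<^bsub>IET_group\<^esub>"
  obtains c d where "c \<in> iet_commutators"
    "d \<in> iet_commutators"
    "diag m (\<lambda>j. if j = 0 then k else \<one>\<^bsub>IET_group\<^esub>) = c \<odot> d"
proof -
  have m: "0 < m" using len by simp
  define U where "U j = foldr (\<odot>) (drop j ws) \<one>\<^bsub>IET_group\<^esub>" for j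
  have U: "iet (U j)" for j
    unfolding U_def using ws set_drop_subset[of j ws] by (intro iet_word) blast
  have U_0: "U 0 = k" by (simp add: U_def k_def)
  have U_end: "U j = \<one>\<^bsub>IET_group\<^esub>" if "length ws \<le> j" for j using that by (simp add: U_def)
  have U_Suc: "U j = ws ! j \<odot> U (Suc j)" if "j < length ws" for j
    using that by (simp add: U_def Cons_nth_drop_Suc[symmetric])
  have "\<exists>a b. iet a \<and> iet b \<and> ws ! j = a \<odot> b \<odot> iet_inv a \<odot> iet_inv b" if "j < length ws" for j
  proof -
    have "ws ! j \<in> iet_commutators" using ws that nth_mem by blast
    then show ?thesis by (rule commutatorE) blast
  qed
  then obtain a b where ab: "\<And>j. j < length ws \<Longrightarrow> iet (a j)" "\<And>j. j < length ws \<Longrightarrow> iet (b j)"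
    "\<And>j. j < length ws \<Longrightarrow> ws ! j = a j \<odot> b j \<odot> iet_inv (a j) \<odot> iet_inv (b j)"
    by metis
  have ws_iet: "iet (ws ! j)" if "j < length ws" for j
    using ab[OF that] by (simp add: iet_mult iet_inv)
  \<comment> \<open>The factors \<open>w\<^sub>j\<close> are placed on the blocks \<open>1, \<dots>, l\<close>; nothing is left to do on block 0.\<close>
  define act where "act j \<longleftrightarrow> 0 < j \<and> j \<le> length ws" for j
  define A where "A j = (if act j then a (j - 1) else \<one>\<^bsub>IET_group\<^esub>)" for j
  define B where "B j = (if act j then b (j - 1) else \<one>\<^bsub>IET_group\<^esub>)" for j
  define W where "W j = (if act j then ws ! (j - 1) else \<one>\<^bsub>IET_group\<^esub>)" for j
  have act: "j - 1 < length ws" if "act j" for j using that by (auto simp: act_def)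
  have ABW: "iet (A j)" "iet (B j)" "iet (W j)" for j
    using ab(1,2) ws_iet act by (auto simp: A_def B_def W_def iet_one)
  have W_eq: "W j = A j \<odot> B j \<odot> iet_inv (A j) \<odot> iet_inv (B j)" for j
    using ab(3) act by (simp add: A_def B_def W_def iet_one)
  define \<phi> where "\<phi> = rot 1 (1 / real m)"
  have \<phi>: "iet \<phi>" unfolding \<phi>_def by (rule iet_rot) simp
  define pre where "pre j = (if j = 0 then m - 1 else j - 1)" for j
  define c where "c = diag m U \<odot> \<phi> \<odot> iet_inv (diag m U) \<odot> iet_inv \<phi>"
  define d where "d = diag m A \<odot> diag m B \<odot> iet_inv (diag m A) \<odot> iet_inv (diag m B)"
  have dU: "iet (diag m U)" "iet (diag m (\<lambda>j. iet_inv (U j)))"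
    by (rule iet_diag[OF m U], rule iet_diag[OF m iet_inv[OF U]])
  have "c = diag m U \<odot> (\<phi> \<odot> diag m (\<lambda>j. iet_inv (U j)) \<odot> iet_inv \<phi>)"
    unfolding c_def diag_inv[OF m U] using dU \<phi> by (simp add: IET.m_assoc iet_mult iet_inv)
  also have "\<phi> \<odot> diag m (\<lambda>j. iet_inv (U j)) \<odot> iet_inv \<phi> = diag m (\<lambda>j. iet_inv (U (pre j)))"
    unfolding \<phi>_def pre_def by (rule diag_rot[OF m iet_inv[OF U]])
  also have "diag m U \<odot> \<dots> = diag m (\<lambda>j. U j \<odot> iet_inv (U (pre j)))"
    by (rule diag_mult[OF m U iet_inv[OF U]])
  finally have c: "c = diag m (\<lambda>j. U j \<odot> iet_inv (U (pre j)))" .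
  have d: "d = diag m W"
  proof -
    have "d = diag m (\<lambda>j. A j \<odot> B j \<odot> iet_inv (A j) \<odot> iet_inv (B j))"
      unfolding d_def using ABW by (simp only: diag_inv[OF m] diag_mult[OF m] iet_mult iet_inv)
    then show ?thesis by (simp only: W_eq[symmetric])
  qed
  have "c \<odot> d = diag m (\<lambda>j. U j \<odot> iet_inv (U (pre j)) \<odot> W j)"
    unfolding c d using U ABW(3) by (intro diag_mult[OF m]) (simp_all add: iet_mult iet_inv)
  also have "\<dots> = diag m (\<lambda>j. if j = 0 then k else \<one>\<^bsub>IET_group\<^esub>)"
  proof (rule diag_cong[OF m])
    fix j y assume "j < m"
    have "U j \<odot> iet_inv (U (pre j)) \<odot> W j = (if j = 0 then k else \<one>\<^bsub>IET_group\<^esub>)"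
    proof (cases "j = 0")
      case True
      have "U (pre j) = \<one>\<^bsub>IET_group\<^esub>" unfolding pre_def using True len by (intro U_end) simp
      moreover have "iet k" using U[of 0] U_0 by simp
      ultimately show ?thesis using True U_0 by (simp add: W_def act_def)
    next
      case False
      show ?thesis
      proof (cases "act j")
        case True
        have "U (pre j) = ws ! (j - 1) \<odot> U j"
          using U_Suc[OF act[OF True]] False by (simp add: pre_def)
        then show ?thesis
          using True False U[of j] ws_iet[OF act[OF True]]
          by (simp add: W_def IET.inv_mult_group IET.m_assoc iet_mult iet_inv)
      next
        case no_act: False
        then have "length ws < j" using False by (simp add: act_def)
        then have "U j = \<one>\<^bsub>IET_group\<^esub>" "U (pre j) = \<one>\<^bsub>IET_group\<^esub>"
          using False by (auto simp: pre_def intro!: U_end)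
        then show ?thesis using False no_act by (simp add: W_def iet_one)
      qed
    qed
    then show "(U j \<odot> iet_inv (U (pre j)) \<odot> W j) y = (if j = 0 then k else \<one>\<^bsub>IET_group\<^esub>) y" by simp
  qed
  finally have "diag m (\<lambda>j. if j = 0 then k else \<one>\<^bsub>IET_group\<^esub>) = c \<odot> d" by simp
  moreover have "c \<in> iet_commutators"
    unfolding c_def using dU(1) \<phi> by (rule commutatorI)
  moreover have "d \<in> iet_commutators"
    unfolding d_def using iet_diag[OF m ABW(1)] iet_diag[OF m ABW(2)] by (rule commutatorI)
  ultimately show thesis using that by blast
qed

section \<open>The bound\<close>

lemma commutator_length_le:
  assumes "set ws \<subseteq> derived_set G (carrier G)" "foldr (\<lambda>x y. x \<otimes>\<^bsub>G\<^esub> y) ws \<one>\<^bsub>G\<^esub> = g"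
  shows "commutator_length G g \<le> enat (length ws)"
  unfolding commutator_length_def by (rule INF_lower) (use assms in simp)

lemma commutator_length_witness:
  assumes "commutator_length G g \<le> enat c"
  obtains ws where "set ws \<subseteq> derived_set G (carrier G)"
    "foldr (\<lambda>x y. x \<otimes>\<^bsub>G\<^esub> y) ws \<one>\<^bsub>G\<^esub> = g" "length ws \<le> c"
proof -
  define S where "S = {ws. set ws \<subseteq> derived_set G (carrier G) \<and> foldr (\<lambda>x y. x \<otimes>\<^bsub>G\<^esub> y) ws \<one>\<^bsub>G\<^esub> = g}"
  have le: "Inf ((\<lambda>ws. enat (length ws)) ` S) \<le> enat c"
    using assms by (simp only: commutator_length_def S_def)
  have "S \<noteq> {}"
  proof
    assume "S = {}"
    then show False using le by (simp add: top_enat_def)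
  qed
  then obtain ws0 where "ws0 \<in> S" by blast
  then have "enat (length ws0) \<in> (\<lambda>ws. enat (length ws)) ` S" by blast
  then have "Inf ((\<lambda>ws. enat (length ws)) ` S) \<in> (\<lambda>ws. enat (length ws)) ` S"
    by (rule wellorder_InfI)
  then obtain ws where "ws \<in> S" "Inf ((\<lambda>ws. enat (length ws)) ` S) = enat (length ws)" by blast
  then show thesis using that[of ws] le by (simp add: S_def)
qed

text \<open>The number \<open>n\<close> bounding all commutator lengths enters only through the choice of \<open>m > n\<close> blocks.\<close>

proposition commutator_length_le_3:
  assumes up: "uniformly_perfect IET_group" and g: "g \<in> iet_derived"
  shows "commutator_length IET_group g \<le> 3"
proof -
  obtain n where n: "commutator_width IET_group = enat n"
    using up unfolding uniformly_perfect_def by (cases "commutator_width IET_group") auto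
  define m where "m = Suc n"
  have m: "0 < m" by (simp add: m_def)
  have "iet g" using IET.derived_in_carrier[of "carrier IET_group"] g by auto
  then obtain p t k where ptk: "iet p" "finite_orbits p" "iet t" "iet k"
    "g = p \<odot> (iet_inv t \<odot> diag m (\<lambda>j. if j = 0 then k else \<one>\<^bsub>IET_group\<^esub>) \<odot> t)"
    using concentrate[OF _ m] by blast
  define H where "H = diag m (\<lambda>j. if j = 0 then k else \<one>\<^bsub>IET_group\<^esub>)"
  have H: "iet H" unfolding H_def using ptk(4) by (intro iet_diag[OF m]) (simp add: iet_one)
  have g_eq: "g = p \<odot> (iet_inv t \<odot> H \<odot> t)" using ptk(5) by (simp add: H_def)
  have "cls g = cls p + (- cls t + cls H + cls t)"
    unfolding g_eq using ptk(1,3) H by (simp only: cls_mult cls_inv iet_mult iet_inv)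
  moreover have "cls g = 0" using cls_eq_0_iff[OF \<open>iet g\<close>] g by simp
  moreover have "cls p = 0" by (rule cls_finite_orbits[OF ptk(1,2)])
  ultimately have "cls H = 0" by simp
  then have "H \<in> iet_derived" using cls_eq_0_iff[OF H] by simp
  then have k: "k \<in> iet_derived"
    unfolding H_def by (rule derived_rescale[OF m ptk(4)])
  have "commutator_length IET_group k \<le> commutator_width IET_group"
    unfolding commutator_width_def by (rule SUP_upper[OF k])
  then have "commutator_length IET_group k \<le> enat n" using n by simp
  then obtain ws where ws: "set ws \<subseteq> iet_commutators"
    "foldr (\<odot>) ws \<one>\<^bsub>IET_group\<^esub> = k" "length ws \<le> n"
    by (rule commutator_length_witness)
  have "length ws < m" using ws(3) by (simp add: m_def)
  then obtain c d where cd: "c \<in> iet_commutators"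
    "d \<in> iet_commutators" "H = c \<odot> d"
    unfolding H_def ws(2)[symmetric] by (rule diag_two_commutators[OF ws(1)])
  define c' where "c' = iet_inv t \<odot> c \<odot> t"
  define d' where "d' = iet_inv t \<odot> d \<odot> t"
  have c'd': "c' \<in> iet_commutators" "d' \<in> iet_commutators"
    unfolding c'_def d'_def using commutator_conj[OF cd(1) ptk(3)] commutator_conj[OF cd(2) ptk(3)] by blast+
  have "g = p \<odot> (c' \<odot> d')"
    unfolding g_eq cd(3) c'_def d'_def
    using conj_mult[OF ptk(3) commutator_iet[OF cd(1)] commutator_iet[OF cd(2)]] by simp
  then have "foldr (\<odot>) [p, c', d'] \<one>\<^bsub>IET_group\<^esub> = g"
    using commutator_iet[OF c'd'(2)] by simp
  moreover have "set [p, c', d'] \<subseteq> iet_commutators"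
    using finite_orbits_commutator[OF ptk(1,2)] c'd' by simp
  ultimately have "commutator_length IET_group g \<le> enat (length [p, c', d'])"
    by (intro commutator_length_le)
  then show ?thesis by (simp add: numeral_eq_enat numeral_3_eq_3)
qed

theorem theorem2:
  assumes "uniformly_perfect IET_group"
  shows "commutator_width IET_group \<le> 5"
proof -
  have "commutator_width IET_group \<le> 3"
    unfolding commutator_width_def by (rule SUP_least) (rule commutator_length_le_3[OF assms])
  also have "(3 :: enat) \<le> 5" by simp
  finally show ?thesis .
qed

end
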